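(* Let $m:[0,1]\to(0,\infty)$ be continuous and monotone, and let $n_0\ge 3$ be such that $m(t)\le 2\log n$ for all $t\in[0,1]$ and $n\ge n_0$. For every $n\ge n_0$ let $(\xi_{ni},\eta_{ni})$, $1\le i\le n$, be independent bivariate Gaussian vectors with $\mathbf{E}\xi_{ni}=\mathbf{E}\eta_{ni}=0$, $\mathbf{E}\xi_{ni}^2=\mathbf{E}\eta_{ni}^2=1$ and correlation coefficients $$\rho_{ni}=1-\frac{m(i/n)}{\log n},\qquad 1\le i\le n.$$ Let $M_{n1}=\max_{1\le i\le n}\xi_{ni}$, $M_{n2}=\max_{1\le i\le n}\eta_{ni}$, $m_{n1}=\min_{1\le i\le n}\xi_{ni}$, $m_{n2}=\min_{1\le i\le n}\eta_{ni}$, and let $b_n$ be defined by $1-\Phi(b_n)=1/n$. For $(x_1,y_1),(x_2,y_2)\in\mathbb{R}^2$ put $$P_n=\mathbf{P}\Big(M_{n1}\le b_n+\tfrac{x_2}{b_n},\ M_{n2}\le b_n+\tfrac{y_2}{b_n},\ m_{n1}\le -b_n+\tfrac{x_1}{b_n},\ m_{n2}\le -b_n+\tfrac{y_1}{b_n}\Big).$$ Then for every $(x_1,y_1),(x_2,y_2)\in\mathbb{R}^2$, $$\lim_{n\to\infty}\frac{2\log n}{\log\log n}\Big(P_n-H(x_2,y_2)\widetilde H(x_1,y_1)\Big)$$ $$=H(x_2,y_2)\widetilde H(x_1,y_1)\,e^{-x_2}\int_0^1\sqrt{m(t)}\,\varphi\Big(\sqrt{m(t)}+\frac{y_2-x_2}{2\sqrt{m(t)}}\Big)dt$$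 $$\quad+H(x_2,y_2)H(-x_1,-y_1)\,e^{x_1}\int_0^1\sqrt{m(t)}\,\varphi\Big(\sqrt{m(t)}+\frac{x_1-y_1}{2\sqrt{m(t)}}\Big)dt.$$
   Context: $\log$ is the natural logarithm. $\Phi$ is the standard Gaussian distribution function, $\varphi=\Phi'$ the standard Gaussian density, and $\Lambda(x)=\exp(-e^{-x})$. For $(x,y)\in\mathbb{R}^2$, $$H(x,y)=\exp\left(-e^{-y}\int_0^1\Phi\Big(\sqrt{m(t)}+\frac{x-y}{2\sqrt{m(t)}}\Big)dt-e^{-x}\int_0^1\Phi\Big(\sqrt{m(t)}+\frac{y-x}{2\sqrt{m(t)}}\Big)dt\right),$$ $$\widetilde H(x,y)=1-\Lambda(-x)-\Lambda(-y)+H(-x,-y).$$ *)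

theory Defs
  imports "HOL-Probability.Probability"
begin

definition Phi :: "real \<Rightarrow> real" where
  "Phi x = cdf std_normal_distribution x"

definition Lambda :: "real \<Rightarrow> real" where
  "Lambda x = exp (- exp (- x))"

definition H :: "(real \<Rightarrow> real) \<Rightarrow> real \<Rightarrow> real \<Rightarrow> real" where
  "H m x y = exp
     (- exp (- y) * integral {0..1} (\<lambda>t. Phi (sqrt (m t) + (x - y) / (2 * sqrt (m t))))
      - exp (- x) * integral {0..1} (\<lambda>t. Phi (sqrt (m t) + (y - x) / (2 * sqrt (m t)))))"

definition H_tilde :: "(real \<Rightarrow> real) \<Rightarrow> real \<Rightarrow> real \<Rightarrow> real" where
  "H_tilde m x y = 1 - Lambda (- x) - Lambda (- y) + H m (- x) (- y)"

text \<open>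
  Point masses count as Gaussian: a Gaussian vector with correlation coefficient \<open>-1\<close> or \<open>1\<close>
  has linear combinations that are almost surely constant.
\<close>

definition gaussian_rv :: "'a measure \<Rightarrow> ('a \<Rightarrow> real) \<Rightarrow> bool" where
  "gaussian_rv M X \<longleftrightarrow>
     (\<exists>\<mu> \<sigma>. 0 < \<sigma> \<and> distributed M lborel X (normal_density \<mu> \<sigma>)) \<or>
     X \<in> borel_measurable M \<and> (\<exists>\<mu>. AE \<omega> in M. X \<omega> = \<mu>)"

definition bivariate_gaussian :: "'a measure \<Rightarrow> ('a \<Rightarrow> real) \<Rightarrow> ('a \<Rightarrow> real) \<Rightarrow> bool" where
  "bivariate_gaussian M X Y \<longleftrightarrow>
     X \<in> borel_measurable M \<and> Y \<in> borel_measurable M \<and>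
     (\<forall>a b. gaussian_rv M (\<lambda>\<omega>. a * X \<omega> + b * Y \<omega>))"

definition correlation :: "'a measure \<Rightarrow> ('a \<Rightarrow> real) \<Rightarrow> ('a \<Rightarrow> real) \<Rightarrow> real" where
  "correlation M X Y =
     prob_space.expectation M (\<lambda>\<omega>. (X \<omega> - prob_space.expectation M X) * (Y \<omega> - prob_space.expectation M Y))
     / sqrt (prob_space.variance M X * prob_space.variance M Y)"

definition row_max :: "(nat \<Rightarrow> nat \<Rightarrow> 'a \<Rightarrow> real) \<Rightarrow> nat \<Rightarrow> 'a \<Rightarrow> real" where
  "row_max \<xi> n \<omega> = Max ((\<lambda>i. \<xi> n i \<omega>) ` {1..n})"

definition row_min :: "(nat \<Rightarrow> nat \<Rightarrow> 'a \<Rightarrow> real) \<Rightarrow> nat \<Rightarrow> 'a \<Rightarrow> real" where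
  "row_min \<xi> n \<omega> = Min ((\<lambda>i. \<xi> n i \<omega>) ` {1..n})"

end

theory Submission
  imports Defs "HOL-Real_Asymp.Real_Asymp"
begin

text \<open>
  Put \<open>u = b + x / b\<close> and \<open>v = b + y / b\<close>. The event \<open>X > u \<or> Y > v\<close> splits according to
  which of \<open>X - u\<close> and \<open>Y - v\<close> is larger, and conditioning on the larger coordinate gives each part
  as a Gaussian integral. With \<open>c = b * sqrt (m / (2 ln n))\<close> the correlation is exactly
  \<open>1 - 2 c\<^sup>2 / b\<^sup>2\<close>, and \<open>n\<close> times the probability equals
  \<open>g c = exp (-x) \<Phi>(c + (y - x) / (2 c)) + exp (-y) \<Phi>(c + (x - y) / (2 c))\<close> up to \<open>O(1 / b\<^sup>2)\<close>,
  which is negligible at the scale \<open>ln ln n / ln n\<close>. The correction in the theorem therefore comes only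
  from \<open>c / sqrt m = 1 - ln ln n / (4 ln n) + o(ln ln n / ln n)\<close> together with
  \<open>g' c = 2 exp (-x) \<phi>(c + (y - x) / (2 c))\<close>. As \<open>g' \<ge> 0\<close> and \<open>m\<close> is monotone, replacing row sums by
  integrals costs only \<open>O(1 / n)\<close>. The minima enter through inclusion-exclusion, since one
  vector exceeds a high level in one coordinate and a low level in the other only with probability
  \<open>O(1 / n\<^sup>2)\<close>.
\<close>

subsection \<open>The Gaussian distribution function and its tail\<close>

text \<open>The logarithmic correction comes from the quantile alone:
  \<open>- ln (Phi_bar b)\<close> is \<open>b^2 / 2 + ln b\<close> up to a bounded term, so at
  \<open>b = b n\<close> the gap \<open>2 ln n - b^2\<close> grows like \<open>2 ln b\<close>, that
  is like \<open>ln (ln n)\<close>. Every other error has to be pushed down to order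
  \<open>1 / b^2\<close>, about \<open>1 / ln n\<close>, to stay invisible at this scale. That
  dictates two-sided Mills bounds with relative error of order \<open>1 / z^2\<close> instead of
  mere limits, estimates uniform in the row index, and a rate for Riemann sums, which continuity of
  \<open>m\<close> by itself does not supply. A second obstacle is the description of a Gaussian
  vector by its linear combinations, which may be degenerate: the correlation can equal -1 when
  \<open>m t = 2 ln n\<close>. The law is therefore reached through characteristic functions, and
  the joint distribution is computed only for correlations strictly between -1 and 1, which covers
  all large \<open>n\<close>.\<close>

abbreviation (input) Phi_bar :: "real \<Rightarrow> real" where "Phi_bar z \<equiv> 1 - Phi z"

interpretation std_normal: real_distribution std_normal_distribution
  by (rule real_dist_normal_dist)

lemma std_normal_measure_eq_integral:
  assumes "A \<in> sets borel"
  shows "measure std_normal_distribution A = (LINT x:A|lborel. std_normal_density x)"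
proof -
  have "measure std_normal_distribution A = (LINT x|std_normal_distribution. indicator A x)"
    using assms by simp
  also have "\<dots> = (LINT x|lborel. std_normal_density x *\<^sub>R indicator A x)"
    using assms by (subst integral_density) auto
  finally show ?thesis by (simp add: set_lebesgue_integral_def mult.commute)
qed

lemma std_normal_singleton: "measure std_normal_distribution {x} = 0"
  proof -
  have "(LINT s:{x}|lborel. std_normal_density s) = integral\<^sup>L lborel (\<lambda>s::real. 0::real)"
    unfolding set_lebesgue_integral_def
    by (intro integral_cong_AE AE_mp[OF AE_lborel_singleton[of x] AE_I2])
       (auto split: split_indicator)
  then show ?thesis by (simp add: std_normal_measure_eq_integral)
qed

lemma Phi_lessThan: "measure std_normal_distribution {..<x} = Phi x"
proof -
  have "measure std_normal_distribution ({..<x} \<union> {x}) = measure std_normal_distribution {..<x} + measure std_normal_distribution {x}"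
    by (intro std_normal.finite_measure_Union) auto
  also have "{..<x} \<union> {x} = {..x}" by auto
  finally show ?thesis by (simp add: Phi_def cdf_def std_normal_singleton)
qed

lemma Phi_bar_greaterThan: "measure std_normal_distribution {x<..} = Phi_bar x"
  using std_normal.prob_compl[of "{..x}"]
  by (simp add: Phi_def cdf_def Compl_eq_Diff_UNIV[symmetric] Compl_atMost)

lemma Phi_bar_atLeast: "measure std_normal_distribution {x..} = Phi_bar x"
  using std_normal.prob_compl[of "{..<x}"]
  by (simp add: Phi_lessThan Compl_eq_Diff_UNIV[symmetric] Compl_lessThan)

lemma Phi_nonneg: "0 \<le> Phi x" and Phi_le_1: "Phi x \<le> 1"
  by (auto simp: Phi_def std_normal.cdf_nonneg std_normal.cdf_bounded_prob)

lemma Phi_mono: "x \<le> y \<Longrightarrow> Phi x \<le> Phi y"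
  by (simp add: Phi_def std_normal.cdf_nondecreasing)

lemma Phi_minus: "Phi (- x) = Phi_bar x"
proof -
  have "Phi (-x) = (LBINT s. indicator {..-x} s * std_normal_density s)"
    by (simp add: Phi_def cdf_def std_normal_measure_eq_integral set_lebesgue_integral_def)
  also have "\<dots> = (LBINT s. indicator {..-x} (0 + (-1) * s) * std_normal_density (0 + (-1) * s))"
    using lborel_integral_real_affine[of "-1" "\<lambda>s. indicator {..-x} s * std_normal_density s" 0] by simp
  also have "\<dots> = (LBINT s. indicator {x..} s * std_normal_density s)"
    by (intro Bochner_Integration.integral_cong) (auto simp: std_normal_density_def split: split_indicator)
  also have "\<dots> = Phi_bar x"
    unfolding Phi_bar_atLeast[symmetric]
    by (subst std_normal_measure_eq_integral) (simp_all add: set_lebesgue_integral_def)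
  finally show ?thesis .
qed

text \<open>The fundamental theorem of calculus applies on the window from \<open>x - 1\<close> to
  \<open>x + 1\<close>, where \<open>Phi\<close> is the constant \<open>Phi (x - 1)\<close> plus an
  integral of the continuous density.\<close>

lemma Phi_deriv: "(Phi has_real_derivative std_normal_density x) (at x)"
proof -
  let ?a = "x - 1" and ?b = "x + 1"
  have cont: "continuous_on {?a..?b} std_normal_density"
    unfolding std_normal_density_def by (intro continuous_intros) auto
  have *: "((\<lambda>u. LBINT y=?a..u. std_normal_density y) has_vector_derivative std_normal_density x)
       (at x within {?a..?b})"
    by (rule interval_integral_FTC2[OF _ _ cont]) auto
  have eq: "Phi u = Phi ?a + (LBINT y=?a..u. std_normal_density y)" if "u \<in> {?a<..<?b}" for u
  proof -
    have "Phi u - Phi ?a = measure std_normal_distribution {?a<..u}"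
      unfolding Phi_def by (rule std_normal.cdf_diff_eq) (use that in auto)
    also have "\<dots> = (LBINT y=?a..u. std_normal_density y)"
      using that by (subst std_normal_measure_eq_integral) (auto simp: interval_integral_Ioc)
    finally show ?thesis by simp
  qed
  have "((\<lambda>u. LBINT y=?a..u. std_normal_density y) has_real_derivative std_normal_density x) (at x)"
    using * at_within_interior[of x "{?a..?b}"]
    by (simp add: has_real_derivative_iff_has_vector_derivative interior_atLeastAtMost_real)
  then have "((\<lambda>u. Phi ?a + (LBINT y=?a..u. std_normal_density y)) has_real_derivative std_normal_density x) (at x)"
    by (auto intro!: derivative_eq_intros)
  then show ?thesis
    by (rule has_field_derivative_transform_within_open[where S="{?a<..<?b}"]) (auto simp: eq)
qed

declare Phi_deriv[THEN DERIV_chain2, derivative_intros]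

lemma std_normal_density_has_deriv:
  "(std_normal_density has_real_derivative - x * std_normal_density x) (at x)"
  unfolding std_normal_density_def
  by (rule derivative_eq_intros refl | simp)+

lemma std_normal_density_le_1: "std_normal_density x \<le> 1"
proof -
  have "1 \<le> sqrt (2 * pi)" using pi_gt3 by (simp add: real_le_rsqrt)
  moreover have "exp (- x\<^sup>2 / 2) \<le> 1" by simp
  ultimately have "exp (- x\<^sup>2 / 2) \<le> sqrt (2 * pi)" by linarith
  then show ?thesis by (simp add: std_normal_density_def divide_le_eq)
qed

text \<open>The crude constant 1 is enough, since later only the order of magnitude of an error in
  the argument of \<open>Phi\<close> matters.\<close>

lemma Phi_Lipschitz: "\<bar>Phi x - Phi y\<bar> \<le> \<bar>x - y\<bar>"
proof -
  have "norm (Phi x - Phi y) \<le> 1 * norm (x - y)"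
    by (rule field_differentiable_bound[where S=UNIV and f'=std_normal_density])
       (auto simp: Phi_deriv std_normal_density_le_1)
  then show ?thesis by simp
qed

lemma continuous_on_Phi [continuous_intros]:
  "continuous_on S f \<Longrightarrow> continuous_on S (\<lambda>x. Phi (f x))"
  by (rule continuous_on_compose2[of UNIV Phi])
     (auto intro!: continuous_at_imp_continuous_on DERIV_isCont Phi_deriv)

lemma borel_measurable_Phi [measurable]: "Phi \<in> borel_measurable borel"
  by (intro borel_measurable_continuous_onI continuous_on_Phi continuous_on_id)

lemma continuous_on_std_normal_density [continuous_intros]:
  "continuous_on S f \<Longrightarrow> continuous_on S (\<lambda>x. std_normal_density (f x))"
  unfolding std_normal_density_def by (intro continuous_intros) auto

section \<open>Mills bounds and the mean excess over a level\<close>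

lemma Phi_bar_tendsto_0: "(Phi_bar \<longlongrightarrow> 0) at_top"
  using tendsto_diff[OF tendsto_const std_normal.cdf_lim_at_top_prob, of 1]
  by (simp add: Phi_def)

text \<open>The gap \<open>std_normal_density z / z - Phi_bar z\<close> has derivative
  \<open>- std_normal_density z / z^2\<close> and vanishes at infinity, so it decreases to 0 and is
  positive before.\<close>

lemma Phi_bar_less_Mills:
  assumes "0 < z"
  shows "Phi_bar z < std_normal_density z / z"
proof -
  have "0 < std_normal_density z / z - Phi_bar z"
  proof (rule DERIV_neg_imp_decreasing_at_top[where f="\<lambda>z. std_normal_density z / z - Phi_bar z"])
    fix x assume "z \<le> x"
    then have "((\<lambda>z. std_normal_density z / z - Phi_bar z) has_real_derivative
       - std_normal_density x / x^2) (at x)"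
      using assms by (auto intro!: derivative_eq_intros std_normal_density_has_deriv simp: field_simps power2_eq_square)
    moreover have "- std_normal_density x / x^2 < 0"
      using \<open>z \<le> x\<close> assms normal_density_pos[of 1 0 x] by simp
    ultimately show "\<exists>y. ((\<lambda>z. std_normal_density z / z - Phi_bar z) has_real_derivative y) (at x) \<and> y < 0" by blast
  next
    have "((\<lambda>z. std_normal_density z / z) \<longlongrightarrow> 0) at_top"
      unfolding std_normal_density_def by real_asymp
    from tendsto_diff[OF this Phi_bar_tendsto_0]
    show "((\<lambda>z. std_normal_density z / z - Phi_bar z) \<longlongrightarrow> 0) at_top" by simp
  qed
  then show ?thesis by simp
qed

text \<open>The same argument with one more term of the asymptotic series: the gap now has
  derivative \<open>- 3 * std_normal_density z / z^4\<close>. Together the two bounds fix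
  \<open>Phi_bar z\<close> up to a relative error of order \<open>1 / z^2\<close>.\<close>

lemma Phi_bar_greater_Mills:
  assumes "0 < z"
  shows "std_normal_density z * (1 / z - 1 / z^3) < Phi_bar z"
proof -
  have "0 < Phi_bar z - std_normal_density z * (1 / z - 1 / z^3)"
  proof (rule DERIV_neg_imp_decreasing_at_top[where f="\<lambda>z. Phi_bar z - std_normal_density z * (1 / z - 1 / z^3)"])
    fix x assume "z \<le> x"
    then have "((\<lambda>z. Phi_bar z - std_normal_density z * (1 / z - 1 / z^3)) has_real_derivative
       - 3 * std_normal_density x / x^4) (at x)"
      using assms by (auto intro!: derivative_eq_intros std_normal_density_has_deriv)
        (simp add: field_simps eval_nat_numeral)
    moreover have "- 3 * std_normal_density x / x^4 < 0"
      using \<open>z \<le> x\<close> assms normal_density_pos[of 1 0 x] by simp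
    ultimately show "\<exists>y. ((\<lambda>z. Phi_bar z - std_normal_density z * (1 / z - 1 / z^3)) has_real_derivative y) (at x) \<and> y < 0" by blast
  next
    have "((\<lambda>z. std_normal_density z * (1 / z - 1 / z^3)) \<longlongrightarrow> 0) at_top"
      unfolding std_normal_density_def by real_asymp
    from tendsto_diff[OF Phi_bar_tendsto_0 this]
    show "((\<lambda>z. Phi_bar z - std_normal_density z * (1 / z - 1 / z^3)) \<longlongrightarrow> 0) at_top" by simp
  qed
  then show ?thesis by simp
qed

lemma Phi_bar_pos: "0 < Phi_bar z"
proof -
  \<comment> \<open>The lower Mills bound is positive only for arguments above 1; monotonicity of
    \<open>Phi\<close> then carries positivity from \<open>max z 2\<close> down to
    \<open>z\<close>.\<close>
  have "0 < std_normal_density (max z 2) * (1 / max z 2 - 1 / (max z 2)^3)"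
    by (intro mult_pos_pos normal_density_pos)
       (auto simp: field_simps power_strict_increasing[of 1 3] less_1_mult' max_def eval_nat_numeral intro: less_1_mult)
  also have "\<dots> < Phi_bar (max z 2)" by (rule Phi_bar_greater_Mills) auto
  also have "\<dots> \<le> Phi_bar z" using Phi_mono[of z "max z 2"] by simp
  finally show ?thesis .
qed

text \<open>The mean excess over \<open>u\<close>: as \<open>- std_normal_density\<close> is an
  antiderivative of \<open>s * std_normal_density s\<close>, the first moment over the tail is
  \<open>std_normal_density u\<close>. It measures how far an exceeding coordinate overshoots its
  level and enters the error in \<open>wedge_prob_asymp\<close>.\<close>

lemma partial_expectation:
  assumes "0 \<le> u"
  shows "integrable std_normal_distribution (\<lambda>s. indicator {u<..} s * (s - u))"
    and "(LINT s|std_normal_distribution. indicator {u<..} s * (s - u)) = std_normal_density u - u * Phi_bar u"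
proof -
  have i: "has_bochner_integral lborel (\<lambda>s. indicator {u..} s * (s * std_normal_density s)) (std_normal_density u)"
  proof (rule has_bochner_integral_nn_integral)
    have lim: "((\<lambda>s. - std_normal_density s) \<longlongrightarrow> 0) at_top"
      unfolding std_normal_density_def by real_asymp
    have "(\<integral>\<^sup>+x. ennreal (x * std_normal_density x) * indicator {u ..} x \<partial>lborel) = 0 - (- std_normal_density u)"
    proof (rule nn_integral_FTC_atLeast[OF _ _ _ lim])
      show "((\<lambda>s. - std_normal_density s) has_real_derivative x * std_normal_density x) (at x)" for x
        by (auto intro!: derivative_eq_intros std_normal_density_has_deriv)
    qed (use assms in auto)
    then show "(\<integral>\<^sup>+x. ennreal (indicator {u..} x * (x * std_normal_density x)) \<partial>lborel) = ennreal (std_normal_density u)"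
      by (simp add: indicator_mult_ennreal mult.commute)
  qed (use assms in \<open>auto split: split_indicator\<close>)
  have j: "integrable std_normal_distribution (\<lambda>s. indicator {u..} s * s)"
    "(LINT s|std_normal_distribution. indicator {u..} s * s) = std_normal_density u"
    using i by (auto simp: integrable_density integral_density has_bochner_integral_iff mult_ac)
  have k: "integrable std_normal_distribution (\<lambda>s. indicator {u..} s * u)"
    "(LINT s|std_normal_distribution. indicator {u..} s * u) = u * Phi_bar u"
    by (auto simp: Phi_bar_atLeast[symmetric] std_normal.emeasure_finite less_top[symmetric])
  \<comment> \<open>The factor \<open>s - u\<close> vanishes at \<open>s = u\<close>, so passing to
    the closed half-line is an identity of functions, not only almost everywhere.\<close>
  have eq: "(\<lambda>s. indicator {u<..} s * (s - u)) = (\<lambda>s. indicator {u..} s * s - indicator {u..} s * u)"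
    by (auto simp: fun_eq_iff algebra_simps split: split_indicator)
  show "integrable std_normal_distribution (\<lambda>s. indicator {u<..} s * (s - u))"
    unfolding eq using j k by auto
  show "(LINT s|std_normal_distribution. indicator {u<..} s * (s - u)) = std_normal_density u - u * Phi_bar u"
    unfolding eq using j k by simp
qed

subsection \<open>The law of a bivariate Gaussian vector\<close>

text \<open>\<open>W\<close> acts as a density: under the reweighted probability measure
  \<open>Y\<close> has characteristic function \<open>char N\<close>, so Levy uniqueness identifies
  its law. Weights that depend on another variable then reveal the joint behaviour of that variable
  and \<open>Y\<close>.\<close>

lemma (in prob_space) weighted_law_unique:
  fixes Y :: "'a \<Rightarrow> real" and W :: "'a \<Rightarrow> real"
  assumes [measurable]: "Y \<in> borel_measurable M" "W \<in> borel_measurable M"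
    and W: "\<And>\<omega>. \<omega> \<in> space M \<Longrightarrow> 0 \<le> W \<omega>" "integrable M W" "expectation W = 1"
    and N: "real_distribution N"
    and ch: "\<And>t. (CLINT \<omega>|M. W \<omega> *\<^sub>R iexp (t * Y \<omega>)) = char N t"
    and B [measurable]: "B \<in> sets borel"
  shows "expectation (\<lambda>\<omega>. W \<omega> * indicator B (Y \<omega>)) = measure N B"
proof -
  let ?D = "density M (\<lambda>\<omega>. ennreal (W \<omega>))"
  interpret D: prob_space ?D
  proof
    have "emeasure ?D (space ?D) = (\<integral>\<^sup>+\<omega>. ennreal (W \<omega>) \<partial>M)"
      by (auto simp: emeasure_density intro!: nn_integral_cong)
    also have "\<dots> = 1"
      using W by (subst nn_integral_eq_integral) auto
    finally show "emeasure ?D (space ?D) = 1" .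
  qed
  have "distr ?D borel Y = N"
  proof (rule Levy_uniqueness[OF _ N])
    show "real_distribution (distr ?D borel Y)" by (rule D.real_distribution_distr) auto
    show "char (distr ?D borel Y) = char N"
    proof
      fix t
      have "char (distr ?D borel Y) t = (CLINT \<omega>|?D. iexp (t * Y \<omega>))"
        unfolding char_def by (subst integral_distr) auto
      also have "\<dots> = (CLINT \<omega>|M. W \<omega> *\<^sub>R iexp (t * Y \<omega>))"
        using W by (subst integral_density) auto
      finally show "char (distr ?D borel Y) t = char N t" using ch by simp
    qed
  qed
  then have "measure N B = measure (distr ?D borel Y) B" by simp
  also have "\<dots> = (LINT \<omega>|?D. indicator B (Y \<omega>))"
    by (subst integral_distr[symmetric, where N=borel]) auto
  also have "\<dots> = expectation (\<lambda>\<omega>. W \<omega> * indicator B (Y \<omega>))"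
    using W by (subst integral_density) auto
  finally show ?thesis ..
qed

text \<open>No two-dimensional uniqueness theorem is needed: weighting \<open>M\<close> by \<open>1 + cos (a X)\<close> and
  \<open>1 + sin (a X)\<close> reduces the claim to one-dimensional uniqueness.\<close>

lemma (in prob_space) std_normal_pair_law:
  assumes [measurable]: "X \<in> borel_measurable M" "Y \<in> borel_measurable M"
    and ch: "\<And>a b. (CLINT \<omega>|M. iexp (a * X \<omega> + b * Y \<omega>)) = exp (- (a\<^sup>2 + b\<^sup>2) / 2)"
    and A [measurable]: "A \<in> sets borel" and B [measurable]: "B \<in> sets borel"
  shows "prob {\<omega> \<in> space M. X \<omega> \<in> A \<and> Y \<omega> \<in> B} =
    measure std_normal_distribution A * measure std_normal_distribution B"
proof -
  let ?N = std_normal_distribution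
  have int [simp]: "integrable M (\<lambda>\<omega>. cos (a * X \<omega>))" "integrable M (\<lambda>\<omega>. sin (a * X \<omega>))"
    "integrable M (\<lambda>\<omega>. iexp (a * X \<omega> + b * Y \<omega>))" for a b
    by (intro integrable_const_bound[where B=1]; simp)+
  have ex: "expectation (\<lambda>\<omega>. cos (a * X \<omega>)) = exp (- a\<^sup>2 / 2)"
    "expectation (\<lambda>\<omega>. sin (a * X \<omega>)) = 0" for a
  proof -
    have i: "integrable M (\<lambda>\<omega>. iexp (a * X \<omega>))" using int(3)[of a 0] by simp
    have *: "(CLINT \<omega>|M. iexp (a * X \<omega>)) = complex_of_real (exp (- a\<^sup>2 / 2))" using ch[of a 0] by simp
    have "Re (CLINT \<omega>|M. iexp (a * X \<omega>)) = expectation (\<lambda>\<omega>. cos (a * X \<omega>))"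
      using integral_Re[OF i] by (simp add: Re_exp)
    then show "expectation (\<lambda>\<omega>. cos (a * X \<omega>)) = exp (- a\<^sup>2 / 2)" unfolding * by simp
    have "Im (CLINT \<omega>|M. iexp (a * X \<omega>)) = expectation (\<lambda>\<omega>. sin (a * X \<omega>))"
      using integral_Im[OF i] by (simp add: Im_exp)
    then show "expectation (\<lambda>\<omega>. sin (a * X \<omega>)) = 0" unfolding * by simp
  qed
  define E where "E = (\<lambda>a t \<omega>. iexp (a * X \<omega> + t * Y \<omega>))"
  have E_int: "integrable M (E a t)" and E_ex: "integral\<^sup>L M (E a t) = exp (- (a\<^sup>2 + t\<^sup>2) / 2)" for a t
    using int(3)[of a t] ch[of a t] by (auto simp: E_def)
  have E_lin: "(CLINT \<omega>|M. c1 * E 0 t \<omega> + c2 * E a t \<omega> + c3 * E (-a) t \<omega>) =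
    c1 * exp (- t\<^sup>2 / 2) + (c2 + c3) * exp (- (a\<^sup>2 + t\<^sup>2) / 2)" for a t c1 c2 c3
    by (simp add: E_int E_ex ring_distribs)
  have iexp_split: "iexp (a * x + t * y) = iexp (a * x) * iexp (t * y)" for a x t y :: real
    by (simp add: exp_add[symmetric] algebra_simps)
  have C: "expectation (\<lambda>\<omega>. cos (a * X \<omega>) * indicator B (Y \<omega>)) = exp (- a\<^sup>2 / 2) * measure ?N B" for a
  proof -
    \<comment> \<open>\<open>?c\<close> is the mean of \<open>1 + cos (a * X)\<close>, so dividing
      by it gives a probability density; the summand 1 keeps the weight nonnegative. The terms
      \<open>E a\<close> and \<open>E (-a)\<close> below are the two exponentials of the
      cosine.\<close>
    let ?c = "1 + exp (- a\<^sup>2 / 2) :: real"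
    have c: "0 < ?c" by (simp add: add_pos_pos)
    have "1 / (2 * d) + 1 / (2 * d) = 1 / d" for d :: real by (simp add: field_simps)
    then have half: "complex_of_real (1 / (2 * ?c)) + complex_of_real (1 / (2 * ?c)) = complex_of_real (1 / ?c)"
      by (metis of_real_add)
    have "expectation (\<lambda>\<omega>. (1 + cos (a * X \<omega>)) / ?c * indicator B (Y \<omega>)) = measure ?N B"
    proof (rule weighted_law_unique)
      show "0 \<le> (1 + cos (a * X \<omega>)) / ?c" for \<omega> using c cos_ge_minus_one[of "a * X \<omega>"]
        by (intro divide_nonneg_pos) (auto simp del: cos_ge_minus_one)
      show "expectation (\<lambda>\<omega>. (1 + cos (a * X \<omega>)) / ?c) = 1" using c by (simp add: ex prob_space)
      fix t
      have "(CLINT \<omega>|M. ((1 + cos (a * X \<omega>)) / ?c) *\<^sub>R iexp (t * Y \<omega>)) =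
        (CLINT \<omega>|M. complex_of_real (1/?c) * E 0 t \<omega> + complex_of_real (1/(2*?c)) * E a t \<omega> + complex_of_real (1/(2*?c)) * E (-a) t \<omega>)"
        unfolding E_def iexp_split
        by (intro Bochner_Integration.integral_cong)
           (auto simp: scaleR_conv_of_real cos_of_real[symmetric] cos_exp_eq algebra_simps add_divide_distrib)
      also have "\<dots> = complex_of_real ((exp (- t\<^sup>2 / 2) + exp (- (a\<^sup>2 + t\<^sup>2) / 2)) / ?c)"
        unfolding E_lin half by (simp add: add_divide_distrib)
      also have "exp (- t\<^sup>2 / 2) + exp (- (a\<^sup>2 + t\<^sup>2) / 2) = exp (- t\<^sup>2 / 2) * ?c"
        by (simp add: algebra_simps exp_add[symmetric] add_divide_distrib diff_divide_distrib)
      finally show "(CLINT \<omega>|M. ((1 + cos (a * X \<omega>)) / ?c) *\<^sub>R iexp (t * Y \<omega>)) = char ?N t"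
        using c by (simp add: char_std_normal_distribution)
    qed (auto simp: real_dist_normal_dist)
    moreover have "expectation (\<lambda>\<omega>. 1 * indicator B (Y \<omega>)) = measure ?N B"
    proof (rule weighted_law_unique)
      show "(CLINT \<omega>|M. 1 *\<^sub>R iexp (t * Y \<omega>)) = char ?N t" for t
        using ch[of 0 t] by (simp add: char_std_normal_distribution)
    qed (auto simp: real_dist_normal_dist prob_space)
    moreover have "integrable M (\<lambda>\<omega>. cos (a * X \<omega>) * indicator B (Y \<omega>))" "integrable M (\<lambda>\<omega>. indicator B (Y \<omega>) :: real)"
      by (intro integrable_const_bound[where B=1]; auto split: split_indicator)+
    then have "expectation (\<lambda>\<omega>. (1 + cos (a * X \<omega>)) / ?c * indicator B (Y \<omega>)) =
      (expectation (\<lambda>\<omega>. 1 * indicator B (Y \<omega>)) + expectation (\<lambda>\<omega>. cos (a * X \<omega>) * indicator B (Y \<omega>))) / ?c"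
      by (simp add: algebra_simps add_divide_distrib)
    ultimately show ?thesis using c by (simp add: field_simps)
  qed
  \<comment> \<open>The sine has mean 0, so \<open>1 + sin (a * X)\<close> already has mean
    1.\<close>
  have S: "expectation (\<lambda>\<omega>. sin (a * X \<omega>) * indicator B (Y \<omega>)) = 0" for a
  proof -
    have "expectation (\<lambda>\<omega>. (1 + sin (a * X \<omega>)) * indicator B (Y \<omega>)) = measure ?N B"
    proof (rule weighted_law_unique)
      show "0 \<le> 1 + sin (a * X \<omega>)" for \<omega> using sin_ge_minus_one[of "a * X \<omega>"] by linarith
      show "expectation (\<lambda>\<omega>. 1 + sin (a * X \<omega>)) = 1" by (simp add: ex prob_space)
      fix t
      have "(CLINT \<omega>|M. (1 + sin (a * X \<omega>)) *\<^sub>R iexp (t * Y \<omega>)) =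
        (CLINT \<omega>|M. 1 * E 0 t \<omega> + (- \<i>/2) * E a t \<omega> + (\<i>/2) * E (-a) t \<omega>)"
        unfolding E_def iexp_split
        by (intro Bochner_Integration.integral_cong)
           (auto simp: scaleR_conv_of_real sin_of_real[symmetric] sin_exp_eq algebra_simps add_divide_distrib field_simps)
      also have "\<dots> = exp (- t\<^sup>2 / 2)"
        unfolding E_lin by simp
      finally show "(CLINT \<omega>|M. (1 + sin (a * X \<omega>)) *\<^sub>R iexp (t * Y \<omega>)) = char ?N t"
        by (simp add: char_std_normal_distribution)
    qed (auto simp: real_dist_normal_dist)
    moreover have "expectation (\<lambda>\<omega>. 1 * indicator B (Y \<omega>)) = measure ?N B"
    proof (rule weighted_law_unique)
      show "(CLINT \<omega>|M. 1 *\<^sub>R iexp (t * Y \<omega>)) = char ?N t" for t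
        using ch[of 0 t] by (simp add: char_std_normal_distribution)
    qed (auto simp: real_dist_normal_dist prob_space)
    moreover have "integrable M (\<lambda>\<omega>. sin (a * X \<omega>) * indicator B (Y \<omega>))" "integrable M (\<lambda>\<omega>. indicator B (Y \<omega>) :: real)"
      by (intro integrable_const_bound[where B=1]; auto split: split_indicator)+
    then have "expectation (\<lambda>\<omega>. (1 + sin (a * X \<omega>)) * indicator B (Y \<omega>)) =
      expectation (\<lambda>\<omega>. 1 * indicator B (Y \<omega>)) + expectation (\<lambda>\<omega>. sin (a * X \<omega>) * indicator B (Y \<omega>))"
      by (simp add: algebra_simps)
    ultimately show ?thesis by simp
  qed
  have one: "expectation (\<lambda>\<omega>. indicator B (Y \<omega>)) = measure ?N B"
    using C[of 0] by simp
  have iB: "integrable M (\<lambda>\<omega>. indicator B (Y \<omega>) :: real)"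
    by (intro integrable_const_bound[where B=1]) (auto split: split_indicator)
  have AB: "prob {\<omega> \<in> space M. X \<omega> \<in> A \<and> Y \<omega> \<in> B} = expectation (\<lambda>\<omega>. indicator B (Y \<omega>) * indicator A (X \<omega>))"
  proof -
    have "prob {\<omega> \<in> space M. X \<omega> \<in> A \<and> Y \<omega> \<in> B} = expectation (indicator {\<omega> \<in> space M. X \<omega> \<in> A \<and> Y \<omega> \<in> B})"
      by simp
    also have "\<dots> = expectation (\<lambda>\<omega>. indicator B (Y \<omega>) * indicator A (X \<omega>))"
      by (intro Bochner_Integration.integral_cong) (auto split: split_indicator)
    finally show ?thesis .
  qed
  show ?thesis
  proof (cases "measure ?N B = 0")
    case True
    have "expectation (\<lambda>\<omega>. indicat_real B (Y \<omega>) * indicat_real A (X \<omega>)) \<le> expectation (\<lambda>\<omega>. indicat_real B (Y \<omega>))"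
      by (intro integral_mono iB integrable_const_bound[where B=1]) (auto split: split_indicator)
    then have "prob {\<omega> \<in> space M. X \<omega> \<in> A \<and> Y \<omega> \<in> B} \<le> 0" using one True AB by simp
    then show ?thesis using True by (simp add: measure_le_0_iff)
  next
    case False
    let ?p = "measure ?N B"
    have p: "0 < ?p" using False measure_nonneg[of ?N B] by linarith
    \<comment> \<open>This weight conditions on \<open>Y \<in> B\<close>. By \<open>C\<close> and
      \<open>S\<close> the conditional characteristic function of \<open>X\<close> is the standard
      normal one for every \<open>B\<close> of positive probability, which is independence.\<close>
    have "expectation (\<lambda>\<omega>. indicator B (Y \<omega>) / ?p * indicator A (X \<omega>)) = measure ?N A"
    proof (rule weighted_law_unique)
      show "expectation (\<lambda>\<omega>. indicator B (Y \<omega>) / ?p) = 1" using one p by simp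
      show "integrable M (\<lambda>\<omega>. indicator B (Y \<omega>) / ?p)" using iB by simp
      fix t
      have i: "integrable M (\<lambda>\<omega>. (cos (t * X \<omega>) * indicator B (Y \<omega>)) :: real)"
         "integrable M (\<lambda>\<omega>. (sin (t * X \<omega>) * indicator B (Y \<omega>)) :: real)"
        by (intro integrable_const_bound[where B=1]; auto split: split_indicator)+
      have "(CLINT \<omega>|M. (indicator B (Y \<omega>) / ?p) *\<^sub>R iexp (t * X \<omega>)) =
        (CLINT \<omega>|M. (1 / ?p) *\<^sub>R (complex_of_real (cos (t * X \<omega>) * indicator B (Y \<omega>)) + \<i> * complex_of_real (sin (t * X \<omega>) * indicator B (Y \<omega>))))"
        by (intro Bochner_Integration.integral_cong)
           (auto simp: complex_eq_iff Re_exp Im_exp split: split_indicator)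
      also have "\<dots> = (1 / ?p) *\<^sub>R (complex_of_real (expectation (\<lambda>\<omega>. cos (t * X \<omega>) * indicator B (Y \<omega>)))
          + \<i> * complex_of_real (expectation (\<lambda>\<omega>. sin (t * X \<omega>) * indicator B (Y \<omega>))))"
        using i by (simp del: of_real_mult)
      also have "\<dots> = char ?N t"
        using p by (simp add: C S char_std_normal_distribution scaleR_conv_of_real)
      finally show "(CLINT \<omega>|M. (indicator B (Y \<omega>) / ?p) *\<^sub>R iexp (t * X \<omega>)) = char ?N t" .
    qed (use p in \<open>auto simp: real_dist_normal_dist\<close>)
    then show ?thesis using p AB by (simp add: field_simps)
  qed
qed

text \<open>Encoded by the joint characteristic function instead of a density: swapping the
  coordinates, changing both signs and forming linear combinations become substitutions in
  \<open>a\<close> and \<open>b\<close>, and \<rho> = -1 or 1 needs no separate treatment.\<close>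

definition std_bivariate_normal :: "'a measure \<Rightarrow> ('a \<Rightarrow> real) \<Rightarrow> ('a \<Rightarrow> real) \<Rightarrow> real \<Rightarrow> bool" where
  "std_bivariate_normal M X Y \<rho> \<longleftrightarrow> X \<in> borel_measurable M \<and> Y \<in> borel_measurable M \<and>
     (\<forall>a b. (CLINT \<omega>|M. iexp (a * X \<omega> + b * Y \<omega>)) = exp (- (a\<^sup>2 + 2 * \<rho> * a * b + b\<^sup>2) / 2))"

lemma std_bivariate_normal_swap:
  assumes "std_bivariate_normal M X Y \<rho>"
  shows "std_bivariate_normal M Y X \<rho>"
  unfolding std_bivariate_normal_def
proof (intro conjI allI)
  fix a b
  have "(CLINT \<omega>|M. iexp (b * X \<omega> + a * Y \<omega>)) = exp (- (b\<^sup>2 + 2 * \<rho> * b * a + a\<^sup>2) / 2)"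
    using assms unfolding std_bivariate_normal_def by blast
  moreover have "b * X \<omega> + a * Y \<omega> = a * Y \<omega> + b * X \<omega>" for \<omega> by simp
  moreover have "b\<^sup>2 + 2 * \<rho> * b * a + a\<^sup>2 = a\<^sup>2 + 2 * \<rho> * a * b + b\<^sup>2" by simp
  ultimately show "(CLINT \<omega>|M. iexp (a * Y \<omega> + b * X \<omega>)) = exp (- (a\<^sup>2 + 2 * \<rho> * a * b + b\<^sup>2) / 2)"
    by (simp only:)
qed (use assms in \<open>auto simp: std_bivariate_normal_def\<close>)

lemma std_bivariate_normal_minus:
  assumes "std_bivariate_normal M X Y \<rho>"
  shows "std_bivariate_normal M (\<lambda>\<omega>. - X \<omega>) (\<lambda>\<omega>. - Y \<omega>) \<rho>"
  unfolding std_bivariate_normal_def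
proof (intro conjI allI)
  fix a b
  have "(CLINT \<omega>|M. iexp ((-a) * X \<omega> + (-b) * Y \<omega>)) = exp (- ((-a)\<^sup>2 + 2 * \<rho> * (-a) * (-b) + (-b)\<^sup>2) / 2)"
    using assms unfolding std_bivariate_normal_def by blast
  then show "(CLINT \<omega>|M. iexp (a * - X \<omega> + b * - Y \<omega>)) = exp (- (a\<^sup>2 + 2 * \<rho> * a * b + b\<^sup>2) / 2)"
    by simp
qed (use assms in \<open>auto simp: std_bivariate_normal_def\<close>)

text \<open>Evaluating the characteristic function at 1 suffices, because \<open>W\<close> will be
  an arbitrary linear combination and absorbs the frequencies. A point mass with mean 0 sits at 0
  and has \<open>v = 0\<close>, so the degenerate alternative yields the same formula.\<close>

lemma (in prob_space) gaussian_rv_iexp: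
  assumes g: "gaussian_rv M W" and W: "integrable M (\<lambda>\<omega>. (W \<omega>)\<^sup>2)"
    and m: "expectation W = 0" and v: "expectation (\<lambda>\<omega>. (W \<omega>)\<^sup>2) = v"
  shows "(CLINT \<omega>|M. iexp (W \<omega>)) = exp (- v / 2)"
  using g unfolding gaussian_rv_def
proof (elim disjE exE conjE)
  fix \<mu> \<sigma> :: real assume s: "0 < \<sigma>" and d: "distributed M lborel W (normal_density \<mu> \<sigma>)"
  have mu: "\<mu> = 0" using normal_distributed_expectation[OF s d] m by simp
  have vv: "v = \<sigma>\<^sup>2" using normal_distributed_variance[OF s d] m v by simp
  have [measurable]: "W \<in> borel_measurable M" using d by (auto simp: distributed_def)
  have dn: "distributed M lborel (\<lambda>\<omega>. (W \<omega> - \<mu>) / \<sigma>) std_normal_density"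
    using normal_standard_normal_convert[OF s, of W \<mu>] d by simp
  have "distr M borel (\<lambda>\<omega>. W \<omega> / \<sigma>) = std_normal_distribution"
    using distributed_distr_eq_density[OF dn] by (simp add: mu cong: distr_cong)
  then have "char std_normal_distribution \<sigma> = (CLINT \<omega>|M. iexp (\<sigma> * (W \<omega> / \<sigma>)))"
    by (subst integral_distr[symmetric, where N=borel and f="\<lambda>x. iexp (\<sigma> * x)"]) (auto simp: char_def)
  then show ?thesis using s by (simp add: char_std_normal_distribution vv)
next
  fix \<mu> assume [measurable]: "W \<in> borel_measurable M" and ae: "AE \<omega> in M. W \<omega> = \<mu>"
  have "expectation W = expectation (\<lambda>\<omega>. \<mu>)" using ae by (intro integral_cong_AE) auto
  then have mu: "\<mu> = 0" using m by (simp add: prob_space)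
  have "expectation (\<lambda>\<omega>. (W \<omega>)\<^sup>2) = expectation (\<lambda>\<omega>. \<mu>\<^sup>2)" using ae by (intro integral_cong_AE) auto
  then have vv: "v = 0" using v mu by simp
  have "(CLINT \<omega>|M. iexp (W \<omega>)) = (CLINT \<omega>|M. iexp \<mu>)" using ae by (intro integral_cong_AE) auto
  then show ?thesis using mu vv by (simp add: prob_space)
qed

lemma (in prob_space) std_bivariate_normalI:
  assumes g: "bivariate_gaussian M X Y"
    and m: "expectation X = 0" "expectation Y = 0"
    and v: "expectation (\<lambda>\<omega>. (X \<omega>)\<^sup>2) = 1" "expectation (\<lambda>\<omega>. (Y \<omega>)\<^sup>2) = 1"
    and c: "correlation M X Y = \<rho>"
  shows "std_bivariate_normal M X Y \<rho>"
  unfolding std_bivariate_normal_def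
proof (intro conjI allI)
  show [measurable]: "X \<in> borel_measurable M" "Y \<in> borel_measurable M"
    using g by (auto simp: bivariate_gaussian_def)
  \<comment> \<open>The integral of a non-integrable function is 0 by convention, so second moments
    equal to 1 already contain square integrability.\<close>
  have i2 [simp]: "integrable M (\<lambda>\<omega>. (X \<omega>)\<^sup>2)" "integrable M (\<lambda>\<omega>. (Y \<omega>)\<^sup>2)"
    using v not_integrable_integral_eq[of M "\<lambda>\<omega>. (X \<omega>)\<^sup>2"] not_integrable_integral_eq[of M "\<lambda>\<omega>. (Y \<omega>)\<^sup>2"] by auto
  have i1 [simp]: "integrable M X" "integrable M Y"
    by (auto intro: square_integrable_imp_integrable)
  have ixy [simp]: "integrable M (\<lambda>\<omega>. X \<omega> * Y \<omega>)"
  proof (rule Bochner_Integration.integrable_bound[where f="\<lambda>\<omega>. (X \<omega>)\<^sup>2 + (Y \<omega>)\<^sup>2"])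
    have "\<bar>x * y\<bar> \<le> \<bar>x\<^sup>2 + y\<^sup>2\<bar>" for x y :: real
    proof -
      have "2 * (\<bar>x\<bar> * \<bar>y\<bar>) \<le> x\<^sup>2 + y\<^sup>2" using sum_squares_bound[of "\<bar>x\<bar>" "\<bar>y\<bar>"] by (simp add: mult.assoc)
      moreover have "0 \<le> \<bar>x\<bar> * \<bar>y\<bar>" by simp
      ultimately have "\<bar>x\<bar> * \<bar>y\<bar> \<le> x\<^sup>2 + y\<^sup>2" by linarith
      then show ?thesis by (simp add: abs_mult)
    qed
    then show "AE \<omega> in M. norm (X \<omega> * Y \<omega>) \<le> norm ((X \<omega>)\<^sup>2 + (Y \<omega>)\<^sup>2)" by simp
  qed auto
  have exy: "expectation (\<lambda>\<omega>. X \<omega> * Y \<omega>) = \<rho>"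
    using c m v by (simp add: correlation_def)
  fix a b
  have eq: "(\<lambda>\<omega>. (a * X \<omega> + b * Y \<omega>)\<^sup>2) = (\<lambda>\<omega>. a\<^sup>2 * (X \<omega>)\<^sup>2 + (2 * a * b) * (X \<omega> * Y \<omega>) + b\<^sup>2 * (Y \<omega>)\<^sup>2)"
    by (simp add: fun_eq_iff power2_eq_square algebra_simps)
  have "(CLINT \<omega>|M. iexp (a * X \<omega> + b * Y \<omega>)) = exp (- (a\<^sup>2 + 2 * a * b * \<rho> + b\<^sup>2) / 2)"
  proof (rule gaussian_rv_iexp)
    show "gaussian_rv M (\<lambda>\<omega>. a * X \<omega> + b * Y \<omega>)" using g by (simp add: bivariate_gaussian_def)
    show "integrable M (\<lambda>\<omega>. (a * X \<omega> + b * Y \<omega>)\<^sup>2)" unfolding eq by simp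
    show "expectation (\<lambda>\<omega>. (a * X \<omega> + b * Y \<omega>)\<^sup>2) = a\<^sup>2 + 2 * a * b * \<rho> + b\<^sup>2"
      unfolding eq by (simp add: v exy)
    show "expectation (\<lambda>\<omega>. a * X \<omega> + b * Y \<omega>) = 0" using m by simp
  qed
  then show "(CLINT \<omega>|M. iexp (a * X \<omega> + b * Y \<omega>)) = exp (- (a\<^sup>2 + 2 * \<rho> * a * b + b\<^sup>2) / 2)"
    by (simp add: mult_ac)
qed

section \<open>Joint distribution for correlations strictly between -1 and 1\<close>

context prob_space
begin

text \<open>Gram-Schmidt: \<open>Z\<close> is the normalized residual of \<open>Y\<close> after
  regression on \<open>X\<close>. In terms of \<open>X\<close> and \<open>Z\<close> the quadratic
  form in the exponent loses its mixed term, so the characteristic function is that of two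
  independent standard normal variables.\<close>

lemma std_bivariate_normal_decompose:
  assumes bn: "std_bivariate_normal M X Y \<rho>" and r: "\<bar>\<rho>\<bar> < 1"
  defines "Z \<equiv> \<lambda>\<omega>. (Y \<omega> - \<rho> * X \<omega>) / sqrt (1 - \<rho>\<^sup>2)"
  shows "distr M (borel \<Otimes>\<^sub>M borel) (\<lambda>\<omega>. (X \<omega>, Z \<omega>)) = std_normal_distribution \<Otimes>\<^sub>M std_normal_distribution"
proof -
  let ?N = std_normal_distribution
  let ?s = "sqrt (1 - \<rho>\<^sup>2)"
  have [measurable]: "X \<in> borel_measurable M" "Y \<in> borel_measurable M"
    using bn by (auto simp: std_bivariate_normal_def)
  have [measurable]: "Z \<in> borel_measurable M" by (simp add: Z_def)
  have r2: "\<rho>\<^sup>2 < 1" using r by (simp add: abs_square_less_1)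
  then have s: "0 < ?s" "?s\<^sup>2 = 1 - \<rho>\<^sup>2" by auto
  have ch: "(CLINT \<omega>|M. iexp (a * X \<omega> + b * Z \<omega>)) = exp (- (a\<^sup>2 + b\<^sup>2) / 2)" for a b
  proof -
    let ?a = "a - b * \<rho> / ?s" and ?b = "b / ?s"
    have "(CLINT \<omega>|M. iexp (?a * X \<omega> + ?b * Y \<omega>)) = exp (- (?a\<^sup>2 + 2 * \<rho> * ?a * ?b + ?b\<^sup>2) / 2)"
      using bn by (simp only: std_bivariate_normal_def)
    moreover have "a * X \<omega> + b * Z \<omega> = ?a * X \<omega> + ?b * Y \<omega>" for \<omega>
      by (simp add: Z_def algebra_simps diff_divide_distrib)
    moreover have "?a\<^sup>2 + 2 * \<rho> * ?a * ?b + ?b\<^sup>2 = a\<^sup>2 + (b\<^sup>2 / ?s\<^sup>2) * (1 - \<rho>\<^sup>2)"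
    proof -
      have "(a - c * \<rho>)\<^sup>2 + 2 * \<rho> * (a - c * \<rho>) * c + c\<^sup>2 = a\<^sup>2 + c\<^sup>2 * (1 - \<rho>\<^sup>2)" for c
        by (simp add: power2_eq_square algebra_simps)
      from this[of "b / ?s"] show ?thesis by (simp only: times_divide_eq_left power_divide)
    qed
    then have "?a\<^sup>2 + 2 * \<rho> * ?a * ?b + ?b\<^sup>2 = a\<^sup>2 + b\<^sup>2" using s by simp
    ultimately show ?thesis by (simp only:)
  qed
  have "?N \<Otimes>\<^sub>M ?N = distr M (borel \<Otimes>\<^sub>M borel) (\<lambda>\<omega>. (X \<omega>, Z \<omega>))"
  proof (rule pair_measure_eqI)
    show "sigma_finite_measure ?N" by unfold_locales
    then show "sigma_finite_measure ?N" .
    show "sets (?N \<Otimes>\<^sub>M ?N) = sets (distr M (borel \<Otimes>\<^sub>M borel) (\<lambda>\<omega>. (X \<omega>, Z \<omega>)))"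
      by (simp cong: sets_pair_measure_cong)
    fix A B assume "A \<in> sets ?N" "B \<in> sets ?N"
    then have [measurable]: "A \<in> sets borel" "B \<in> sets borel" by auto
    have "emeasure (distr M (borel \<Otimes>\<^sub>M borel) (\<lambda>\<omega>. (X \<omega>, Z \<omega>))) (A \<times> B) = emeasure M {\<omega> \<in> space M. X \<omega> \<in> A \<and> Z \<omega> \<in> B}"
      by (subst emeasure_distr) (auto intro!: arg_cong2[where f=emeasure])
    also have "\<dots> = ennreal (measure ?N A * measure ?N B)"
      unfolding emeasure_eq_measure by (subst std_normal_pair_law[OF _ _ ch]) auto
    finally show "emeasure ?N A * emeasure ?N B = emeasure (distr M (borel \<Otimes>\<^sub>M borel) (\<lambda>\<omega>. (X \<omega>, Z \<omega>))) (A \<times> B)"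
      by (simp add: std_normal.emeasure_eq_measure ennreal_mult'')
  qed
  then show ?thesis ..
qed

text \<open>Conditioning on \<open>X = s\<close>, where \<open>Y\<close> is
  \<open>\<rho> * s + sqrt (1 - \<rho>\<^sup>2) * z\<close> with an independent standard normal
  \<open>z\<close>. Every later probability of a single vector is derived from this formula.\<close>

lemma std_bivariate_normal_prob:
  assumes bn: "std_bivariate_normal M X Y \<rho>" and r: "\<bar>\<rho>\<bar> < 1"
    and A [measurable]: "A \<in> sets (borel \<Otimes>\<^sub>M borel)"
  shows "prob {\<omega> \<in> space M. (X \<omega>, Y \<omega>) \<in> A} =
    (LINT s|std_normal_distribution. measure std_normal_distribution {z. (s, \<rho> * s + sqrt (1 - \<rho>\<^sup>2) * z) \<in> A})"
proof -
  let ?N = std_normal_distribution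
  let ?s = "sqrt (1 - \<rho>\<^sup>2)"
  define Z where "Z = (\<lambda>\<omega>. (Y \<omega> - \<rho> * X \<omega>) / ?s)"
  have [measurable]: "X \<in> borel_measurable M" "Y \<in> borel_measurable M"
    using bn by (auto simp: std_bivariate_normal_def)
  have [measurable]: "Z \<in> borel_measurable M" by (simp add: Z_def)
  have r2: "\<rho>\<^sup>2 < 1" using r by (simp add: abs_square_less_1)
  let ?A = "{p. (fst p, \<rho> * fst p + ?s * snd p) \<in> A}"
  have sA: "?A \<in> sets (borel \<Otimes>\<^sub>M borel)"
  proof -
    have "(\<lambda>p. (fst p, \<rho> * fst p + ?s * snd p)) -` A \<inter> space (borel \<Otimes>\<^sub>M borel) \<in> sets (borel \<Otimes>\<^sub>M borel)"
      by (rule measurable_sets[OF _ A]) measurable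
    then show ?thesis by (simp add: vimage_def space_pair_measure)
  qed
  then have sA': "?A \<in> sets (?N \<Otimes>\<^sub>M ?N)" by (simp cong: sets_pair_measure_cong)
  have Y: "Y \<omega> = \<rho> * X \<omega> + ?s * Z \<omega>" for \<omega> using r2 by (simp add: Z_def)
  have "emeasure M {\<omega> \<in> space M. (X \<omega>, Y \<omega>) \<in> A} = emeasure (distr M (borel \<Otimes>\<^sub>M borel) (\<lambda>\<omega>. (X \<omega>, Z \<omega>))) ?A"
    using sA by (subst emeasure_distr) (auto intro!: arg_cong2[where f=emeasure] simp: Y)
  also have "\<dots> = (\<integral>\<^sup>+s. emeasure ?N (Pair s -` ?A) \<partial>?N)"
    using std_bivariate_normal_decompose[OF bn r] sA'
    by (simp add: Z_def std_normal.emeasure_pair_measure_alt)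
  also have "\<dots> = (\<integral>\<^sup>+s. ennreal (measure ?N {z. (s, \<rho> * s + ?s * z) \<in> A}) \<partial>?N)"
    by (simp add: std_normal.emeasure_eq_measure vimage_def)
  finally have "ennreal (prob {\<omega> \<in> space M. (X \<omega>, Y \<omega>) \<in> A}) = (\<integral>\<^sup>+s. ennreal (measure ?N {z. (s, \<rho> * s + ?s * z) \<in> A}) \<partial>?N)"
    by (simp add: emeasure_eq_measure)
  moreover have "(\<lambda>s. measure ?N {z. (s, \<rho> * s + ?s * z) \<in> A}) \<in> borel_measurable ?N"
  proof -
    have "(\<lambda>s. measure ?N (Pair s -` ?A)) \<in> borel_measurable ?N"
      unfolding measure_def using std_normal.measurable_emeasure_Pair[OF sA'] by measurable
    then show ?thesis by (simp add: vimage_def)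
  qed
  ultimately show ?thesis
    by (subst integral_eq_nn_integral) (auto simp flip: \<open>ennreal (prob _) = _\<close>)
qed

end

subsection \<open>Exceedance probabilities\<close>

text \<open>The probability of \<open>X > u\<close> and \<open>Y - X \<le> - d\<close>, conditioned
  on the value \<open>s\<close> of \<open>X\<close>; for \<open>d = u - v\<close> the second
  condition says that \<open>Y - v\<close> is at most \<open>X - u\<close>. No probability space
  occurs, so the asymptotics can be carried out on real functions.\<close>

definition wedge_prob :: "real \<Rightarrow> real \<Rightarrow> real \<Rightarrow> real" where
  "wedge_prob \<rho> u d =
     (LINT s|std_normal_distribution. indicator {u<..} s * Phi ((s * (1 - \<rho>) - d) / sqrt (1 - \<rho>\<^sup>2)))"

definition exceed_prob :: "real \<Rightarrow> real \<Rightarrow> real \<Rightarrow> real" where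
  "exceed_prob \<rho> u v = wedge_prob \<rho> u (u - v) + wedge_prob \<rho> v (v - u)"

lemma std_normal_AE_neq: "AE s in std_normal_distribution. s \<noteq> u"
  using AE_lborel_singleton[of u] by (subst AE_density) auto

lemma integrable_std_normal_indicator_Phi [simp]:
  assumes [measurable]: "f \<in> borel_measurable borel"
  shows "integrable std_normal_distribution (\<lambda>s. indicator {u<..} s * Phi (f s))"
  by (intro std_normal.integrable_const_bound[where B=1])
     (auto split: split_indicator simp: Phi_nonneg Phi_le_1)

lemma wedge_prob_le: "wedge_prob \<rho> u d \<le> Phi_bar u"
proof -
  have "wedge_prob \<rho> u d \<le> (LINT s|std_normal_distribution. indicator {u<..} s)"
    unfolding wedge_prob_def
    by (intro integral_mono integrable_std_normal_indicator_Phi)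
       (auto split: split_indicator simp: Phi_le_1 std_normal.emeasure_finite less_top[symmetric])
  then show ?thesis by (simp add: Phi_bar_greaterThan)
qed

lemma exceed_prob_le: "exceed_prob \<rho> u v \<le> Phi_bar u + Phi_bar v"
  using wedge_prob_le[of \<rho> u "u - v"] wedge_prob_le[of \<rho> v "v - u"] by (simp add: exceed_prob_def)

context prob_space
begin

text \<open>Strict and weak inequalities give the same value because the normal law has no atoms.
  Both kinds occur: a weak and a strict \<open>T\<close> assign ties of \<open>X - u\<close> and
  \<open>Y - v\<close> to exactly one wedge, while maxima lead to \<open>u < X\<close> and reflected
  minima to \<open>u \<le> X\<close>.\<close>

lemma wedge_prob:
  assumes bn: "std_bivariate_normal M X Y \<rho>" and r: "\<bar>\<rho>\<bar> < 1"
    and S: "S = {u<..} \<or> S = {u..}" and T: "T = {..<-d} \<or> T = {..-d}"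
  shows "prob {\<omega> \<in> space M. X \<omega> \<in> S \<and> Y \<omega> - X \<omega> \<in> T} = wedge_prob \<rho> u d"
proof -
  let ?N = std_normal_distribution
  let ?s = "sqrt (1 - \<rho>\<^sup>2)"
  have r2: "\<rho>\<^sup>2 < 1" using r by (simp add: abs_square_less_1)
  have [measurable]: "S \<in> sets borel" "T \<in> sets borel" using S T by auto
  let ?A = "{p :: real \<times> real. fst p \<in> S \<and> snd p - fst p \<in> T}"
  have A: "?A \<in> sets (borel \<Otimes>\<^sub>M borel)"
  proof -
    have "{p \<in> space (borel \<Otimes>\<^sub>M borel). fst p \<in> S \<and> snd p - fst p \<in> T} \<in> sets (borel \<Otimes>\<^sub>M (borel :: real measure))"
      by measurable
    then show ?thesis by (simp add: space_pair_measure)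
  qed
  have m: "measure ?N {z. (s, \<rho> * s + ?s * z) \<in> ?A} = indicator S s * Phi ((s * (1 - \<rho>) - d) / ?s)" for s
    using T
  proof
    assume T: "T = {..<-d}"
    have "{z. (s, \<rho> * s + ?s * z) \<in> ?A} = (if s \<in> S then {..< (s * (1 - \<rho>) - d) / ?s} else {})"
      using r2 by (auto simp: T field_simps)
    then show ?thesis by (simp add: Phi_lessThan)
  next
    assume T: "T = {..-d}"
    have "{z. (s, \<rho> * s + ?s * z) \<in> ?A} = (if s \<in> S then {..(s * (1 - \<rho>) - d) / ?s} else {})"
      using r2 by (auto simp: T field_simps)
    then show ?thesis by (simp add: Phi_def cdf_def)
  qed
  have "prob {\<omega> \<in> space M. X \<omega> \<in> S \<and> Y \<omega> - X \<omega> \<in> T} = (LINT s|?N. indicator S s * Phi ((s * (1 - \<rho>) - d) / ?s))"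
    using std_bivariate_normal_prob[OF bn r A] unfolding m by simp
  also have "\<dots> = wedge_prob \<rho> u d"
    unfolding wedge_prob_def
    by (intro integral_cong_AE AE_mp[OF std_normal_AE_neq[of u] AE_I2])
       (use S in \<open>auto split: split_indicator\<close>)
  finally show ?thesis .
qed

lemma exceed_prob:
  assumes bn: "std_bivariate_normal M X Y \<rho>" and r: "\<bar>\<rho>\<bar> < 1"
  shows "prob {\<omega> \<in> space M. u < X \<omega> \<or> v < Y \<omega>} = exceed_prob \<rho> u v" (is ?open)
    and "prob {\<omega> \<in> space M. u \<le> X \<omega> \<or> v \<le> Y \<omega>} = exceed_prob \<rho> u v" (is ?closed)
proof -
  have [measurable]: "X \<in> borel_measurable M" "Y \<in> borel_measurable M"
    using bn by (auto simp: std_bivariate_normal_def)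
  have w: "S = {u<..} \<or> S = {u..} \<Longrightarrow> prob {\<omega> \<in> space M. X \<omega> \<in> S \<and> Y \<omega> - X \<omega> \<in> {..-(u - v)}} = wedge_prob \<rho> u (u - v)"
    "S = {v<..} \<or> S = {v..} \<Longrightarrow> prob {\<omega> \<in> space M. Y \<omega> \<in> S \<and> X \<omega> - Y \<omega> \<in> {..<-(v - u)}} = wedge_prob \<rho> v (v - u)" for S
    by (rule wedge_prob[OF bn r] wedge_prob[OF std_bivariate_normal_swap[OF bn] r]; simp)+
  have "prob {\<omega> \<in> space M. u < X \<omega> \<or> v < Y \<omega>} = prob ({\<omega> \<in> space M. X \<omega> \<in> {u<..} \<and> Y \<omega> - X \<omega> \<in> {..-(u - v)}}
     \<union> {\<omega> \<in> space M. Y \<omega> \<in> {v<..} \<and> X \<omega> - Y \<omega> \<in> {..<-(v - u)}})"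
    by (intro arg_cong[where f=prob]) auto
  also have "\<dots> = exceed_prob \<rho> u v"
    unfolding exceed_prob_def by (subst finite_measure_Union) (use w(1)[of "{u<..}"] w(2)[of "{v<..}"] in auto)
  finally show ?open .
  have "prob {\<omega> \<in> space M. u \<le> X \<omega> \<or> v \<le> Y \<omega>} = prob ({\<omega> \<in> space M. X \<omega> \<in> {u..} \<and> Y \<omega> - X \<omega> \<in> {..-(u - v)}}
     \<union> {\<omega> \<in> space M. Y \<omega> \<in> {v..} \<and> X \<omega> - Y \<omega> \<in> {..<-(v - u)}})"
    by (intro arg_cong[where f=prob]) auto
  also have "\<dots> = exceed_prob \<rho> u v"
    unfolding exceed_prob_def by (subst finite_measure_Union) (use w(1)[of "{u..}"] w(2)[of "{v..}"] in auto)
  finally show ?closed .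
qed

lemma lower_tail_prob:
  assumes bn: "std_bivariate_normal M X Y \<rho>" and r: "\<bar>\<rho>\<bar> < 1"
  shows "prob {\<omega> \<in> space M. X \<omega> \<le> s} = Phi s"
proof -
  have A: "S \<times> UNIV \<in> sets (borel \<Otimes>\<^sub>M borel)" if "S \<in> sets borel" for S :: "real set"
    using that by (intro pair_measureI) auto
  have m: "measure std_normal_distribution {z. (x, f z) \<in> S \<times> UNIV} = indicator S x" for x :: real and S and f :: "real \<Rightarrow> real"
    using std_normal.prob_space by (cases "x \<in> S") auto
  have "prob {\<omega> \<in> space M. X \<omega> \<in> S} = measure std_normal_distribution S" if "S \<in> sets borel" for S
    using std_bivariate_normal_prob[OF bn r A[OF that]] that unfolding m by simp
  from this[of "{..s}"] show ?thesis by (simp add: Phi_def cdf_def)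
qed

text \<open>Given \<open>X = x > v > 0\<close>, the conditional mean \<open>\<rho> * x\<close> of
  \<open>Y\<close> is nonnegative and its conditional deviation is at most 1. For
  \<open>s \<le> 0\<close> both facts push \<open>Y \<le> s\<close> further into the tail, so the
  bound valid for independent coordinates persists.\<close>

lemma opposite_prob_le:
  assumes bn: "std_bivariate_normal M X Y \<rho>" and r: "0 \<le> \<rho>" "\<rho> < 1" and vs: "0 < v" "s \<le> 0"
  shows "prob {\<omega> \<in> space M. v < X \<omega> \<and> Y \<omega> \<le> s} \<le> Phi_bar v * Phi s"
proof -
  let ?N = std_normal_distribution
  let ?s = "sqrt (1 - \<rho>\<^sup>2)"
  have r2: "\<rho>\<^sup>2 < 1" using r by (simp add: abs_square_less_1)
  have s: "0 < ?s" "?s \<le> 1" using r2 by auto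
  have A: "{v<..} \<times> {..s} \<in> sets (borel \<Otimes>\<^sub>M (borel :: real measure))" by (intro pair_measureI) auto
  have m: "measure ?N {z. (x, \<rho> * x + ?s * z) \<in> {v<..} \<times> {..s}} = indicator {v<..} x * Phi ((s - \<rho> * x) / ?s)" for x
  proof -
    have "{z. (x, \<rho> * x + ?s * z) \<in> {v<..} \<times> {..s}} = (if x \<in> {v<..} then {..(s - \<rho> * x) / ?s} else {})"
      using s by (auto simp: field_simps)
    then show ?thesis by (simp add: Phi_def cdf_def)
  qed
  have "prob {\<omega> \<in> space M. v < X \<omega> \<and> Y \<omega> \<le> s} = (LINT x|?N. indicator {v<..} x * Phi ((s - \<rho> * x) / ?s))"
    using std_bivariate_normal_prob[OF bn _ A] r unfolding m by simp
  also have "\<dots> \<le> (LINT x|?N. indicator {v<..} x * Phi s)"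
  proof (intro integral_mono integrable_std_normal_indicator_Phi)
    fix x
    show "indicator {v<..} x * Phi ((s - \<rho> * x) / ?s) \<le> indicator {v<..} x * Phi s"
    proof (cases "v < x")
      case True
      then have "0 \<le> \<rho> * x" using vs r by simp
      then have "(s - \<rho> * x) / ?s \<le> s / ?s" using s by (intro divide_right_mono) auto
      also have "\<dots> \<le> s" using s vs by (simp add: divide_le_eq mult_le_cancel_left1)
      finally show ?thesis by (auto intro: Phi_mono split: split_indicator)
    qed simp
  qed auto
  also have "\<dots> = Phi_bar v * Phi s" by (simp add: Phi_bar_greaterThan)
  finally show ?thesis .
qed

text \<open>A coordinate cannot be above its high and below its low level at once, as
  \<open>s \<le> 0 < u\<close> and \<open>t \<le> 0 < v\<close>. The overlap of the two events thus
  forces opposite extremes in different coordinates. The three claims bound the minimum of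
  \<open>X\<close>, of \<open>Y\<close>, and both.\<close>

lemma exceed_or_below_prob:
  assumes bn: "std_bivariate_normal M X Y \<rho>" and r: "0 \<le> \<rho>" "\<rho> < 1"
    and uv: "0 < u" "0 < v" and st: "s \<le> 0" "t \<le> 0"
  shows "\<bar>prob {\<omega> \<in> space M. (u < X \<omega> \<or> v < Y \<omega>) \<or> X \<omega> \<le> s} - (exceed_prob \<rho> u v + Phi s)\<bar>
       \<le> Phi_bar u * Phi t + Phi_bar v * Phi s"
    and "\<bar>prob {\<omega> \<in> space M. (u < X \<omega> \<or> v < Y \<omega>) \<or> Y \<omega> \<le> t} - (exceed_prob \<rho> u v + Phi t)\<bar>
       \<le> Phi_bar u * Phi t + Phi_bar v * Phi s"
    and "\<bar>prob {\<omega> \<in> space M. (u < X \<omega> \<or> v < Y \<omega>) \<or> (X \<omega> \<le> s \<or> Y \<omega> \<le> t)} - (exceed_prob \<rho> u v + exceed_prob \<rho> (-s) (-t))\<bar>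
       \<le> Phi_bar u * Phi t + Phi_bar v * Phi s"
proof -
  have [measurable]: "X \<in> borel_measurable M" "Y \<in> borel_measurable M"
    using bn by (auto simp: std_bivariate_normal_def)
  have r1: "\<bar>\<rho>\<bar> < 1" using r by simp
  let ?O = "{\<omega> \<in> space M. v < Y \<omega> \<and> X \<omega> \<le> s} \<union> {\<omega> \<in> space M. u < X \<omega> \<and> Y \<omega> \<le> t}"
  have "prob ?O \<le> prob {\<omega> \<in> space M. v < Y \<omega> \<and> X \<omega> \<le> s} + prob {\<omega> \<in> space M. u < X \<omega> \<and> Y \<omega> \<le> t}"
    by (rule measure_Un_le) auto
  also have "\<dots> \<le> Phi_bar v * Phi s + Phi_bar u * Phi t"
    by (intro add_mono opposite_prob_le[OF bn] opposite_prob_le[OF std_bivariate_normal_swap[OF bn]]) (use r uv st in auto)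
  finally have O: "prob ?O \<le> Phi_bar u * Phi t + Phi_bar v * Phi s" by simp
  have main: "\<bar>prob {\<omega> \<in> space M. (u < X \<omega> \<or> v < Y \<omega>) \<or> P \<omega>} - (exceed_prob \<rho> u v + prob {\<omega> \<in> space M. P \<omega>})\<bar>
       \<le> Phi_bar u * Phi t + Phi_bar v * Phi s"
    if [measurable]: "Measurable.pred M P" and P: "\<And>\<omega>. P \<omega> \<Longrightarrow> X \<omega> \<le> s \<or> Y \<omega> \<le> t" for P
  proof -
    let ?A = "{\<omega> \<in> space M. u < X \<omega> \<or> v < Y \<omega>}" and ?B = "{\<omega> \<in> space M. P \<omega>}"
    have "prob (?A \<union> ?B) = prob ?A + prob ?B - prob (?A \<inter> ?B)"
      by (rule measure_Un3) (auto simp: fmeasurable_eq_sets)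
    moreover have "prob (?A \<inter> ?B) \<le> prob ?O"
      using P uv st by (intro finite_measure_mono) (fastforce, simp)
    moreover have "?A \<union> ?B = {\<omega> \<in> space M. (u < X \<omega> \<or> v < Y \<omega>) \<or> P \<omega>}" by auto
    ultimately show ?thesis using O exceed_prob(1)[OF bn r1] measure_nonneg[of M "?A \<inter> ?B"] by auto
  qed
  show "\<bar>prob {\<omega> \<in> space M. (u < X \<omega> \<or> v < Y \<omega>) \<or> X \<omega> \<le> s} - (exceed_prob \<rho> u v + Phi s)\<bar>
       \<le> Phi_bar u * Phi t + Phi_bar v * Phi s"
    using main[of "\<lambda>\<omega>. X \<omega> \<le> s"] lower_tail_prob[OF bn r1] by simp
  show "\<bar>prob {\<omega> \<in> space M. (u < X \<omega> \<or> v < Y \<omega>) \<or> Y \<omega> \<le> t} - (exceed_prob \<rho> u v + Phi t)\<bar>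
       \<le> Phi_bar u * Phi t + Phi_bar v * Phi s"
    using main[of "\<lambda>\<omega>. Y \<omega> \<le> t"] lower_tail_prob[OF std_bivariate_normal_swap[OF bn] r1] by simp
  \<comment> \<open>Reflection: the negated pair has the same law, and \<open>X \<le> s\<close>
    becomes the weak exceedance \<open>-s \<le> -X\<close>.\<close>
  have "prob {\<omega> \<in> space M. X \<omega> \<le> s \<or> Y \<omega> \<le> t} = exceed_prob \<rho> (-s) (-t)"
    using exceed_prob(2)[OF std_bivariate_normal_minus[OF bn] r1, of "-s" "-t"] by simp
  then show "\<bar>prob {\<omega> \<in> space M. (u < X \<omega> \<or> v < Y \<omega>) \<or> (X \<omega> \<le> s \<or> Y \<omega> \<le> t)} - (exceed_prob \<rho> u v + exceed_prob \<rho> (-s) (-t))\<bar>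
       \<le> Phi_bar u * Phi t + Phi_bar v * Phi s"
    using main[of "\<lambda>\<omega>. X \<omega> \<le> s \<or> Y \<omega> \<le> t"] by simp
qed

end

subsection \<open>Asymptotics of the exceedance probabilities\<close>

text \<open>With \<open>y = 1 / b^2\<close>, an error of order \<open>1 / b^2\<close> is
  differentiability at \<open>y = 0\<close>; quotients of Mills bounds turn out to be smooth
  functions of this \<open>y\<close>.\<close>

lemma eventually_deriv_bound_inverse_square:
  fixes g :: "real \<Rightarrow> real"
  assumes "(g has_real_derivative D) (at 0)"
  shows "\<forall>\<^sub>F b in at_top. \<bar>g (1 / b\<^sup>2) - g 0\<bar> \<le> (\<bar>D\<bar> + 1) / b\<^sup>2"
proof -
  have "((\<lambda>y. (g y - g 0) / y) \<longlongrightarrow> D) (at 0)"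
    using assms by (simp add: has_field_derivative_iff)
  then have "((\<lambda>y. \<bar>(g y - g 0) / y\<bar>) \<longlongrightarrow> \<bar>D\<bar>) (at 0)" by (rule tendsto_rabs)
  moreover have "filterlim (\<lambda>b::real. 1 / b\<^sup>2) (at 0) at_top" by real_asymp
  ultimately have "((\<lambda>b. \<bar>(g (1 / b\<^sup>2) - g 0) / (1 / b\<^sup>2)\<bar>) \<longlongrightarrow> \<bar>D\<bar>) at_top"
    by (rule filterlim_compose)
  then have "\<forall>\<^sub>F b in at_top. \<bar>(g (1 / b\<^sup>2) - g 0) / (1 / b\<^sup>2)\<bar> < \<bar>D\<bar> + 1"
    by (rule order_tendstoD) simp
  then show ?thesis
    using eventually_gt_at_top[of 0] by eventually_elim (simp add: abs_mult pos_le_divide_eq)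
qed

text \<open>A rate is needed and not only the limit: \<open>b^2\<close> is of order
  \<open>ln n\<close>, so the error disappears even after multiplication by
  \<open>ln n / ln (ln n)\<close>.\<close>

lemma Phi_bar_shift_ratio:
  "\<exists>C. \<forall>\<^sub>F b in at_top. \<bar>Phi_bar (b + x / b) / Phi_bar b - exp (- x)\<bar> \<le> C / b\<^sup>2"
proof -
  \<comment> \<open>\<open>g1\<close> is the upper Mills bound at \<open>b + x / b\<close> over the
    lower one at \<open>b\<close>, and \<open>g2\<close> the lower over the upper, both written in
    \<open>y = 1 / b^2\<close>. They use \<open>b + x / b = b * (1 + x * y)\<close> and the density
    ratio \<open>exp (- x - x\<^sup>2 * y / 2)\<close>.\<close>
  define g1 where "g1 = (\<lambda>y. exp (- x - x\<^sup>2 * y / 2) / ((1 + x * y) * (1 - y)))"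
  define g2 where "g2 = (\<lambda>y. exp (- x - x\<^sup>2 * y / 2) * (1 / (1 + x * y) - y / (1 + x * y) ^ 3))"
  have "\<exists>D. (g1 has_real_derivative D) (at 0)" "\<exists>D. (g2 has_real_derivative D) (at 0)"
    unfolding g1_def g2_def by (rule exI, (rule derivative_eq_intros refl | simp)+)+
  then obtain D1 D2 where D1: "(g1 has_real_derivative D1) (at 0)" and D2: "(g2 has_real_derivative D2) (at 0)"
    by blast
  have g0: "g1 0 = exp (-x)" "g2 0 = exp (-x)" by (auto simp: g1_def g2_def)
  have "filterlim (\<lambda>b. b + x / b) at_top at_top" by real_asymp
  then have u: "\<forall>\<^sub>F b in at_top. b + x / b > 0" by (auto simp: filterlim_at_top_dense)
  have "\<forall>\<^sub>F b in at_top. \<bar>Phi_bar (b + x / b) / Phi_bar b - exp (- x)\<bar> \<le> (\<bar>D1\<bar> + \<bar>D2\<bar> + 1) / b\<^sup>2"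
    using eventually_deriv_bound_inverse_square[OF D1] eventually_deriv_bound_inverse_square[OF D2]
      u eventually_gt_at_top[of 1]
  proof eventually_elim
    case (elim b)
    let ?u = "b + x / b"
    define y where "y = 1 / b\<^sup>2"
    have b: "b > 1" and u: "?u > 0" using elim by auto
    have "(?u)\<^sup>2 = b\<^sup>2 + 2 * x + x\<^sup>2 * y" using b by (simp add: y_def power2_eq_square field_simps)
    then have ph: "std_normal_density ?u = std_normal_density b * exp (- x - x\<^sup>2 * y / 2)"
      by (simp add: std_normal_density_def exp_add[symmetric] add_divide_distrib diff_divide_distrib)
    have phb: "0 < std_normal_density b" by (simp add: normal_density_pos)
    have ub: "?u = b * (1 + x * y)" using b by (simp add: y_def power2_eq_square field_simps)
    have v: "1 + x * y > 0" using u b unfolding ub by (simp add: zero_less_mult_iff)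
    have y: "y < 1" "y > 0" using b by (auto simp: y_def field_simps power2_eq_square intro: less_1_mult)
    have lo: "0 < std_normal_density b * (1 / b - 1 / b ^ 3)"
      using phb b by (intro mult_pos_pos) (auto simp: field_simps eval_nat_numeral intro: less_1_mult)
    have "Phi_bar ?u / Phi_bar b \<le> (std_normal_density ?u / ?u) / (std_normal_density b * (1 / b - 1 / b ^ 3))"
      using Phi_bar_less_Mills[OF u] Phi_bar_greater_Mills[of b] b lo Phi_bar_pos[of ?u] by (intro frac_le) auto
    also have "\<dots> = g1 y"
    proof -
      have "1 / b - 1 / b ^ 3 = (1 - y) / b" using b by (simp add: y_def field_simps eval_nat_numeral)
      then show ?thesis
        unfolding ph unfolding g1_def ub using phb b v y by (simp add: divide_simps)
    qed
    finally have up: "Phi_bar ?u / Phi_bar b \<le> g1 y" .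
    have "g2 y = (std_normal_density ?u * (1 / ?u - 1 / ?u ^ 3)) / (std_normal_density b / b)"
    proof -
      have "1 / ?u - 1 / ?u ^ 3 = (1 / (1 + x * y) - y / (1 + x * y) ^ 3) / b"
        unfolding ub power_mult_distrib using b v by (simp add: y_def diff_divide_distrib eval_nat_numeral mult_ac)
      then show ?thesis
        unfolding ph unfolding g2_def using phb b by simp
    qed
    also have "\<dots> \<le> Phi_bar ?u / (std_normal_density b / b)"
      using Phi_bar_greater_Mills[OF u] phb b by (intro divide_right_mono) auto
    also have "\<dots> \<le> Phi_bar ?u / Phi_bar b"
      using Phi_bar_less_Mills[of b] Phi_bar_pos[of b] Phi_bar_pos[of ?u] phb b
      by (intro divide_left_mono) (auto intro!: mult_pos_pos divide_pos_pos)
    finally have dn: "g2 y \<le> Phi_bar ?u / Phi_bar b" .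
    have "\<bar>Phi_bar ?u / Phi_bar b - exp (-x)\<bar> \<le> max ((\<bar>D1\<bar> + 1) / b\<^sup>2) ((\<bar>D2\<bar> + 1) / b\<^sup>2)"
      using up dn elim(1,2) unfolding g0 y_def[symmetric] by linarith
    also have "\<dots> \<le> (\<bar>D1\<bar> + \<bar>D2\<bar> + 1) / b\<^sup>2" by (auto intro!: divide_right_mono)
    finally show ?case .
  qed
  then show ?thesis by blast
qed

text \<open>By the lower Mills bound the mean excess is at most
  \<open>std_normal_density u / u^2\<close>, and for \<open>u \<ge> 2\<close> the same bound gives
  \<open>std_normal_density u / u \<le> 2 * Phi_bar u\<close>. The remaining factor
  \<open>1 / u \<le> 2 / b\<close> produces the 4. Relative to the tail, the overshoot is thus of
  order \<open>1 / b\<close>.\<close>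

lemma partial_expectation_le:
  assumes "2 \<le> u" "b \<le> 2 * u" "0 < b"
  shows "std_normal_density u - u * Phi_bar u \<le> 4 * Phi_bar u / b"
proof -
  have u: "0 < u" using assms by simp
  have lo: "std_normal_density u * (1 / u - 1 / u ^ 3) < Phi_bar u" using Phi_bar_greater_Mills[OF u] .
  have "u * (std_normal_density u * (1 / u - 1 / u ^ 3)) \<le> u * Phi_bar u"
    using lo u by (intro mult_left_mono) auto
  moreover have "u * (std_normal_density u * (1 / u - 1 / u ^ 3)) = std_normal_density u - std_normal_density u / u\<^sup>2"
    using u by (simp add: field_simps eval_nat_numeral)
  ultimately have 1: "std_normal_density u - u * Phi_bar u \<le> (std_normal_density u / u) / u"
    by (simp add: power2_eq_square)
  have "4 \<le> u * u" using assms mult_mono[of 2 u 2 u] by simp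
  then have "1 / u ^ 3 \<le> 1 / (2 * u)" using u by (simp add: field_simps eval_nat_numeral)
  then have "1 / (2 * u) \<le> 1 / u - 1 / u ^ 3" using u by (simp add: field_simps)
  then have "std_normal_density u * (1 / (2 * u)) \<le> std_normal_density u * (1 / u - 1 / u ^ 3)"
    by (intro mult_left_mono) auto
  then have "std_normal_density u * (1 / (2 * u)) \<le> Phi_bar u" using lo by linarith
  then have "std_normal_density u / u \<le> 2 * Phi_bar u" by simp
  then have "(std_normal_density u / u) / u \<le> 2 * Phi_bar u / u" using u by (intro divide_right_mono) auto
  also have "\<dots> \<le> 4 * Phi_bar u / b" 
  proof -
    have "2 * Phi_bar u * (1 / u) \<le> 2 * Phi_bar u * (2 / b)"
      using assms u Phi_bar_pos[of u] by (intro mult_left_mono) (auto simp: field_simps)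
    then show ?thesis by simp
  qed
  finally show ?thesis using 1 by linarith
qed

text \<open>On the tail the argument of \<open>Phi\<close> is close to
  \<open>c + (y - x) / (2 * c)\<close>. The deviation has a part of order \<open>1 / b^2\<close> and
  a part of order \<open>(s - u) / b\<close>; the mean overshoot is itself of order
  \<open>1 / b\<close>, so both contribute \<open>1 / b^2\<close>. Keeping \<open>c\<close> in a
  compact interval makes the constant uniform, as a sum over a whole row requires.\<close>

lemma wedge_prob_asymp:
  assumes l: "0 < l0" "l0 \<le> l1"
  shows "\<exists>C. \<forall>\<^sub>F b in at_top. \<forall>c\<in>{l0..l1}.
    \<bar>wedge_prob (1 - 2 * c\<^sup>2 / b\<^sup>2) (b + x / b) ((x - y) / b) / Phi_bar b - exp (- x) * Phi (c + (y - x) / (2 * c))\<bar> \<le> C / b\<^sup>2"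
proof -
  obtain C0 where C0: "\<forall>\<^sub>F b in at_top. \<bar>Phi_bar (b + x / b) / Phi_bar b - exp (- x)\<bar> \<le> C0 / b\<^sup>2"
    using Phi_bar_shift_ratio by blast
  \<comment> \<open>\<open>kmax\<close> bounds the limiting argument \<open>k\<close> for all
    admissible \<open>c\<close>. In \<open>K\<close>, the first term pays for replacing
    \<open>1 / \<alpha>\<close> by 1 and the second for the shift \<open>x / b\<close> of the level.
    In \<open>C\<close>, \<open>8 * l1\<close> is \<open>2 * l1\<close> times the 4 of
    \<open>partial_expectation_le\<close>, the factor behind it bounds the tail ratio, and the last
    \<open>C0\<close> is the error of that ratio.\<close>
  define kmax where "kmax = l1 + \<bar>y - x\<bar> / (2 * l0)"
  define K where "K = 2 * l1\<^sup>2 * kmax + 2 * l1 * \<bar>x\<bar>"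
  define C where "C = (K + 8 * l1) * (exp (-x) + \<bar>C0\<bar>) + C0"
  have "filterlim (\<lambda>b. b + x / b) at_top at_top" by real_asymp
  then have ev1: "\<forall>\<^sub>F b in at_top. 2 \<le> b + x / b" by (auto simp: filterlim_at_top)
  have ev2: "\<forall>\<^sub>F b in at_top. b \<le> 2 * (b + x / b)" by real_asymp
  have ev3: "\<forall>\<^sub>F b in at_top. 2 * l1\<^sup>2 \<le> b\<^sup>2" by real_asymp
  have "\<forall>\<^sub>F b in at_top. \<forall>c\<in>{l0..l1}.
    \<bar>wedge_prob (1 - 2 * c\<^sup>2 / b\<^sup>2) (b + x / b) ((x - y) / b) / Phi_bar b - exp (- x) * Phi (c + (y - x) / (2 * c))\<bar> \<le> C / b\<^sup>2"
    using C0 ev1 ev2 ev3 eventually_ge_at_top[of 1]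
  proof eventually_elim
    case (elim b)
    let ?u = "b + x / b" and ?d = "(x - y) / b"
    have b: "1 \<le> b" "0 < b" and b2: "1 \<le> b\<^sup>2" using elim by auto
    show ?case
    proof
      fix c assume c: "c \<in> {l0..l1}"
      have cp: "0 < c" "c \<le> l1" "l0 \<le> c" using c l by auto
      let ?\<rho> = "1 - 2 * c\<^sup>2 / b\<^sup>2"
      define k where "k = c + (y - x) / (2 * c)"
      define \<alpha> where "\<alpha> = sqrt (1 - c\<^sup>2 / b\<^sup>2)"
      have c2: "c\<^sup>2 \<le> l1\<^sup>2" using cp by (intro power_mono) auto
      then have cb: "c\<^sup>2 / b\<^sup>2 \<le> 1 / 2" using elim(4) b by (simp add: divide_le_eq)
      have "c\<^sup>2 / b\<^sup>2 \<le> 1" using cb by linarith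
      then have a2: "\<alpha>\<^sup>2 = 1 - c\<^sup>2 / b\<^sup>2" by (simp add: \<alpha>_def)
      have "1 / 4 \<le> 1 - c\<^sup>2 / b\<^sup>2" using cb by linarith
      then have "sqrt (1 / 4) \<le> \<alpha>" unfolding \<alpha>_def by (rule real_sqrt_le_mono)
      then have al: "1 / 2 \<le> \<alpha>" by (simp add: real_sqrt_divide)
      have a1: "\<alpha> \<le> 1" by (simp add: \<alpha>_def)
      have k: "\<bar>k\<bar> \<le> kmax"
      proof -
        have "\<bar>(y - x) / (2 * c)\<bar> = \<bar>y - x\<bar> / (2 * c)" using cp by simp
        also have "\<dots> \<le> \<bar>y - x\<bar> / (2 * l0)" using cp l by (intro divide_left_mono) auto
        finally show ?thesis unfolding k_def kmax_def using cp by linarith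
      qed
      have sq: "sqrt (1 - ?\<rho>\<^sup>2) = 2 * c * \<alpha> / b"
      proof (rule real_sqrt_unique)
        have "(2 * c * \<alpha> / b)\<^sup>2 = 4 * c\<^sup>2 * \<alpha>\<^sup>2 / b\<^sup>2" by (simp add: power_divide power_mult_distrib)
        also have "\<dots> = 1 - ?\<rho>\<^sup>2" unfolding a2 using b by (simp add: field_simps power2_eq_square)
        finally show "(2 * c * \<alpha> / b)\<^sup>2 = 1 - ?\<rho>\<^sup>2" .
      qed (use cp al b in auto)
      \<comment> \<open>Splitting \<open>s\<close> into the level and the overshoot separates the
        three sizes: \<open>k\<close> of order 1, the overshoot term, and the shift of the
        level.\<close>
      have arg: "(s * (1 - ?\<rho>) - ?d) / sqrt (1 - ?\<rho>\<^sup>2) = (k + c * (s - ?u) / b + c * x / b\<^sup>2) / \<alpha>" for s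
        unfolding sq k_def using cp b al by (simp add: field_simps power2_eq_square)
      have ia: "1 / \<alpha> - 1 \<le> 2 * l1\<^sup>2 / b\<^sup>2" "0 \<le> 1 / \<alpha> - 1" "1 / \<alpha> \<le> 2"
      proof -
        show i2: "1 / \<alpha> \<le> 2" using al by (simp add: divide_le_eq)
        show "0 \<le> 1 / \<alpha> - 1" using al a1 by simp
        have "\<alpha>\<^sup>2 \<le> \<alpha>" using al a1 by (simp add: power2_eq_square mult_le_cancel_left1)
        then have "1 - \<alpha> \<le> c\<^sup>2 / b\<^sup>2" using a2 by simp
        also have "\<dots> \<le> l1\<^sup>2 / b\<^sup>2" using c2 by (intro divide_right_mono) auto
        finally have "(1 - \<alpha>) * (1 / \<alpha>) \<le> (l1\<^sup>2 / b\<^sup>2) * 2"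
          using i2 a1 al by (intro mult_mono) auto
        then show "1 / \<alpha> - 1 \<le> 2 * l1\<^sup>2 / b\<^sup>2" using al by (simp add: field_simps)
      qed
      have diff: "\<bar>Phi ((s * (1 - ?\<rho>) - ?d) / sqrt (1 - ?\<rho>\<^sup>2)) - Phi k\<bar> \<le> K / b\<^sup>2 + 2 * l1 / b * (s - ?u)"
        if s: "?u < s" for s
      proof -
        have "\<bar>Phi ((s * (1 - ?\<rho>) - ?d) / sqrt (1 - ?\<rho>\<^sup>2)) - Phi k\<bar>
           \<le> \<bar>(k + c * (s - ?u) / b + c * x / b\<^sup>2) / \<alpha> - k\<bar>"
          unfolding arg by (rule Phi_Lipschitz)
        also have "(k + c * (s - ?u) / b + c * x / b\<^sup>2) / \<alpha> - k =
           k * (1 / \<alpha> - 1) + (c * (s - ?u) / b) * (1 / \<alpha>) + (c * x / b\<^sup>2) * (1 / \<alpha>)"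
          by (simp add: add_divide_distrib right_diff_distrib)
        also have "\<bar>\<dots>\<bar> \<le> \<bar>k * (1 / \<alpha> - 1)\<bar> + \<bar>(c * (s - ?u) / b) * (1 / \<alpha>)\<bar> + \<bar>(c * x / b\<^sup>2) * (1 / \<alpha>)\<bar>"
          by linarith
        also have "\<dots> \<le> kmax * (2 * l1\<^sup>2 / b\<^sup>2) + (l1 * (s - ?u) / b) * 2 + (l1 * \<bar>x\<bar> / b\<^sup>2) * 2"
        proof -
          have "\<bar>c * (s - ?u) / b\<bar> \<le> l1 * (s - ?u) / b"
            using cp s b by (auto simp: abs_mult intro!: divide_right_mono mult_right_mono)
          moreover have "\<bar>c * x / b\<^sup>2\<bar> \<le> l1 * \<bar>x\<bar> / b\<^sup>2"
            using cp by (auto simp: abs_mult intro!: divide_right_mono mult_right_mono)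
          ultimately show ?thesis
            unfolding abs_mult[of _ "1 / \<alpha>"] abs_mult[of k] using k ia al s b cp by (intro add_mono mult_mono) auto
        qed
        also have "\<dots> = K / b\<^sup>2 + 2 * l1 / b * (s - ?u)"
          unfolding K_def by (simp add: add_divide_distrib mult_ac)
        finally show ?thesis .
      qed
      let ?N = std_normal_distribution
      let ?W = "wedge_prob ?\<rho> ?u ?d"
      have u0: "0 \<le> ?u" using elim(2) by simp
      note pe = partial_expectation[OF u0]
      have iu0 [simp]: "integrable ?N (indicat_real {?u<..})"
        by (auto simp: std_normal.emeasure_finite less_top[symmetric])
      have iu: "integrable ?N (\<lambda>s. indicator {?u<..} s * (e::real))" for e
        by (auto simp: std_normal.emeasure_finite less_top[symmetric])
      have "\<bar>?W - Phi_bar ?u * Phi k\<bar> =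
         \<bar>LINT s|?N. indicator {?u<..} s * Phi ((s * (1 - ?\<rho>) - ?d) / sqrt (1 - ?\<rho>\<^sup>2)) - indicator {?u<..} s * Phi k\<bar>"
        unfolding wedge_prob_def
        by (subst Bochner_Integration.integral_diff) (auto simp: iu Phi_bar_greaterThan)
      also have "\<dots> \<le> (LINT s|?N. indicator {?u<..} s * (K / b\<^sup>2) + 2 * l1 / b * (indicator {?u<..} s * (s - ?u)))"
        by (intro integral_abs_bound[THEN order_trans] integral_mono Bochner_Integration.integrable_add
            Bochner_Integration.integrable_diff integrable_abs iu integrable_mult_right pe integrable_std_normal_indicator_Phi)
          (use diff in \<open>auto split: split_indicator\<close>)
      also have "\<dots> = Phi_bar ?u * (K / b\<^sup>2) + 2 * l1 / b * (std_normal_density ?u - ?u * Phi_bar ?u)"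
        using pe iu[of "K / b\<^sup>2"] by (simp add: Phi_bar_greaterThan)
      also have "\<dots> \<le> Phi_bar ?u * (K / b\<^sup>2) + 2 * l1 / b * (4 * Phi_bar ?u / b)"
        using partial_expectation_le[OF elim(2,3) b(2)] cp b
        by (intro add_left_mono mult_left_mono) auto
      also have "\<dots> = (K + 8 * l1) / b\<^sup>2 * Phi_bar ?u" by (simp add: power2_eq_square add_divide_distrib diff_divide_distrib algebra_simps)
      finally have W: "\<bar>?W - Phi_bar ?u * Phi k\<bar> \<le> (K + 8 * l1) / b\<^sup>2 * Phi_bar ?u" .
      have "0 \<le> C0 / b\<^sup>2" using elim(1) abs_ge_zero order_trans by blast
      then have C0p: "0 \<le> C0" using b by (simp add: zero_le_divide_iff)
      have "C0 / b\<^sup>2 \<le> C0 / 1" using b2 C0p by (intro divide_left_mono) auto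
      then have R: "Phi_bar ?u / Phi_bar b \<le> exp (-x) + \<bar>C0\<bar>" using elim(1) by linarith
      have Kp: "0 \<le> K + 8 * l1" unfolding K_def kmax_def using l by simp
      have "\<bar>?W / Phi_bar b - Phi_bar ?u / Phi_bar b * Phi k\<bar> = \<bar>?W - Phi_bar ?u * Phi k\<bar> / Phi_bar b"
        using Phi_bar_pos[of b] by (simp add: diff_divide_distrib[symmetric])
      also have "\<dots> \<le> (K + 8 * l1) / b\<^sup>2 * Phi_bar ?u / Phi_bar b"
        using W Phi_bar_pos[of b] by (intro divide_right_mono) auto
      also have "\<dots> \<le> (K + 8 * l1) / b\<^sup>2 * (exp (-x) + \<bar>C0\<bar>)"
        unfolding times_divide_eq_right[symmetric] using R Kp by (intro mult_left_mono) auto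
      finally have 1: "\<bar>?W / Phi_bar b - Phi_bar ?u / Phi_bar b * Phi k\<bar> \<le> (K + 8 * l1) / b\<^sup>2 * (exp (-x) + \<bar>C0\<bar>)" .
      have "\<bar>Phi_bar ?u / Phi_bar b * Phi k - exp (-x) * Phi k\<bar> = \<bar>Phi_bar ?u / Phi_bar b - exp (-x)\<bar> * Phi k"
        unfolding left_diff_distrib[symmetric] abs_mult by (simp add: Phi_nonneg)
      also have "\<dots> \<le> (C0 / b\<^sup>2) * 1"
        using elim(1) by (intro mult_mono) (auto simp: Phi_nonneg Phi_le_1 C0p)
      finally have 2: "\<bar>Phi_bar ?u / Phi_bar b * Phi k - exp (-x) * Phi k\<bar> \<le> C0 / b\<^sup>2" by simp
      have "\<bar>?W / Phi_bar b - exp (-x) * Phi k\<bar> \<le> (K + 8 * l1) / b\<^sup>2 * (exp (-x) + \<bar>C0\<bar>) + C0 / b\<^sup>2"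
        using 1 2 by linarith
      also have "\<dots> = C / b\<^sup>2" by (simp add: C_def add_divide_distrib[symmetric])
      finally show "\<bar>?W / Phi_bar b - exp (- x) * Phi (c + (y - x) / (2 * c))\<bar> \<le> C / b\<^sup>2"
        unfolding k_def .
    qed
  qed
  then show ?thesis by blast
qed

text \<open>The exponent function of the bivariate Huesler-Reiss law with parameter
  \<open>c\<close>; averaged over \<open>c = sqrt (m t)\<close> it becomes
  \<open>- ln H\<close>.\<close>

definition exceed_limit :: "real \<Rightarrow> real \<Rightarrow> real \<Rightarrow> real" where
  "exceed_limit x y c = exp (- x) * Phi (c + (y - x) / (2 * c)) + exp (- y) * Phi (c + (x - y) / (2 * c))"

lemma exceed_prob_asymp:
  assumes l: "0 < l0" "l0 \<le> l1"
  shows "\<exists>C. \<forall>\<^sub>F b in at_top. \<forall>c\<in>{l0..l1}.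
    \<bar>exceed_prob (1 - 2 * c\<^sup>2 / b\<^sup>2) (b + x / b) (b + y / b) / Phi_bar b - exceed_limit x y c\<bar> \<le> C / b\<^sup>2"
proof -
  obtain C1 where C1: "\<forall>\<^sub>F b in at_top. \<forall>c\<in>{l0..l1}.
    \<bar>wedge_prob (1 - 2 * c\<^sup>2 / b\<^sup>2) (b + x / b) ((x - y) / b) / Phi_bar b - exp (- x) * Phi (c + (y - x) / (2 * c))\<bar> \<le> C1 / b\<^sup>2"
    using wedge_prob_asymp[OF l] by blast
  obtain C2 where C2: "\<forall>\<^sub>F b in at_top. \<forall>c\<in>{l0..l1}.
    \<bar>wedge_prob (1 - 2 * c\<^sup>2 / b\<^sup>2) (b + y / b) ((y - x) / b) / Phi_bar b - exp (- y) * Phi (c + (x - y) / (2 * c))\<bar> \<le> C2 / b\<^sup>2"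
    using wedge_prob_asymp[OF l] by blast
  have "\<forall>\<^sub>F b in at_top. \<forall>c\<in>{l0..l1}.
    \<bar>exceed_prob (1 - 2 * c\<^sup>2 / b\<^sup>2) (b + x / b) (b + y / b) / Phi_bar b - exceed_limit x y c\<bar> \<le> (C1 + C2) / b\<^sup>2"
    using C1 C2
  proof (eventually_elim, intro ballI)
    fix b c assume 1: "\<forall>c\<in>{l0..l1}. \<bar>wedge_prob (1 - 2 * c\<^sup>2 / b\<^sup>2) (b + x / b) ((x - y) / b) / Phi_bar b - exp (- x) * Phi (c + (y - x) / (2 * c))\<bar> \<le> C1 / b\<^sup>2"
      and 2: "\<forall>c\<in>{l0..l1}. \<bar>wedge_prob (1 - 2 * c\<^sup>2 / b\<^sup>2) (b + y / b) ((y - x) / b) / Phi_bar b - exp (- y) * Phi (c + (x - y) / (2 * c))\<bar> \<le> C2 / b\<^sup>2"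
      and c: "c \<in> {l0..l1}"
    have d: "b + x / b - (b + y / b) = (x - y) / b" "b + y / b - (b + x / b) = (y - x) / b"
      by (simp_all add: diff_divide_distrib)
    show "\<bar>exceed_prob (1 - 2 * c\<^sup>2 / b\<^sup>2) (b + x / b) (b + y / b) / Phi_bar b - exceed_limit x y c\<bar> \<le> (C1 + C2) / b\<^sup>2"
      unfolding exceed_prob_def exceed_limit_def d add_divide_distrib
      using 1[rule_format, OF c] 2[rule_format, OF c] by linarith
  qed
  then show ?thesis by blast
qed

subsection \<open>Asymptotics of the normalizing constants\<close>

lemma Phi_bar_quantile_at_top:
  assumes b: "\<forall>n\<ge>n0. Phi_bar (b n) = 1 / real n"
  shows "filterlim b at_top sequentially"
  unfolding filterlim_at_top
proof
  fix K :: real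
  have "(\<lambda>n. 1 / real n) \<longlonglongrightarrow> 0" by real_asymp
  then have "\<forall>\<^sub>F n in sequentially. 1 / real n < Phi_bar K" by (rule order_tendstoD) (rule Phi_bar_pos)
  then show "\<forall>\<^sub>F n in sequentially. K \<le> b n"
    using eventually_ge_at_top[of n0]
  proof eventually_elim
    case (elim n)
    then have "Phi_bar (b n) < Phi_bar K" using b by simp
    then show "K \<le> b n" using Phi_mono[of "b n" K] by linarith
  qed
qed

text \<open>The logarithms of the two Mills bounds differ only by \<open>ln (1 - 1 / b^2)\<close>,
  which vanishes at infinity.\<close>

lemma ln_Phi_bar_asymp:
  "((\<lambda>b. - ln (Phi_bar b) - (b\<^sup>2 / 2 + ln b + ln (sqrt (2 * pi)))) \<longlongrightarrow> 0) at_top"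
proof (rule tendsto_sandwich)
  have id: "ln (std_normal_density b) = - b\<^sup>2 / 2 - ln (sqrt (2 * pi))" for b
    unfolding std_normal_density_def by (subst ln_mult) (auto simp: ln_div)
  show "\<forall>\<^sub>F b in at_top. 0 \<le> - ln (Phi_bar b) - (b\<^sup>2 / 2 + ln b + ln (sqrt (2 * pi)))"
    using eventually_gt_at_top[of 1]
  proof eventually_elim
    case (elim b)
    have "ln (Phi_bar b) \<le> ln (std_normal_density b / b)"
      using Phi_bar_less_Mills[of b] Phi_bar_pos[of b] elim by (subst ln_le_cancel_iff) (auto intro!: divide_pos_pos normal_density_pos)
    also have "\<dots> = ln (std_normal_density b) - ln b"
      using elim normal_density_pos[of 1 0 b] by (subst ln_div) auto
    finally show ?case by (simp add: id)
  qed
  show "\<forall>\<^sub>F b in at_top. - ln (Phi_bar b) - (b\<^sup>2 / 2 + ln b + ln (sqrt (2 * pi))) \<le> - ln (1 - 1 / b\<^sup>2)"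
    using eventually_gt_at_top[of 1]
  proof eventually_elim
    case (elim b)
    have p: "0 < std_normal_density b" by (simp add: normal_density_pos)
    have y: "0 < 1 - 1 / b\<^sup>2" using elim by (simp add: field_simps)
    have eq: "std_normal_density b * (1 / b - 1 / b ^ 3) = std_normal_density b * (1 - 1 / b\<^sup>2) / b"
      using elim by (simp add: field_simps eval_nat_numeral)
    have "ln (std_normal_density b * (1 - 1 / b\<^sup>2) / b) \<le> ln (Phi_bar b)"
      using Phi_bar_greater_Mills[of b] Phi_bar_pos[of b] elim p y unfolding eq
      by (subst ln_le_cancel_iff) (auto intro!: divide_pos_pos mult_pos_pos)
    moreover have "ln (std_normal_density b * v / b) = ln (std_normal_density b) + ln v - ln b" if "0 < v" for v
      using p that elim by (simp add: ln_div ln_mult)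
    note this[OF y]
    ultimately show ?case by (simp add: id)
  qed
  show "((\<lambda>b::real. - ln (1 - 1 / b\<^sup>2)) \<longlongrightarrow> 0) at_top" by real_asymp
qed simp

text \<open>\<open>2 * L b - b^2\<close> is \<open>2 * ln b\<close> up to a bounded term, and
  \<open>ln (L b)\<close> is asymptotic to \<open>2 * ln b\<close> as well. Bounding the remainder
  \<open>e\<close> by 1 leaves elementary functions of \<open>b\<close> on both sides. At the
  quantile, \<open>L b\<close> is \<open>ln n\<close>.\<close>

lemma ln_Phi_bar_expansion:
  defines "L \<equiv> \<lambda>b. - ln (Phi_bar b)"
  shows "((\<lambda>b. (2 * L b - b\<^sup>2) / ln (L b)) \<longlongrightarrow> 1) at_top"
    and "((\<lambda>b. b\<^sup>2 / (2 * L b)) \<longlongrightarrow> 1) at_top"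
proof -
  define k where "k = ln (sqrt (2 * pi))"
  define e where "e = (\<lambda>b. L b - (b\<^sup>2 / 2 + ln b + k))"
  have e0: "(e \<longlongrightarrow> 0) at_top" unfolding e_def L_def k_def by (rule ln_Phi_bar_asymp)
  have e1: "\<forall>\<^sub>F b in at_top. \<bar>e b\<bar> < 1"
    using tendsto_rabs[OF e0] by (intro order_tendstoD(2)[where y="\<bar>0\<bar>"]) auto
  have big: "\<forall>\<^sub>F b in at_top. 2 < b\<^sup>2 / 2 + ln b + k - 1" "\<forall>\<^sub>F b in at_top. 2 * ln b + 2 * k - 2 > 0"
    by real_asymp+
  show "((\<lambda>b. (2 * L b - b\<^sup>2) / ln (L b)) \<longlongrightarrow> 1) at_top"
  proof (rule tendsto_sandwich)
    show "\<forall>\<^sub>F b in at_top. (2 * ln b + 2 * k - 2) / ln (b\<^sup>2 / 2 + ln b + k + 1) \<le> (2 * L b - b\<^sup>2) / ln (L b)"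
      using e1 big
    proof eventually_elim
      case (elim b)
      then show ?case unfolding e_def by (intro frac_le) (auto simp: abs_less_iff)
    qed
    show "\<forall>\<^sub>F b in at_top. (2 * L b - b\<^sup>2) / ln (L b) \<le> (2 * ln b + 2 * k + 2) / ln (b\<^sup>2 / 2 + ln b + k - 1)"
      using e1 big
    proof eventually_elim
      case (elim b)
      then show ?case unfolding e_def by (intro frac_le) (auto simp: abs_less_iff)
    qed
    show "((\<lambda>b. (2 * ln b + 2 * k - 2) / ln (b\<^sup>2 / 2 + ln b + k + 1)) \<longlongrightarrow> 1) at_top" by real_asymp
    show "((\<lambda>b. (2 * ln b + 2 * k + 2) / ln (b\<^sup>2 / 2 + ln b + k - 1)) \<longlongrightarrow> 1) at_top" by real_asymp
  qed
  show "((\<lambda>b. b\<^sup>2 / (2 * L b)) \<longlongrightarrow> 1) at_top"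
  proof (rule tendsto_sandwich)
    show "\<forall>\<^sub>F b in at_top. b\<^sup>2 / (2 * (b\<^sup>2 / 2 + ln b + k + 1)) \<le> b\<^sup>2 / (2 * L b)"
      using e1 big
    proof eventually_elim
      case (elim b)
      then show ?case unfolding e_def by (intro frac_le) (auto simp: abs_less_iff)
    qed
    show "\<forall>\<^sub>F b in at_top. b\<^sup>2 / (2 * L b) \<le> b\<^sup>2 / (2 * (b\<^sup>2 / 2 + ln b + k - 1))"
      using e1 big
    proof eventually_elim
      case (elim b)
      then show ?case unfolding e_def by (intro frac_le) (auto simp: abs_less_iff)
    qed
    show "((\<lambda>b. b\<^sup>2 / (2 * (b\<^sup>2 / 2 + ln b + k + 1))) \<longlongrightarrow> 1) at_top" by real_asymp
    show "((\<lambda>b. b\<^sup>2 / (2 * (b\<^sup>2 / 2 + ln b + k - 1))) \<longlongrightarrow> 1) at_top" by real_asymp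
  qed
qed

text \<open>Since \<open>2 * ln n * (1 - r^2) = 2 * ln n - b^2\<close> is asymptotic to
  \<open>ln (ln n)\<close>, dividing by \<open>1 + r\<close>, which tends to 2, gives the limit
  \<open>1 / 2\<close>. The third claim is the reason why errors of order \<open>1 / b^2\<close> can
  be ignored at the scale \<open>s\<close>.\<close>

lemma Phi_bar_quantile_asymp:
  fixes b :: "nat \<Rightarrow> real"
  assumes b: "\<forall>n\<ge>n0. Phi_bar (b n) = 1 / real n"
  defines "r \<equiv> \<lambda>n. b n / sqrt (2 * ln (real n))"
    and "s \<equiv> \<lambda>n. 2 * ln (real n) / ln (ln (real n))"
  shows "r \<longlonglongrightarrow> 1" and "(\<lambda>n. s n * (1 - r n)) \<longlonglongrightarrow> 1 / 2" and "(\<lambda>n. s n / (b n)\<^sup>2) \<longlonglongrightarrow> 0"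
proof -
  note bt = Phi_bar_quantile_at_top[OF b]
  have L: "\<forall>\<^sub>F n in sequentially. - ln (Phi_bar (b n)) = ln (real n)"
    using eventually_ge_at_top[of "max n0 1"] by eventually_elim (simp add: b ln_div)
  have bpos: "\<forall>\<^sub>F n in sequentially. 0 < b n" using bt by (simp add: filterlim_at_top_dense)
  have lpos: "\<forall>\<^sub>F n in sequentially. 1 < ln (real n)" by real_asymp
  have 1: "(\<lambda>n. (2 * ln (real n) - (b n)\<^sup>2) / ln (ln (real n))) \<longlonglongrightarrow> 1"
  proof (rule Lim_transform_eventually[OF filterlim_compose[OF ln_Phi_bar_expansion(1) bt]])
    show "\<forall>\<^sub>F n in sequentially. (2 * - ln (Phi_bar (b n)) - (b n)\<^sup>2) / ln (- ln (Phi_bar (b n))) = (2 * ln (real n) - (b n)\<^sup>2) / ln (ln (real n))"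
      using L by eventually_elim simp
  qed
  have 2: "(\<lambda>n. (b n)\<^sup>2 / (2 * ln (real n))) \<longlonglongrightarrow> 1"
  proof (rule Lim_transform_eventually[OF filterlim_compose[OF ln_Phi_bar_expansion(2) bt]])
    show "\<forall>\<^sub>F n in sequentially. (b n)\<^sup>2 / (2 * - ln (Phi_bar (b n))) = (b n)\<^sup>2 / (2 * ln (real n))"
      using L by eventually_elim simp
  qed
  have "(\<lambda>n. sqrt ((b n)\<^sup>2 / (2 * ln (real n)))) \<longlonglongrightarrow> sqrt 1" by (intro tendsto_real_sqrt 2)
  moreover have "\<forall>\<^sub>F n in sequentially. sqrt ((b n)\<^sup>2 / (2 * ln (real n))) = r n"
    using bpos by eventually_elim (simp add: r_def real_sqrt_divide)
  ultimately have "r \<longlonglongrightarrow> sqrt 1" by (rule Lim_transform_eventually)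
  then show r1: "r \<longlonglongrightarrow> 1" by simp
  have "(\<lambda>n. (2 * ln (real n) - (b n)\<^sup>2) / ln (ln (real n)) * (1 / (1 + r n))) \<longlonglongrightarrow> 1 * (1 / (1 + 1))"
    by (intro tendsto_intros 1 r1) simp
  then have "(\<lambda>n. (2 * ln (real n) - (b n)\<^sup>2) / ln (ln (real n)) * (1 / (1 + r n))) \<longlonglongrightarrow> 1 / 2" by simp
  then show "(\<lambda>n. s n * (1 - r n)) \<longlonglongrightarrow> 1 / 2"
  proof (rule Lim_transform_eventually)
    show "\<forall>\<^sub>F n in sequentially. (2 * ln (real n) - (b n)\<^sup>2) / ln (ln (real n)) * (1 / (1 + r n)) = s n * (1 - r n)"
      using bpos lpos
    proof eventually_elim
      case (elim n)
      have r: "0 < 1 + r n" using elim by (simp add: r_def add_pos_pos)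
      have r2: "(r n)\<^sup>2 = (b n)\<^sup>2 / (2 * ln (real n))" using elim by (simp add: r_def power_divide)
      have "2 * ln (real n) - (b n)\<^sup>2 = 2 * ln (real n) * (1 - (r n)\<^sup>2)"
        unfolding r2 using elim by (simp add: field_simps)
      also have "\<dots> = 2 * ln (real n) * (1 - r n) * (1 + r n)" by (simp add: power2_eq_square algebra_simps)
      finally show ?case unfolding s_def using r by simp
    qed
  qed
  have 3: "(\<lambda>n. 1 / ln (ln (real n))) \<longlonglongrightarrow> 0" by real_asymp
  have "(\<lambda>n. inverse ((b n)\<^sup>2 / (2 * ln (real n))) * (1 / ln (ln (real n)))) \<longlonglongrightarrow> inverse 1 * 0"
    by (intro tendsto_intros 2 3) simp
  then show "(\<lambda>n. s n / (b n)\<^sup>2) \<longlonglongrightarrow> 0" by (simp add: s_def mult_ac)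
qed

subsection \<open>Sums over a row\<close>

text \<open>Cell by cell, \<open>w i\<close> bounds the deviation from the right endpoint value.
  Leaving \<open>w\<close> free serves two purposes: increments of a monotone function give a rate,
  a modulus of continuity gives plain convergence.\<close>

lemma riemann_sum_error:
  fixes h :: "real \<Rightarrow> real"
  assumes h: "continuous_on {0..1} h" and n: "0 < n"
    and w: "\<And>i t. i < n \<Longrightarrow> real i / n \<le> t \<Longrightarrow> t \<le> real (Suc i) / n \<Longrightarrow> \<bar>h t - h (real (Suc i) / n)\<bar> \<le> w i"
  shows "\<bar>integral {0..1} h - (\<Sum>i=1..n. h (real i / n)) / n\<bar> \<le> (\<Sum>i<n. w i) / n"
proof -
  have "\<bar>integral {0..real k / n} h - (\<Sum>i<k. h (real (Suc i) / n)) / n\<bar> \<le> (\<Sum>i<k. w i) / n" if "k \<le> n" for k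
    using that
  proof (induction k)
    case (Suc k)
    let ?a = "real k / n" and ?b = "real (Suc k) / n"
    have ab: "0 \<le> ?a" "?a \<le> ?b" "?b \<le> 1" using n Suc.prems by (auto simp: divide_right_mono)
    have sub: "{?a..?b} \<subseteq> {0..1}" using ab(1,3) by (simp only: atLeastatMost_subset_iff) simp
    have int: "h integrable_on {0..?b}"
      by (rule integrable_continuous_real, rule continuous_on_subset[OF h]) (use ab in auto)
    have int': "h integrable_on {?a..?b}"
      by (rule integrable_continuous_real, rule continuous_on_subset[OF h]) (use ab in auto)
    have len: "?b - ?a = 1 / n" by (simp add: diff_divide_distrib[symmetric])
    have "integral {0..?b} h = integral {0..?a} h + integral {?a..?b} h"
      using Henstock_Kurzweil_Integration.integral_combine[OF ab(1,2) int] by simp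
    moreover have "\<bar>integral {?a..?b} h - h ?b / n\<bar> \<le> w k / n"
    proof -
      have "integral {?a..?b} h - h ?b / n = integral {?a..?b} (\<lambda>t. h t - h ?b)"
        using int' ab len by (subst Henstock_Kurzweil_Integration.integral_diff) auto
      also have "norm \<dots> \<le> w k * (?b - ?a)"
      proof (rule integral_bound[OF ab(2)])
        show "continuous_on {?a..?b} (\<lambda>t. h t - h ?b)"
          by (intro continuous_intros continuous_on_subset[OF h sub])
        show "norm (h t - h ?b) \<le> w k" if "t \<in> {?a..?b}" for t
          using that Suc.prems w[of k t] by simp
      qed
      finally show ?thesis unfolding len by simp
    qed
    moreover have "\<bar>integral {0..?a} h - (\<Sum>i<k. h (real (Suc i) / n)) / n\<bar> \<le> (\<Sum>i<k. w i) / n"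
      using Suc by simp
    ultimately show ?case by (simp add: add_divide_distrib del: of_nat_Suc)
  qed simp
  from this[of n] have "\<bar>integral {0..1} h - (\<Sum>i<n. h (real (Suc i) / n)) / n\<bar> \<le> (\<Sum>i<n. w i) / n"
    using n by simp
  \<comment> \<open>Cells are counted from 0 and evaluated at their right endpoints, which are
    exactly the points \<open>i / n\<close> with \<open>1 \<le> i \<le> n\<close>.\<close>
  moreover have "(\<Sum>i<n. h (real (Suc i) / n)) = (\<Sum>i=1..n. h (real i / n))"
    by (rule sum.reindex_bij_witness[where i="\<lambda>i. i - 1" and j=Suc]) auto
  ultimately show ?thesis by simp
qed

text \<open>On each cell the deviation is at most the increment of \<open>h\<close>, and the
  increments telescope.\<close>

lemma riemann_sum_error_mono:
  fixes h :: "real \<Rightarrow> real"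
  assumes h: "continuous_on {0..1} h" and n: "0 < n" and mono: "mono_on {0..1} h"
  shows "\<bar>integral {0..1} h - (\<Sum>i=1..n. h (real i / n)) / n\<bar> \<le> \<bar>h 1 - h 0\<bar> / n"
proof -
  have "\<bar>integral {0..1} h - (\<Sum>i=1..n. h (real i / n)) / n\<bar> \<le> (\<Sum>i<n. h (real (Suc i) / n) - h (real i / n)) / n"
  proof (rule riemann_sum_error[OF h n])
    fix i t assume i: "i < n" "real i / n \<le> t" "t \<le> real (Suc i) / n"
    have "0 \<le> real i / n" "real (Suc i) / n \<le> 1" using i by auto
    then have "0 \<le> t" "t \<le> 1" using i(2,3) by (blast intro: order_trans)+
    with i have "h (real i / n) \<le> h t" "h t \<le> h (real (Suc i) / n)"
      by (auto intro!: mono_onD[OF mono])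
    then show "\<bar>h t - h (real (Suc i) / n)\<bar> \<le> h (real (Suc i) / n) - h (real i / n)" by simp
  qed
  also have "(\<Sum>i<n. h (real (Suc i) / n) - h (real i / n)) = h 1 - h 0"
    using n sum_lessThan_telescope[of "\<lambda>i. h (real i / n)" n] by simp
  also have "(h 1 - h 0) / n \<le> \<bar>h 1 - h 0\<bar> / n" by (intro divide_right_mono) auto
  finally show ?thesis .
qed

lemma riemann_sum_error_monotone:
  fixes h :: "real \<Rightarrow> real"
  assumes h: "continuous_on {0..1} h" and n: "0 < n" and mono: "mono_on {0..1} h \<or> antimono_on {0..1} h"
  shows "\<bar>integral {0..1} h - (\<Sum>i=1..n. h (real i / n)) / n\<bar> \<le> \<bar>h 1 - h 0\<bar> / n"
  using mono
proof
  assume "antimono_on {0..1} h"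
  then have "mono_on {0..1} (\<lambda>t. - h t)" by (auto simp: monotone_on_def)
  from riemann_sum_error_mono[OF continuous_on_minus[OF h] n this]
  show ?thesis by (simp add: sum_negf abs_minus_commute)
qed (rule riemann_sum_error_mono[OF h n])

lemma riemann_sum_tendsto:
  fixes h :: "real \<Rightarrow> real"
  assumes h: "continuous_on {0..1} h"
  shows "(\<lambda>n. (\<Sum>i=1..n. h (real i / n)) / n) \<longlonglongrightarrow> integral {0..1} h"
proof (rule LIMSEQ_I)
  fix e :: real assume e: "0 < e"
  have "uniformly_continuous_on {0..1} h" by (rule compact_uniformly_continuous[OF h]) simp
  then obtain d where d: "0 < d" "\<And>x y. x \<in> {0..1} \<Longrightarrow> y \<in> {0..1} \<Longrightarrow> dist y x < d \<Longrightarrow> dist (h y) (h x) < e / 2"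
    using e unfolding uniformly_continuous_on_def by (meson half_gt_zero)
  obtain N where N: "1 / d < real N" using reals_Archimedean2 by blast
  show "\<exists>N. \<forall>n\<ge>N. norm ((\<Sum>i=1..n. h (real i / n)) / n - integral {0..1} h) < e"
  proof (intro exI allI impI)
    fix n assume n: "max N 1 \<le> n"
    then have n0: "0 < n" "1 / d < real n" using N by auto
    then have nd: "1 / real n < d" using d by (simp add: field_simps)
    have "\<bar>integral {0..1} h - (\<Sum>i=1..n. h (real i / n)) / n\<bar> \<le> (\<Sum>i<n. e / 2) / n"
    proof (rule riemann_sum_error[OF h n0(1)])
      fix i t assume i: "i < n" "real i / n \<le> t" "t \<le> real (Suc i) / n"
      have *: "0 \<le> real i / n" "real (Suc i) / n \<le> 1" using i by auto
      have "real (Suc i) / n = real i / n + 1 / n" by (simp add: add_divide_distrib)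
      then have "\<bar>t - real (Suc i) / n\<bar> < d" using i nd by linarith
      then have "dist t (real (Suc i) / n) < d" by (simp only: dist_real_def)
      moreover have "t \<in> {0..1}" using i(2,3) * unfolding atLeastAtMost_iff by (blast intro: order_trans)
      moreover have "real (Suc i) / n \<in> {0..1}" using * by simp
      ultimately have "dist (h t) (h (real (Suc i) / n)) < e / 2"
        by (intro d(2))
      then show "\<bar>h t - h (real (Suc i) / n)\<bar> \<le> e / 2" by (simp add: dist_real_def)
    qed
    also have "\<dots> = e / 2" using n0 by simp
    finally show "norm ((\<Sum>i=1..n. h (real i / n)) / n - integral {0..1} h) < e"
      using e unfolding real_norm_def by linarith
  qed
qed

text \<open>\<open>G (r * f)\<close> is \<open>G f - (1 - r) * f * g f\<close> up to
  \<open>o(1 - r)\<close>, uniformly in the row. The first term is compared with its integral at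
  cost \<open>1 / n\<close>, because \<open>G\<close> is nondecreasing and so \<open>G\<close> of
  \<open>f\<close> inherits monotonicity. The linear term only needs convergence of its Riemann
  sums, since its factor \<open>s * (1 - r)\<close> already has a limit.\<close>

lemma riemann_sum_scaled_expansion:
  fixes f G g :: "real \<Rightarrow> real" and r s :: "nat \<Rightarrow> real"
  assumes f: "continuous_on {0..1} f" and fpos: "\<And>t. t \<in> {0..1} \<Longrightarrow> 0 < f t"
    and fmono: "mono_on {0..1} f \<or> antimono_on {0..1} f"
    and G: "\<And>c. 0 < c \<Longrightarrow> (G has_real_derivative g c) (at c)"
    and g: "continuous_on {0<..} g" "\<And>c. 0 < c \<Longrightarrow> 0 \<le> g c"
    and r: "r \<longlonglongrightarrow> 1" and s: "(\<lambda>n. s n * (1 - r n)) \<longlonglongrightarrow> \<kappa>" and sn: "(\<lambda>n. s n / n) \<longlonglongrightarrow> 0"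
  shows "(\<lambda>n. s n * ((\<Sum>i=1..n. G (r n * f (real i / n))) / n - integral {0..1} (\<lambda>t. G (f t))))
     \<longlonglongrightarrow> - \<kappa> * integral {0..1} (\<lambda>t. f t * g (f t))"
proof -
  obtain a where a: "a \<in> {0..1}" "\<And>t. t \<in> {0..1} \<Longrightarrow> f a \<le> f t"
    using continuous_attains_inf[OF _ _ f] by auto
  obtain c where c: "c \<in> {0..1}" "\<And>t. t \<in> {0..1} \<Longrightarrow> f t \<le> f c"
    using continuous_attains_sup[OF _ _ f] by auto
  \<comment> \<open>Half the minimum and twice the maximum of \<open>f\<close>: once
    \<open>r n\<close> is within \<open>1 / 2\<close> of 1, all \<open>r n * f t\<close> stay in
    this fixed compact interval, on which \<open>g\<close> is uniformly continuous.\<close>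
  define l0 where "l0 = f a / 2"
  define l1 where "l1 = 2 * f c"
  have l: "0 < l0" "l0 \<le> l1" using fpos[OF a(1)] a(2)[OF c(1)] by (auto simp: l0_def l1_def)
  have G_cont: "continuous_on {0<..} G"
    by (auto intro!: continuous_at_imp_continuous_on DERIV_isCont G)
  have Gf_cont: "continuous_on {0..1} (\<lambda>t. G (f t))"
    by (rule continuous_on_compose2[OF G_cont f]) (use fpos in auto)
  have gf_cont: "continuous_on {0..1} (\<lambda>t. f t * g (f t))"
    by (intro continuous_intros f continuous_on_compose2[OF g(1) f]) (use fpos in auto)
  have G_mono: "G x \<le> G y" if "0 < x" "x \<le> y" for x y
  proof (rule DERIV_nonneg_imp_nondecreasing[OF that(2)])
    fix z assume "x \<le> z" "z \<le> y"
    then have "0 < z" using that by simp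
    then show "\<exists>d. (G has_real_derivative d) (at z) \<and> 0 \<le> d" using G g(2) by blast
  qed
  have Gf_mono: "mono_on {0..1} (\<lambda>t. G (f t)) \<or> antimono_on {0..1} (\<lambda>t. G (f t))"
    using fmono
  proof
    assume "mono_on {0..1} f"
    then have "f t \<le> f u" if "t \<in> {0..1}" "u \<in> {0..1}" "t \<le> u" for t u
      using that unfolding monotone_on_def by blast
    then have "mono_on {0..1} (\<lambda>t. G (f t))"
      by (intro monotone_onI G_mono fpos)
    then show ?thesis ..
  next
    assume "antimono_on {0..1} f"
    then have "f u \<le> f t" if "t \<in> {0..1}" "u \<in> {0..1}" "t \<le> u" for t u
      using that unfolding monotone_on_def by blast
    then have "antimono_on {0..1} (\<lambda>t. G (f t))"
      by (intro monotone_onI G_mono fpos)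
    then show ?thesis ..
  qed
  have one: "(\<lambda>n. s n * ((\<Sum>i=1..n. G (f (real i / n))) / n - integral {0..1} (\<lambda>t. G (f t)))) \<longlonglongrightarrow> 0"
  proof (rule Lim_null_comparison)
    show "\<forall>\<^sub>F n in sequentially. norm (s n * ((\<Sum>i=1..n. G (f (real i / n))) / n - integral {0..1} (\<lambda>t. G (f t))))
        \<le> \<bar>s n / n\<bar> * \<bar>G (f 1) - G (f 0)\<bar>"
      using eventually_gt_at_top[of 0]
    proof eventually_elim
      case (elim n)
      from riemann_sum_error_monotone[OF Gf_cont elim Gf_mono]
      have "\<bar>(\<Sum>i=1..n. G (f (real i / n))) / n - integral {0..1} (\<lambda>t. G (f t))\<bar> \<le> \<bar>G (f 1) - G (f 0)\<bar> / n"
        by (simp add: abs_minus_commute)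
      then have "\<bar>s n\<bar> * \<bar>(\<Sum>i=1..n. G (f (real i / n))) / n - integral {0..1} (\<lambda>t. G (f t))\<bar> \<le> \<bar>s n\<bar> * (\<bar>G (f 1) - G (f 0)\<bar> / n)"
        by (rule mult_left_mono) simp
      then show ?case by (simp add: abs_mult)
    qed
    show "(\<lambda>n. \<bar>s n / n\<bar> * \<bar>G (f 1) - G (f 0)\<bar>) \<longlonglongrightarrow> 0"
      using tendsto_mult_left_zero[OF tendsto_rabs_zero[OF sn]] by blast
  qed
  have two: "(\<lambda>n. (\<Sum>i=1..n. G (r n * f (real i / n)) - G (f (real i / n)) + (1 - r n) * (f (real i / n) * g (f (real i / n)))) / n * s n) \<longlonglongrightarrow> 0"
  proof (rule LIMSEQ_I)
    fix e :: real assume e: "0 < e"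
    \<comment> \<open>Chosen so that the accumulated bound
      \<open>(\<bar>\<kappa>\<bar> + 1) * f c * (e / (2 * B))\<close> equals
      \<open>e / 2\<close>.\<close>
    define B where "B = (\<bar>\<kappa>\<bar> + 1) * f c"
    have fc: "0 < f c" using fpos c by auto
    then have B: "0 < B" by (simp add: B_def)
    have "uniformly_continuous_on {l0..l1} g"
      by (rule compact_uniformly_continuous[OF continuous_on_subset[OF g(1)]]) (use l in auto)
    moreover have "0 < e / (2 * B)" using e B by simp
    ultimately obtain d where d: "0 < d" "\<And>x y. x \<in> {l0..l1} \<Longrightarrow> y \<in> {l0..l1} \<Longrightarrow> dist y x < d \<Longrightarrow> dist (g y) (g x) < e / (2 * B)"
      unfolding uniformly_continuous_on_def by meson
    have "(\<lambda>n. \<bar>s n * (1 - r n)\<bar>) \<longlonglongrightarrow> \<bar>\<kappa>\<bar>" by (rule tendsto_rabs[OF s])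
    then have s1: "\<forall>\<^sub>F n in sequentially. \<bar>s n * (1 - r n)\<bar> < \<bar>\<kappa>\<bar> + 1" by (rule order_tendstoD) simp
    have r1: "\<forall>\<^sub>F n in sequentially. \<bar>r n - 1\<bar> < min (1/2) (d / f c)"
      using tendsto_rabs[OF tendsto_diff[OF r tendsto_const[of 1]]] d fc
      by (intro order_tendstoD(2)[where y="\<bar>1 - 1\<bar>"]) simp_all
    have "\<forall>\<^sub>F n in sequentially. norm ((\<Sum>i=1..n. G (r n * f (real i / n)) - G (f (real i / n)) + (1 - r n) * (f (real i / n) * g (f (real i / n)))) / n * s n - 0) < e"
      using s1 r1 eventually_gt_at_top[of 0]
    proof eventually_elim
      case (elim n)
      have incr: "\<bar>G (r n * v) - G v + (1 - r n) * (v * g v)\<bar> \<le> \<bar>1 - r n\<bar> * (f c * (e / (2 * B)))"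
        if v: "f a \<le> v" "v \<le> f c" for v
      proof -
        have vpos: "0 < v" using v fpos[OF a(1)] by linarith
        have rr: "\<bar>r n - 1\<bar> < 1/2" "\<bar>r n - 1\<bar> < d / f c" using elim(2) by (simp_all only: min_less_iff_conj)
        then have rb: "1/2 < r n" "r n < 3/2" by linarith+
        have lo: "f a / 2 \<le> r n * v" using mult_mono[of "1/2" "r n" "f a" v] rb v fpos[OF a(1)] by simp
        have hi: "r n * v \<le> 2 * f c" using mult_mono[of "r n" 2 v "f c"] rb v fc vpos by simp
        \<comment> \<open>An intermediate point of the mean value theorem; the order of
          \<open>r n * v\<close> and \<open>v\<close> is unknown, hence the three cases.\<close>
        obtain z where z: "\<bar>z - v\<bar> \<le> \<bar>r n * v - v\<bar>" "z \<in> {l0..l1}" "G (r n * v) - G v = (r n * v - v) * g z"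
        proof (cases "r n * v" v rule: linorder_cases)
          case less
          have "\<exists>z>r n * v. z < v \<and> G v - G (r n * v) = (v - r n * v) * g z"
            by (rule MVT2[OF less]) (use lo fpos[OF a(1)] in \<open>auto intro!: G\<close>)
          then obtain z where "r n * v < z" "z < v" "G v - G (r n * v) = (v - r n * v) * g z" by blast
          then show ?thesis using lo hi v fc by (intro that[of z]) (auto simp: l0_def l1_def algebra_simps)
        next
          case equal
          then show ?thesis using lo hi by (intro that[of v]) (auto simp: l0_def l1_def)
        next
          case greater
          have "\<exists>z>v. z < r n * v \<and> G (r n * v) - G v = (r n * v - v) * g z"
            by (rule MVT2[OF greater]) (use vpos in \<open>auto intro!: G\<close>)
          then obtain z where "v < z" "z < r n * v" "G (r n * v) - G v = (r n * v - v) * g z" by blast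
          then show ?thesis using lo hi v fc fpos[OF a(1)] by (intro that[of z]) (auto simp: l0_def l1_def algebra_simps)
        qed
        have "r n * v - v = (r n - 1) * v" by (simp add: algebra_simps)
        then have "\<bar>r n * v - v\<bar> = \<bar>r n - 1\<bar> * v" using vpos by (simp only: abs_mult abs_of_pos)
        also have "\<dots> \<le> \<bar>r n - 1\<bar> * f c" using v by (intro mult_left_mono) auto
        also have "\<dots> < d" using rr(2) fc by (simp only: pos_less_divide_eq)
        finally have "dist z v < d" using z(1) by (simp add: dist_real_def)
        moreover have "v \<in> {l0..l1}" using v fpos[OF a(1)] fc by (auto simp: l0_def l1_def)
        ultimately have gz: "\<bar>g z - g v\<bar> < e / (2 * B)" using d(2)[of v z] z(2) by (simp add: dist_real_def)
        have "G (r n * v) - G v + (1 - r n) * (v * g v) = (1 - r n) * (v * (g v - g z))"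
          unfolding z(3) by (simp add: algebra_simps)
        also have "\<bar>\<dots>\<bar> = \<bar>1 - r n\<bar> * (v * \<bar>g z - g v\<bar>)" using vpos by (simp add: abs_mult abs_minus_commute)
        also have "\<dots> \<le> \<bar>1 - r n\<bar> * (f c * (e / (2 * B)))"
          using gz v fc by (intro mult_left_mono mult_mono) auto
        finally show ?thesis .
      qed
      let ?S = "\<Sum>i=1..n. G (r n * f (real i / n)) - G (f (real i / n)) + (1 - r n) * (f (real i / n) * g (f (real i / n)))"
      have "\<bar>?S\<bar> \<le> (\<Sum>i=1..n. \<bar>1 - r n\<bar> * (f c * (e / (2 * B))))"
        by (intro order_trans[OF sum_abs] sum_mono incr a(2) c(2)) auto
      then have "\<bar>?S\<bar> / n \<le> \<bar>1 - r n\<bar> * (f c * (e / (2 * B)))" using elim by (simp add: divide_le_eq mult_ac)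
      then have "\<bar>?S\<bar> / n * \<bar>s n\<bar> \<le> \<bar>1 - r n\<bar> * (f c * (e / (2 * B))) * \<bar>s n\<bar>" by (rule mult_right_mono) simp
      also have "\<dots> = \<bar>s n * (1 - r n)\<bar> * (f c * (e / (2 * B)))" by (simp add: abs_mult)
      also have "\<dots> \<le> (\<bar>\<kappa>\<bar> + 1) * (f c * (e / (2 * B)))"
        using elim fc e B by (intro mult_right_mono) auto
      also have "\<dots> = e / 2" using B fc unfolding B_def by (simp add: field_simps)
      finally have "\<bar>?S\<bar> / n * \<bar>s n\<bar> < e" using e by linarith
      then show ?case by (simp add: abs_mult)
    qed
    then show "\<exists>N. \<forall>n\<ge>N. norm ((\<Sum>i=1..n. G (r n * f (real i / n)) - G (f (real i / n)) + (1 - r n) * (f (real i / n) * g (f (real i / n)))) / n * s n - 0) < e"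
      by (simp add: eventually_sequentially)
  qed
  have three: "(\<lambda>n. s n * (1 - r n) * ((\<Sum>i=1..n. f (real i / n) * g (f (real i / n))) / n)) \<longlonglongrightarrow> \<kappa> * integral {0..1} (\<lambda>t. f t * g (f t))"
    by (intro tendsto_mult s riemann_sum_tendsto[OF gf_cont])
  have "(\<lambda>n. s n * ((\<Sum>i=1..n. G (f (real i / n))) / n - integral {0..1} (\<lambda>t. G (f t)))
     + (\<Sum>i=1..n. G (r n * f (real i / n)) - G (f (real i / n)) + (1 - r n) * (f (real i / n) * g (f (real i / n)))) / n * s n
     - s n * (1 - r n) * ((\<Sum>i=1..n. f (real i / n) * g (f (real i / n))) / n)) \<longlonglongrightarrow> 0 + 0 - \<kappa> * integral {0..1} (\<lambda>t. f t * g (f t))"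
    by (intro tendsto_intros one two three)
  moreover have "s n * ((\<Sum>i=1..n. G (f (real i / n))) / n - integral {0..1} (\<lambda>t. G (f t)))
     + (\<Sum>i=1..n. G (r n * f (real i / n)) - G (f (real i / n)) + (1 - r n) * (f (real i / n) * g (f (real i / n)))) / n * s n
     - s n * (1 - r n) * ((\<Sum>i=1..n. f (real i / n) * g (f (real i / n))) / n)
    = s n * ((\<Sum>i=1..n. G (r n * f (real i / n))) / n - integral {0..1} (\<lambda>t. G (f t)))" for n
    unfolding sum.distrib sum_subtractf sum_distrib_left[symmetric]
    by (simp add: add_divide_distrib diff_divide_distrib ring_distribs)
  ultimately show ?thesis by simp
qed

text \<open>Replacing \<open>1 - p\<close> by \<open>exp (- p)\<close> costs at most
  \<open>p^2\<close> per factor, hence \<open>C^2 / n\<close> in total, because all factors lie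
  between 0 and 1. What remains is \<open>exp\<close> of minus the sum, whose deviation from
  \<open>exp (- A)\<close> is governed by the derivative at \<open>A\<close>.\<close>

lemma prod_one_minus_expansion:
  fixes p :: "nat \<Rightarrow> nat \<Rightarrow> real" and s :: "nat \<Rightarrow> real"
  assumes p: "\<forall>\<^sub>F n in sequentially. \<forall>i\<in>{1..n}. 0 \<le> p n i \<and> p n i \<le> 1 \<and> p n i \<le> C / n"
    and s: "filterlim s at_top sequentially" and sn: "(\<lambda>n. s n / n) \<longlonglongrightarrow> 0"
    and sum: "(\<lambda>n. s n * ((\<Sum>i=1..n. p n i) - A)) \<longlonglongrightarrow> L"
  shows "(\<lambda>n. s n * ((\<Prod>i=1..n. 1 - p n i) - exp (- A))) \<longlonglongrightarrow> - exp (- A) * L"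
proof -
  define T where "T = (\<lambda>n. \<Sum>i=1..n. p n i)"
  have spos: "\<forall>\<^sub>F n in sequentially. 0 < s n" using s by (simp add: filterlim_at_top_dense)
  \<comment> \<open>The upper half rests on \<open>(1 + x) * (1 - x + x\<^sup>2) = 1 + x^3\<close>,
    which is at least 1.\<close>
  have quad: "\<bar>(1 - x) - exp (- x)\<bar> \<le> x\<^sup>2" if "0 \<le> x" "x \<le> 1" for x :: real
  proof -
    have "exp (- x) \<le> 1 + (- x) + (- x)\<^sup>2"
    proof -
      have "1 \<le> exp x * (1 - x + x\<^sup>2)"
      proof -
        have "(1 + x) * (1 - x + x\<^sup>2) = 1 + x ^ 3" by (simp add: algebra_simps eval_nat_numeral)
        moreover have "(1 + x) * (1 - x + x\<^sup>2) \<le> exp x * (1 - x + x\<^sup>2)"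
          using that by (intro mult_right_mono exp_ge_add_one_self) auto
        moreover have "0 \<le> x ^ 3" using that by simp
        ultimately show ?thesis by linarith
      qed
      then show ?thesis by (simp add: exp_minus field_simps)
    qed
    moreover have "1 + - x \<le> exp (- x)" by (rule exp_ge_add_one_self)
    ultimately show ?thesis by simp
  qed
  have one: "(\<lambda>n. s n * ((\<Prod>i=1..n. 1 - p n i) - exp (- T n))) \<longlonglongrightarrow> 0"
  proof (rule Lim_null_comparison)
    show "\<forall>\<^sub>F n in sequentially. norm (s n * ((\<Prod>i=1..n. 1 - p n i) - exp (- T n))) \<le> s n / n * C\<^sup>2"
      using p spos eventually_gt_at_top[of 0]
    proof eventually_elim
      case (elim n)
      have "\<bar>(\<Prod>i=1..n. 1 - p n i) - (\<Prod>i=1..n. exp (- p n i))\<bar> \<le> (\<Sum>i=1..n. \<bar>(1 - p n i) - exp (- p n i)\<bar>)"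
        using norm_prod_diff[of "{1..n}" "\<lambda>i. 1 - p n i" "\<lambda>i. exp (- p n i)"] elim(1) by auto
      also have "\<dots> \<le> (\<Sum>i=1..n. (C / n)\<^sup>2)"
      proof (rule sum_mono)
        fix i assume i: "i \<in> {1..n}"
        have "\<bar>(1 - p n i) - exp (- p n i)\<bar> \<le> (p n i)\<^sup>2" using elim(1) i by (intro quad) auto
        also have "\<dots> \<le> (C / n)\<^sup>2" using elim(1) i by (intro power_mono) auto
        finally show "\<bar>(1 - p n i) - exp (- p n i)\<bar> \<le> (C / n)\<^sup>2" .
      qed
      also have "\<dots> = C\<^sup>2 / n" using elim by (simp add: power2_eq_square)
      also have "(\<Prod>i=1..n. exp (- p n i)) = exp (- T n)" by (simp add: T_def exp_sum sum_negf[symmetric])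
      finally have "s n * \<bar>(\<Prod>i=1..n. 1 - p n i) - exp (- T n)\<bar> \<le> s n * (C\<^sup>2 / n)"
        using elim(2) by (intro mult_left_mono) auto
      then show ?case using elim(2) by (simp add: abs_mult)
    qed
    show "(\<lambda>n. s n / n * C\<^sup>2) \<longlonglongrightarrow> 0" using tendsto_mult_left_zero[OF sn] by blast
  qed
  have TA: "T \<longlonglongrightarrow> A"
  proof -
    have "(\<lambda>n. s n * (T n - A) * inverse (s n)) \<longlonglongrightarrow> L * 0"
      using sum s by (intro tendsto_mult tendsto_inverse_0_at_top) (simp_all add: T_def)
    moreover have "\<forall>\<^sub>F n in sequentially. s n * (T n - A) * inverse (s n) = T n - A"
      using spos by eventually_elim simp
    ultimately have "(\<lambda>n. T n - A) \<longlonglongrightarrow> L * 0"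
      by (rule Lim_transform_eventually)
    then show ?thesis by (simp add: LIM_zero_iff)
  qed
  \<comment> \<open>The difference quotient of \<open>exp (- t)\<close> at \<open>A\<close>,
    completed by the derivative so that it is continuous there; rows with \<open>T n = A\<close>
    then need no separate treatment.\<close>
  define q where "q = (\<lambda>t. if t = A then - exp (- A) else (exp (- t) - exp (- A)) / (t - A))"
  have "((\<lambda>t. exp (- t)) has_real_derivative - exp (- A)) (at A)" by (auto intro!: derivative_eq_intros)
  then have "((\<lambda>t. (exp (- t) - exp (- A)) / (t - A)) \<longlongrightarrow> - exp (- A)) (at A)"
    by (simp add: has_field_derivative_iff)
  moreover have "\<forall>\<^sub>F t in at A. (exp (- t) - exp (- A)) / (t - A) = q t"
    by (auto simp: q_def eventually_at_filter)
  moreover have "q A = - exp (- A)" by (simp add: q_def)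
  ultimately have "isCont q A"
    unfolding isCont_def by (simp only:) (rule Lim_transform_eventually)
  then have "(\<lambda>n. q (T n)) \<longlonglongrightarrow> q A" using TA by (rule isCont_tendsto_compose)
  then have "(\<lambda>n. q (T n) * (s n * (T n - A))) \<longlonglongrightarrow> q A * L"
    using sum by (intro tendsto_mult) (simp_all add: T_def)
  moreover have "q (T n) * (s n * (T n - A)) = s n * (exp (- T n) - exp (- A))" for n
    by (simp add: q_def)
  ultimately have "(\<lambda>n. s n * (exp (- T n) - exp (- A))) \<longlonglongrightarrow> q A * L"
    by (simp only:)
  then have two: "(\<lambda>n. s n * (exp (- T n) - exp (- A))) \<longlonglongrightarrow> - exp (- A) * L"
    by (simp add: q_def)
  have "(\<lambda>n. s n * ((\<Prod>i=1..n. 1 - p n i) - exp (- T n)) + s n * (exp (- T n) - exp (- A))) \<longlonglongrightarrow> 0 + (- exp (- A) * L)"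
    by (intro tendsto_add one two)
  then show ?thesis by (simp add: algebra_simps)
qed

subsection \<open>The joint limit of maxima and minima\<close>

text \<open>The two arguments \<open>?k\<close> and \<open>?k'\<close> satisfy
  \<open>?k'^2 - ?k^2 = 2 * (x - y)\<close>, so the weighted densities
  \<open>exp (- x) * std_normal_density ?k\<close> and
  \<open>exp (- y) * std_normal_density ?k'\<close> coincide. The inner derivatives then add up to
  2, and the derivative is visibly nonnegative.\<close>

lemma exceed_limit_deriv:
  assumes c: "0 < c"
  shows "(exceed_limit x y has_real_derivative 2 * exp (- x) * std_normal_density (c + (y - x) / (2 * c))) (at c)"
proof -
  let ?k = "c + (y - x) / (2 * c)" and ?k' = "c + (x - y) / (2 * c)"
  have "((\<lambda>c. exp (- x) * Phi (c + (y - x) / (2 * c)) + exp (- y) * Phi (c + (x - y) / (2 * c))) has_real_derivative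
      exp (- x) * (std_normal_density ?k * (1 - (y - x) / (2 * c\<^sup>2)))
      + exp (- y) * (std_normal_density ?k' * (1 - (x - y) / (2 * c\<^sup>2)))) (at c)"
  proof -
    have d: "((\<lambda>c. c + d / (2 * c)) has_real_derivative 1 - d / (2 * c\<^sup>2)) (at c)" for d
      using c by (auto intro!: derivative_eq_intros simp: field_simps power2_eq_square)
    show ?thesis by (intro DERIV_add DERIV_cmult DERIV_chain2[OF Phi_deriv d])
  qed
  moreover have "exp (- y) * std_normal_density ?k' = exp (- x) * std_normal_density ?k"
  proof -
    have "- y + - ?k'\<^sup>2 / 2 = - x + - ?k\<^sup>2 / 2" using c by (simp add: field_simps power2_eq_square)
    then have "exp (- y) * exp (- ?k'\<^sup>2 / 2) = exp (- x) * exp (- ?k\<^sup>2 / 2)" by (simp only: exp_add[symmetric])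
    then show ?thesis by (simp add: std_normal_density_def)
  qed
  then have "exp (- x) * (std_normal_density ?k * (1 - (y - x) / (2 * c\<^sup>2)))
      + exp (- y) * (std_normal_density ?k' * (1 - (x - y) / (2 * c\<^sup>2)))
      = (exp (- x) * std_normal_density ?k) * ((1 - (y - x) / (2 * c\<^sup>2)) + (1 - (x - y) / (2 * c\<^sup>2)))"
    by (simp only: mult.assoc[symmetric] distrib_left)
  moreover have "(1 - (y - x) / (2 * c\<^sup>2)) + (1 - (x - y) / (2 * c\<^sup>2)) = 2"
    by (simp add: diff_divide_distrib)
  ultimately show ?thesis unfolding exceed_limit_def[abs_def] by (simp add: mult_ac)
qed

lemma H_eq_exp_integral:
  assumes m_pos: "\<And>t. t \<in> {0..1} \<Longrightarrow> 0 < m t" and m_cont: "continuous_on {0..1} m"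
  shows "H m x y = exp (- integral {0..1} (\<lambda>t. exceed_limit x y (sqrt (m t))))"
proof -
  have i: "(\<lambda>t. Phi (sqrt (m t) + (u - v) / (2 * sqrt (m t)))) integrable_on {0..1}" for u v
    by (intro integrable_continuous_real continuous_intros m_cont) (use m_pos in force)
  have "integral {0..1} (\<lambda>t. exceed_limit x y (sqrt (m t))) =
     exp (- x) * integral {0..1} (\<lambda>t. Phi (sqrt (m t) + (y - x) / (2 * sqrt (m t)))) +
     exp (- y) * integral {0..1} (\<lambda>t. Phi (sqrt (m t) + (x - y) / (2 * sqrt (m t))))"
    unfolding exceed_limit_def
    by (subst Henstock_Kurzweil_Integration.integral_add)
       (auto intro!: integrable_on_mult_right i simp: Henstock_Kurzweil_Integration.integral_mult_right)
  then show ?thesis by (simp add: H_def)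
qed

text \<open>One-dimensional tails have no correction at the scale \<open>ln (ln n) / ln n\<close>.
  Restricting a single minimum therefore alters the limit but adds no integral to the second-order
  term.\<close>

lemma tail_scaled_asymp:
  fixes b :: "nat \<Rightarrow> real"
  assumes b: "\<forall>n\<ge>n0. Phi_bar (b n) = 1 / real n"
  shows "(\<lambda>n. real n * Phi_bar (b n + x / b n)) \<longlonglongrightarrow> exp (- x)"
    and "(\<lambda>n. 2 * ln (real n) / ln (ln (real n)) * (real n * Phi_bar (b n + x / b n) - exp (- x))) \<longlonglongrightarrow> 0"
proof -
  let ?s = "\<lambda>n. 2 * ln (real n) / ln (ln (real n))"
  note bt = Phi_bar_quantile_at_top[OF b]
  obtain C where C: "\<forall>\<^sub>F b in at_top. \<bar>Phi_bar (b + x / b) / Phi_bar b - exp (- x)\<bar> \<le> C / b\<^sup>2"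
    using Phi_bar_shift_ratio by blast
  have "\<forall>\<^sub>F n in sequentially. \<bar>Phi_bar (b n + x / b n) / Phi_bar (b n) - exp (- x)\<bar> \<le> C / (b n)\<^sup>2"
    using C bt by (rule eventually_compose_filterlim)
  then have ev: "\<forall>\<^sub>F n in sequentially. \<bar>real n * Phi_bar (b n + x / b n) - exp (- x)\<bar> \<le> C / (b n)\<^sup>2"
    using eventually_ge_at_top[of "max n0 1"] by eventually_elim (simp add: b mult.commute)
  have "((\<lambda>b::real. C / b\<^sup>2) \<longlongrightarrow> 0) at_top" by real_asymp
  then have Cb: "(\<lambda>n. C / (b n)\<^sup>2) \<longlonglongrightarrow> 0" using bt by (rule filterlim_compose)
  have "(\<lambda>n. real n * Phi_bar (b n + x / b n) - exp (- x)) \<longlonglongrightarrow> 0"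
    by (rule Lim_null_comparison[OF _ Cb]) (use ev in simp)
  then show "(\<lambda>n. real n * Phi_bar (b n + x / b n)) \<longlonglongrightarrow> exp (- x)" by (simp add: LIM_zero_iff)
  have "(\<lambda>n. C * (?s n / (b n)\<^sup>2)) \<longlonglongrightarrow> C * 0"
    by (intro tendsto_mult tendsto_const Phi_bar_quantile_asymp(3)[OF b])
  then have sC: "(\<lambda>n. C * (?s n / (b n)\<^sup>2)) \<longlonglongrightarrow> 0" by simp
  have spos: "\<forall>\<^sub>F n in sequentially. 0 < ?s n" by real_asymp
  show "(\<lambda>n. ?s n * (real n * Phi_bar (b n + x / b n) - exp (- x))) \<longlonglongrightarrow> 0"
  proof (rule Lim_null_comparison[OF _ sC])
    show "\<forall>\<^sub>F n in sequentially. norm (?s n * (real n * Phi_bar (b n + x / b n) - exp (- x))) \<le> C * (?s n / (b n)\<^sup>2)"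
      using ev spos
    proof eventually_elim
      case (elim n)
      then have "?s n * \<bar>real n * Phi_bar (b n + x / b n) - exp (- x)\<bar> \<le> ?s n * (C / (b n)\<^sup>2)"
        by (intro mult_left_mono) auto
      moreover have "norm (?s n * (real n * Phi_bar (b n + x / b n) - exp (- x))) = ?s n * \<bar>real n * Phi_bar (b n + x / b n) - exp (- x)\<bar>"
        unfolding real_norm_def abs_mult using elim by (simp only: abs_of_pos)
      ultimately show ?case by (simp add: mult_ac)
    qed
  qed
qed

text \<open>The correlation belongs to the parameter \<open>r n * sqrt (m t)\<close>, so the sum is
  a Riemann sum at slightly shrunken arguments. The limit \<open>1 / 2\<close> of
  \<open>s n * (1 - r n)\<close> cancels the factor 2 in the derivative of
  \<open>exceed_limit\<close>.\<close>

lemma exceed_sum_asymp: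
  fixes b :: "nat \<Rightarrow> real"
  assumes m_pos: "\<And>t. t \<in> {0..1} \<Longrightarrow> 0 < m t" and m_cont: "continuous_on {0..1} m"
    and m_monotone: "mono_on {0..1} m \<or> antimono_on {0..1} m"
    and b: "\<forall>n\<ge>n0. Phi_bar (b n) = 1 / real n"
  shows "(\<lambda>n. 2 * ln (real n) / ln (ln (real n)) *
      ((\<Sum>i=1..n. exceed_prob (1 - m (real i / real n) / ln (real n)) (b n + x / b n) (b n + y / b n))
        - integral {0..1} (\<lambda>t. exceed_limit x y (sqrt (m t)))))
    \<longlonglongrightarrow> - (exp (- x) * integral {0..1} (\<lambda>t. sqrt (m t) * std_normal_density (sqrt (m t) + (y - x) / (2 * sqrt (m t)))))"
proof -
  define s where "s = (\<lambda>n. 2 * ln (real n) / ln (ln (real n)))"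
  define r where "r = (\<lambda>n. b n / sqrt (2 * ln (real n)))"
  define f where "f = (\<lambda>t. sqrt (m t))"
  define G where "G = exceed_limit x y"
  define g where "g = (\<lambda>c. 2 * exp (- x) * std_normal_density (c + (y - x) / (2 * c)))"
  note bt = Phi_bar_quantile_at_top[OF b]
  have q: "r \<longlonglongrightarrow> 1" "(\<lambda>n. s n * (1 - r n)) \<longlonglongrightarrow> 1 / 2" "(\<lambda>n. s n / (b n)\<^sup>2) \<longlonglongrightarrow> 0"
    unfolding r_def s_def by (rule Phi_bar_quantile_asymp[OF b])+
  have f: "continuous_on {0..1} f" unfolding f_def by (intro continuous_intros m_cont)
  have fpos: "0 < f t" if "t \<in> {0..1}" for t using m_pos[OF that] by (simp add: f_def)
  have sn: "(\<lambda>n. s n / n) \<longlonglongrightarrow> 0" unfolding s_def by real_asymp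
  have one: "(\<lambda>n. s n * ((\<Sum>i=1..n. G (r n * f (real i / n))) / n - integral {0..1} (\<lambda>t. G (f t))))
     \<longlonglongrightarrow> - (1 / 2) * integral {0..1} (\<lambda>t. f t * g (f t))"
  proof (rule riemann_sum_scaled_expansion[OF f fpos])
    show "mono_on {0..1} f \<or> antimono_on {0..1} f"
      using m_monotone by (auto simp: f_def monotone_on_def)
    show "(G has_real_derivative g c) (at c)" if "0 < c" for c
      unfolding G_def g_def by (rule exceed_limit_deriv[OF that])
    show "continuous_on {0<..} g" unfolding g_def by (intro continuous_intros) auto
    show "0 \<le> g c" if "0 < c" for c by (simp add: g_def)
  qed (assumption | rule q sn)+
  obtain a where a: "a \<in> {0..1}" "\<And>t. t \<in> {0..1} \<Longrightarrow> f a \<le> f t"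
    using continuous_attains_inf[OF _ _ f] by auto
  obtain c where c: "c \<in> {0..1}" "\<And>t. t \<in> {0..1} \<Longrightarrow> f t \<le> f c"
    using continuous_attains_sup[OF _ _ f] by auto
  have l: "0 < f a / 2" "f a / 2 \<le> 2 * f c" using fpos[OF a(1)] a(2)[OF c(1)] by auto
  obtain C where C: "\<forall>\<^sub>F b in at_top. \<forall>c\<in>{f a / 2..2 * f c}.
    \<bar>exceed_prob (1 - 2 * c\<^sup>2 / b\<^sup>2) (b + x / b) (b + y / b) / Phi_bar b - exceed_limit x y c\<bar> \<le> C / b\<^sup>2"
    using exceed_prob_asymp[OF l] by blast
  have C': "\<forall>\<^sub>F n in sequentially. \<forall>c\<in>{f a / 2..2 * f c}.
    \<bar>exceed_prob (1 - 2 * c\<^sup>2 / (b n)\<^sup>2) (b n + x / b n) (b n + y / b n) / Phi_bar (b n) - exceed_limit x y c\<bar> \<le> C / (b n)\<^sup>2"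
    using C bt by (rule eventually_compose_filterlim)
  have r1: "\<forall>\<^sub>F n in sequentially. 1 / 2 < r n" "\<forall>\<^sub>F n in sequentially. r n < 2"
    by (rule order_tendstoD[OF q(1)]; simp)+
  have bpos: "\<forall>\<^sub>F n in sequentially. 0 < b n" using bt by (simp add: filterlim_at_top_dense)
  have lpos: "\<forall>\<^sub>F n in sequentially. 1 < ln (real n)" by real_asymp
  have spos: "\<forall>\<^sub>F n in sequentially. 0 < s n" unfolding s_def by real_asymp
  let ?p = "\<lambda>n i. exceed_prob (1 - m (real i / real n) / ln (real n)) (b n + x / b n) (b n + y / b n)"
  have two: "(\<lambda>n. s n * ((\<Sum>i=1..n. ?p n i) - (\<Sum>i=1..n. G (r n * f (real i / n))) / n)) \<longlonglongrightarrow> 0"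
  proof (rule Lim_null_comparison)
    show "\<forall>\<^sub>F n in sequentially. norm (s n * ((\<Sum>i=1..n. ?p n i) - (\<Sum>i=1..n. G (r n * f (real i / n))) / n)) \<le> C * (s n / (b n)\<^sup>2)"
      using C' r1 bpos lpos spos eventually_ge_at_top[of "max n0 1"]
    proof eventually_elim
      case (elim n)
      have n: "n0 \<le> n" "0 < n" using elim by auto
      have "\<bar>?p n i - G (r n * f (real i / n)) / n\<bar> \<le> C / (b n)\<^sup>2 / n" if i: "i \<in> {1..n}" for i
      proof -
        let ?t = "real i / n"
        have t: "?t \<in> {0..1}" using i by auto
        have ft: "f a \<le> f ?t" "f ?t \<le> f c" "0 < f ?t" "0 < f a" using a c t fpos by auto
        have "f a / 2 \<le> r n * f ?t" using mult_mono[of "1/2" "r n" "f a" "f ?t"] elim ft by simp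
        moreover have "r n * f ?t \<le> 2 * f c" using mult_mono[of "r n" 2 "f ?t" "f c"] elim ft by simp
        ultimately have "r n * f ?t \<in> {f a / 2..2 * f c}" by simp
        moreover have "2 * (r n * f ?t)\<^sup>2 / (b n)\<^sup>2 = m ?t / ln (real n)"
          using elim m_pos[OF t] by (simp add: r_def f_def power_mult_distrib power_divide)
        ultimately have le: "\<bar>?p n i / Phi_bar (b n) - G (r n * f ?t)\<bar> \<le> C / (b n)\<^sup>2"
          using elim(1) unfolding G_def by metis
        \<comment> \<open>By the choice of \<open>b n\<close>, dividing by the tail
          \<open>Phi_bar (b n)\<close> is multiplying by \<open>n\<close>.\<close>
        have eq: "?p n i - G (r n * f ?t) / n = (?p n i / Phi_bar (b n) - G (r n * f ?t)) / n"
          using n b n by (simp add: diff_divide_distrib)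
        show ?thesis unfolding eq abs_divide using divide_right_mono[OF le, of "real n"] by simp
      qed
      then have "\<bar>\<Sum>i=1..n. ?p n i - G (r n * f (real i / n)) / n\<bar> \<le> (\<Sum>i=1..n. C / (b n)\<^sup>2 / n)"
        by (intro order_trans[OF sum_abs] sum_mono) auto
      also have "\<dots> = C / (b n)\<^sup>2" using n by simp
      finally have "\<bar>(\<Sum>i=1..n. ?p n i) - (\<Sum>i=1..n. G (r n * f (real i / n))) / n\<bar> \<le> C / (b n)\<^sup>2"
        by (simp add: sum_subtractf sum_divide_distrib)
      then have "s n * \<bar>(\<Sum>i=1..n. ?p n i) - (\<Sum>i=1..n. G (r n * f (real i / n))) / n\<bar> \<le> s n * (C / (b n)\<^sup>2)"
        using elim by (intro mult_left_mono) auto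
      then show ?case using elim by (simp add: abs_mult mult_ac)
    qed
    show "(\<lambda>n. C * (s n / (b n)\<^sup>2)) \<longlonglongrightarrow> 0" using tendsto_mult_right_zero[OF q(3)] by blast
  qed
  have "(\<lambda>n. s n * ((\<Sum>i=1..n. ?p n i) - (\<Sum>i=1..n. G (r n * f (real i / n))) / n)
    + s n * ((\<Sum>i=1..n. G (r n * f (real i / n))) / n - integral {0..1} (\<lambda>t. G (f t))))
    \<longlonglongrightarrow> 0 + - (1 / 2) * integral {0..1} (\<lambda>t. f t * g (f t))"
    by (intro tendsto_add one two)
  moreover have "integral {0..1} (\<lambda>t. f t * g (f t)) =
     integral {0..1} (\<lambda>t. 2 * exp (- x) * (sqrt (m t) * std_normal_density (sqrt (m t) + (y - x) / (2 * sqrt (m t)))))"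
    by (simp add: f_def g_def mult_ac)
  ultimately show ?thesis
    by (simp add: Henstock_Kurzweil_Integration.integral_mult_right s_def f_def G_def right_diff_distrib)
qed

section \<open>Row events as products over independent vectors\<close>

lemma (in prob_space) prob_all_not:
  fixes X Y :: "nat \<Rightarrow> 'a \<Rightarrow> real"
  assumes ind: "indep_vars (\<lambda>_. borel :: (real \<times> real) measure) (\<lambda>i \<omega>. (X i \<omega>, Y i \<omega>)) {1..n}"
    and n: "0 < n" and R: "{z. R (fst z) (snd z)} \<in> sets (borel :: (real \<times> real) measure)"
  shows "prob {\<omega> \<in> space M. \<forall>i\<in>{1..n}. \<not> R (X i \<omega>) (Y i \<omega>)} = (\<Prod>i=1..n. 1 - prob {\<omega> \<in> space M. R (X i \<omega>) (Y i \<omega>)})"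
proof -
  let ?B = "{z. \<not> R (fst z) (snd z)}"
  have B: "?B \<in> sets borel" using borel_comp[OF R] by (simp add: Compl_eq)
  have "prob (\<Inter>i\<in>{1..n}. (\<lambda>\<omega>. (X i \<omega>, Y i \<omega>)) -` ?B \<inter> space M) = (\<Prod>i\<in>{1..n}. prob ((\<lambda>\<omega>. (X i \<omega>, Y i \<omega>)) -` ?B \<inter> space M))"
    by (rule indep_varsD_finite[OF ind]) (use n B in auto)
  also have "(\<Inter>i\<in>{1..n}. (\<lambda>\<omega>. (X i \<omega>, Y i \<omega>)) -` ?B \<inter> space M) = {\<omega> \<in> space M. \<forall>i\<in>{1..n}. \<not> R (X i \<omega>) (Y i \<omega>)}"
    using n by auto
  also have "(\<Prod>i\<in>{1..n}. prob ((\<lambda>\<omega>. (X i \<omega>, Y i \<omega>)) -` ?B \<inter> space M)) = (\<Prod>i=1..n. 1 - prob {\<omega> \<in> space M. R (X i \<omega>) (Y i \<omega>)})"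
  proof (rule prod.cong)
    fix i assume i: "i \<in> {1..n}"
    have "(\<lambda>\<omega>. (X i \<omega>, Y i \<omega>)) \<in> measurable M borel" using ind i by (auto simp: indep_vars_def)
    from measurable_sets[OF this R]
    have "{\<omega> \<in> space M. R (X i \<omega>) (Y i \<omega>)} \<in> sets M" by (simp add: vimage_def Int_def conj_commute)
    from prob_compl[OF this]
    moreover have "(\<lambda>\<omega>. (X i \<omega>, Y i \<omega>)) -` ?B \<inter> space M = space M - {\<omega> \<in> space M. R (X i \<omega>) (Y i \<omega>)}"
      by auto
    ultimately show "prob ((\<lambda>\<omega>. (X i \<omega>, Y i \<omega>)) -` ?B \<inter> space M) = 1 - prob {\<omega> \<in> space M. R (X i \<omega>) (Y i \<omega>)}"
      by (simp only:)
  qed simp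
  finally show ?thesis .
qed

text \<open>An upper bound on a minimum is not a condition on all vectors, but its negation
  \<open>X i > s\<close> for all \<open>i\<close> is. Taking complements inside the event for the
  maxima leaves four events that each constrain every vector separately and so factor by
  independence.\<close>

lemma (in prob_space) prob_max_min_inclusion_exclusion:
  fixes X Y :: "nat \<Rightarrow> 'a \<Rightarrow> real"
  assumes [measurable]: "\<And>i. i \<in> {1..n} \<Longrightarrow> X i \<in> borel_measurable M" "\<And>i. i \<in> {1..n} \<Longrightarrow> Y i \<in> borel_measurable M"
    and n: "0 < n"
  shows "prob {\<omega> \<in> space M. Max ((\<lambda>i. X i \<omega>) ` {1..n}) \<le> u \<and> Max ((\<lambda>i. Y i \<omega>) ` {1..n}) \<le> v \<and>
      Min ((\<lambda>i. X i \<omega>) ` {1..n}) \<le> s \<and> Min ((\<lambda>i. Y i \<omega>) ` {1..n}) \<le> t} =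
    prob {\<omega> \<in> space M. \<forall>i\<in>{1..n}. \<not> (u < X i \<omega> \<or> v < Y i \<omega>)}
    - prob {\<omega> \<in> space M. \<forall>i\<in>{1..n}. \<not> ((u < X i \<omega> \<or> v < Y i \<omega>) \<or> X i \<omega> \<le> s)}
    - prob {\<omega> \<in> space M. \<forall>i\<in>{1..n}. \<not> ((u < X i \<omega> \<or> v < Y i \<omega>) \<or> Y i \<omega> \<le> t)}
    + prob {\<omega> \<in> space M. \<forall>i\<in>{1..n}. \<not> ((u < X i \<omega> \<or> v < Y i \<omega>) \<or> (X i \<omega> \<le> s \<or> Y i \<omega> \<le> t))}"
    (is "prob ?E = prob ?U - prob ?A - prob ?B + prob ?AB")
proof -
  have [measurable]: "?U \<in> sets M" "?A \<in> sets M" "?B \<in> sets M" by measurable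
  have "?E = ?U - (?A \<union> ?B)"
    using n by (auto simp: Max_le_iff Min_le_iff not_less not_le)
  moreover have "?A \<union> ?B \<subseteq> ?U" by auto
  ultimately have "prob ?E = prob ?U - prob (?A \<union> ?B)" by (simp add: finite_measure_Diff)
  also have "prob (?A \<union> ?B) = prob ?A + prob ?B - prob (?A \<inter> ?B)"
    by (rule measure_Un3) (auto simp: fmeasurable_eq_sets)
  also have "?A \<inter> ?B = ?AB" by auto
  finally show ?thesis by simp
qed

text \<open>Allows the exact probabilities \<open>p\<close> to be known only through approximations
  \<open>q\<close>: \<open>\<delta>\<close> is the error per vector and must be
  \<open>o(1 / (n * s n))\<close>, while \<open>\<tau>\<close> bounds \<open>q\<close> and yields
  the uniform bound of order \<open>1 / n\<close>.\<close>

lemma prod_one_minus_perturbed_expansion: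
  fixes p q :: "nat \<Rightarrow> nat \<Rightarrow> real" and s \<delta> \<tau> :: "nat \<Rightarrow> real"
  assumes p: "\<forall>\<^sub>F n in sequentially. \<forall>i\<in>{1..n}. 0 \<le> p n i \<and> p n i \<le> 1 \<and> \<bar>p n i - q n i\<bar> \<le> \<delta> n \<and> q n i \<le> \<tau> n"
    and s: "filterlim s at_top sequentially" and sn: "(\<lambda>n. s n / n) \<longlonglongrightarrow> 0"
    and \<delta>: "(\<lambda>n. s n * (real n * \<delta> n)) \<longlonglongrightarrow> 0" and \<tau>: "(\<lambda>n. real n * (\<tau> n + \<delta> n)) \<longlonglongrightarrow> B"
    and sum: "(\<lambda>n. s n * ((\<Sum>i=1..n. q n i) - A)) \<longlonglongrightarrow> L"
  shows "(\<lambda>n. s n * ((\<Prod>i=1..n. 1 - p n i) - exp (- A))) \<longlonglongrightarrow> - exp (- A) * L"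
proof (rule prod_one_minus_expansion[OF _ s sn])
  have spos: "\<forall>\<^sub>F n in sequentially. 0 < s n" using s by (simp add: filterlim_at_top_dense)
  have "\<forall>\<^sub>F n in sequentially. real n * (\<tau> n + \<delta> n) < B + 1" using \<tau> by (rule order_tendstoD) simp
  then show "\<forall>\<^sub>F n in sequentially. \<forall>i\<in>{1..n}. 0 \<le> p n i \<and> p n i \<le> 1 \<and> p n i \<le> (B + 1) / n"
    using p
  proof eventually_elim
    case (elim n)
    show ?case
    proof
      fix i assume i: "i \<in> {1..n}"
      then have "p n i \<le> \<tau> n + \<delta> n" using elim(2) by fastforce
      also have "\<dots> \<le> (B + 1) / n" using i elim(1) by (simp add: pos_le_divide_eq mult.commute)
      finally show "0 \<le> p n i \<and> p n i \<le> 1 \<and> p n i \<le> (B + 1) / n" using elim(2) i by blast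
    qed
  qed
  have diff: "(\<lambda>n. s n * ((\<Sum>i=1..n. p n i) - (\<Sum>i=1..n. q n i))) \<longlonglongrightarrow> 0"
  proof (rule Lim_null_comparison[OF _ \<delta>])
    show "\<forall>\<^sub>F n in sequentially. norm (s n * ((\<Sum>i=1..n. p n i) - (\<Sum>i=1..n. q n i))) \<le> s n * (real n * \<delta> n)"
      using p spos
    proof eventually_elim
      case (elim n)
      have "\<bar>(\<Sum>i=1..n. p n i) - (\<Sum>i=1..n. q n i)\<bar> \<le> (\<Sum>i=1..n. \<delta> n)"
        unfolding sum_subtractf[symmetric] using elim(1) by (intro order_trans[OF sum_abs] sum_mono) blast
      then show ?case using elim(2) by (simp add: abs_mult)
    qed
  qed
  have "(\<lambda>n. s n * ((\<Sum>i=1..n. p n i) - (\<Sum>i=1..n. q n i)) + s n * ((\<Sum>i=1..n. q n i) - A)) \<longlonglongrightarrow> 0 + L"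
    by (intro tendsto_add diff sum)
  then show "(\<lambda>n. s n * ((\<Sum>i=1..n. p n i) - A)) \<longlonglongrightarrow> L" by (simp add: algebra_simps)
qed

theorem theorem2:
  fixes m :: "real \<Rightarrow> real" and n0 :: nat
    and M :: "nat \<Rightarrow> 'a measure"
    and \<xi> \<eta> :: "nat \<Rightarrow> nat \<Rightarrow> 'a \<Rightarrow> real"
    and b P :: "nat \<Rightarrow> real"
    and x1 y1 x2 y2 :: real
  assumes m_pos: "\<And>t. t \<in> {0..1} \<Longrightarrow> 0 < m t"
    and m_cont: "continuous_on {0..1} m"
    and m_monotone: "mono_on {0..1} m \<or> antimono_on {0..1} m"
    and n0: "3 \<le> n0"
    and m_le: "\<And>t n. t \<in> {0..1} \<Longrightarrow> n0 \<le> n \<Longrightarrow> m t \<le> 2 * ln (real n)"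
    and prob_space: "\<And>n. n0 \<le> n \<Longrightarrow> prob_space (M n)"
    and gaussian: "\<And>n i. n0 \<le> n \<Longrightarrow> i \<in> {1..n} \<Longrightarrow> bivariate_gaussian (M n) (\<xi> n i) (\<eta> n i)"
    and indep: "\<And>n. n0 \<le> n \<Longrightarrow>
      prob_space.indep_vars (M n) (\<lambda>_. borel :: (real \<times> real) measure) (\<lambda>i \<omega>. (\<xi> n i \<omega>, \<eta> n i \<omega>)) {1..n}"
    and mean_\<xi>: "\<And>n i. n0 \<le> n \<Longrightarrow> i \<in> {1..n} \<Longrightarrow> prob_space.expectation (M n) (\<xi> n i) = 0"
    and mean_\<eta>: "\<And>n i. n0 \<le> n \<Longrightarrow> i \<in> {1..n} \<Longrightarrow> prob_space.expectation (M n) (\<eta> n i) = 0"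
    and second_moment_\<xi>: "\<And>n i. n0 \<le> n \<Longrightarrow> i \<in> {1..n} \<Longrightarrow>
      prob_space.expectation (M n) (\<lambda>\<omega>. (\<xi> n i \<omega>)\<^sup>2) = 1"
    and second_moment_\<eta>: "\<And>n i. n0 \<le> n \<Longrightarrow> i \<in> {1..n} \<Longrightarrow>
      prob_space.expectation (M n) (\<lambda>\<omega>. (\<eta> n i \<omega>)\<^sup>2) = 1"
    and corr: "\<And>n i. n0 \<le> n \<Longrightarrow> i \<in> {1..n} \<Longrightarrow>
      correlation (M n) (\<xi> n i) (\<eta> n i) = 1 - m (real i / real n) / ln (real n)"
    and b: "\<And>n. n0 \<le> n \<Longrightarrow> 1 - Phi (b n) = 1 / real n"
    and P: "\<And>n. n0 \<le> n \<Longrightarrow> P n = measure (M n) {\<omega> \<in> space (M n).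
        row_max \<xi> n \<omega> \<le> b n + x2 / b n \<and> row_max \<eta> n \<omega> \<le> b n + y2 / b n \<and>
        row_min \<xi> n \<omega> \<le> - b n + x1 / b n \<and> row_min \<eta> n \<omega> \<le> - b n + y1 / b n}"
  shows "(\<lambda>n. 2 * ln (real n) / ln (ln (real n)) * (P n - H m x2 y2 * H_tilde m x1 y1))
    \<longlonglongrightarrow>
      H m x2 y2 * H_tilde m x1 y1 * exp (- x2) *
        integral {0..1} (\<lambda>t. sqrt (m t) * std_normal_density (sqrt (m t) + (y2 - x2) / (2 * sqrt (m t))))
      + H m x2 y2 * H m (- x1) (- y1) * exp x1 *
        integral {0..1} (\<lambda>t. sqrt (m t) * std_normal_density (sqrt (m t) + (x1 - y1) / (2 * sqrt (m t))))"
proof -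
  define s where "s = (\<lambda>n. 2 * ln (real n) / ln (ln (real n)))"
  define A where "A = (\<lambda>x y. integral {0..1} (\<lambda>t. exceed_limit x y (sqrt (m t))))"
  define K where "K = (\<lambda>x y. exp (- x) * integral {0..1} (\<lambda>t. sqrt (m t) * std_normal_density (sqrt (m t) + (y - x) / (2 * sqrt (m t)))))"
  define q where "q = (\<lambda>x n. Phi_bar (b n + x / b n))"
  define \<rho> where "\<rho> = (\<lambda>n i. 1 - m (real i / real n) / ln (real n))"
  define ex where "ex = (\<lambda>x y n i. exceed_prob (\<rho> n i) (b n + x / b n) (b n + y / b n))"
  have b': "\<forall>n\<ge>n0. Phi_bar (b n) = 1 / real n" using b by blast
  note bt = Phi_bar_quantile_at_top[OF b']
  have s_top: "filterlim s at_top sequentially" unfolding s_def by real_asymp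
  have sn: "(\<lambda>n. s n / n) \<longlonglongrightarrow> 0" unfolding s_def by real_asymp
  have q_lim: "(\<lambda>n. real n * q x n) \<longlonglongrightarrow> exp (- x)"
    and q_exp: "(\<lambda>n. s n * (real n * q x n - exp (- x))) \<longlonglongrightarrow> 0" for x
    using tail_scaled_asymp[OF b', of x] unfolding q_def s_def by blast+
  have ex_sum: "(\<lambda>n. s n * ((\<Sum>i=1..n. ex x y n i) - A x y)) \<longlonglongrightarrow> - K x y" for x y
    unfolding s_def ex_def \<rho>_def A_def K_def
    by (rule exceed_sum_asymp[OF m_pos m_cont m_monotone b'])
  have ex_le: "ex x y n i \<le> q x n + q y n" for x y n i unfolding ex_def q_def by (rule exceed_prob_le)
  have q_pos: "0 < q x n" for x n unfolding q_def by (rule Phi_bar_pos)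
  \<comment> \<open>\<open>\<delta>\<close> is the overlap bound of
    \<open>exceed_or_below_prob\<close>. Each \<open>q\<close> is of order \<open>1 / n\<close>, so
    \<open>n * \<delta> n\<close> is of order \<open>1 / n\<close> and still vanishes after
    multiplication by \<open>s n\<close>. \<open>\<tau>\<close> dominates the approximate
    probabilities in all four products.\<close>
  define \<delta> where "\<delta> = (\<lambda>n. q x2 n * q (- y1) n + q y2 n * q (- x1) n)"
  define \<tau> where "\<tau> = (\<lambda>n. q x2 n + q y2 n + q (- x1) n + q (- y1) n)"
  have d0: "(\<lambda>n. s n / n * ((real n * q x2 n) * (real n * q (- y1) n) + (real n * q y2 n) * (real n * q (- x1) n)))
      \<longlonglongrightarrow> 0 * (exp (- x2) * exp (- (- y1)) + exp (- y2) * exp (- (- x1)))"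
    by (intro tendsto_intros sn q_lim)
  have s\<delta>: "(\<lambda>n. s n * (real n * \<delta> n)) \<longlonglongrightarrow> 0"
  proof (rule Lim_transform_eventually)
    show "(\<lambda>n. s n / n * ((real n * q x2 n) * (real n * q (- y1) n) + (real n * q y2 n) * (real n * q (- x1) n))) \<longlonglongrightarrow> 0"
      using d0 by simp
    show "\<forall>\<^sub>F n in sequentially. s n / n * ((real n * q x2 n) * (real n * q (- y1) n) + (real n * q y2 n) * (real n * q (- x1) n)) = s n * (real n * \<delta> n)"
      using eventually_gt_at_top[of 0] by eventually_elim (simp add: \<delta>_def field_simps)
  qed
  have n_inv: "(\<lambda>n. inverse (real n)) \<longlonglongrightarrow> 0" by real_asymp
  have "(\<lambda>n. inverse (real n) * ((real n * q x2 n) * (real n * q (- y1) n) + (real n * q y2 n) * (real n * q (- x1) n)))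
      \<longlonglongrightarrow> 0 * (exp (- x2) * exp (- (- y1)) + exp (- y2) * exp (- (- x1)))"
    by (intro tendsto_intros n_inv q_lim)
  then have n\<delta>: "(\<lambda>n. real n * \<delta> n) \<longlonglongrightarrow> 0 * (exp (- x2) * exp (- (- y1)) + exp (- y2) * exp (- (- x1)))"
  proof (rule Lim_transform_eventually)
    show "\<forall>\<^sub>F n in sequentially. inverse (real n) * ((real n * q x2 n) * (real n * q (- y1) n) + (real n * q y2 n) * (real n * q (- x1) n)) = real n * \<delta> n"
      using eventually_gt_at_top[of 0] by eventually_elim (simp add: \<delta>_def field_simps)
  qed
  have "(\<lambda>n. real n * q x2 n + real n * q y2 n + real n * q (- x1) n + real n * q (- y1) n + real n * \<delta> n)
      \<longlonglongrightarrow> exp (- x2) + exp (- y2) + exp (- (- x1)) + exp (- (- y1)) + 0 * (exp (- x2) * exp (- (- y1)) + exp (- y2) * exp (- (- x1)))"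
    by (intro tendsto_add q_lim n\<delta>)
  then obtain B where n\<tau>: "(\<lambda>n. real n * (\<tau> n + \<delta> n)) \<longlonglongrightarrow> B"
    by (auto simp: \<tau>_def distrib_left add.assoc)
  \<comment> \<open>What a single vector must avoid in each of the four products: exceeding a high
    level (\<open>R1\<close>), and in addition a low first coordinate (\<open>R2\<close>), a low
    second one (\<open>R3\<close>), or either (\<open>R4\<close>).\<close>
  define R1 where "R1 = (\<lambda>n X Y. b n + x2 / b n < X \<or> b n + y2 / b n < (Y::real))"
  define R2 where "R2 = (\<lambda>n X Y. R1 n X Y \<or> X \<le> - b n + x1 / b n)"
  define R3 where "R3 = (\<lambda>n X Y. R1 n X Y \<or> Y \<le> - b n + y1 / b n)"
  define R4 where "R4 = (\<lambda>n X Y. R1 n X Y \<or> (X \<le> - b n + x1 / b n \<or> Y \<le> - b n + y1 / b n))"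
  define p where "p = (\<lambda>R n i. measure (M n) {\<omega> \<in> space (M n). R n (\<xi> n i \<omega>) (\<eta> n i \<omega>)})"
  have lower: "Phi (- b n + x / b n) = q (- x) n" for x n
    using Phi_minus[of "b n + (- x) / b n"] by (simp add: q_def)
  have bn: "std_bivariate_normal (M n) (\<xi> n i) (\<eta> n i) (\<rho> n i)" if "n0 \<le> n" "i \<in> {1..n}" for n i
    unfolding \<rho>_def
    by (rule prob_space.std_bivariate_normalI[OF prob_space[OF that(1)] gaussian[OF that] mean_\<xi>[OF that] mean_\<eta>[OF that]
          second_moment_\<xi>[OF that] second_moment_\<eta>[OF that] corr[OF that]])
  \<comment> \<open>The maximum \<open>c\<close> of \<open>m\<close> is needed because
    \<open>opposite_prob_le\<close> asks for a nonnegative correlation, which holds throughout a row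
    as soon as \<open>ln n > c\<close>; the finitely many other rows do not affect the
    limit.\<close>
  have "\<exists>x\<in>{0..1}. \<forall>t\<in>{0..1}. m t \<le> m x"
    by (rule continuous_attains_sup[OF _ _ m_cont]) auto
  then obtain c where c: "\<And>t. t \<in> {0..1} \<Longrightarrow> m t \<le> c" by blast
  have "filterlim (\<lambda>n. ln (real n)) at_top sequentially" by real_asymp
  then have ln_c: "\<forall>\<^sub>F n in sequentially. c < ln (real n)" by (simp add: filterlim_at_top_dense)
  have ln_1: "\<forall>\<^sub>F n in sequentially. 1 < ln (real n)" by real_asymp
  have pos: "\<forall>\<^sub>F n in sequentially. 0 < b n + x / b n" for x
  proof -
    have "filterlim (\<lambda>b. b + x / b) at_top at_top" by real_asymp
    then have "filterlim (\<lambda>n. b n + x / b n) at_top sequentially" using bt by (rule filterlim_compose)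
    then show ?thesis by (simp add: filterlim_at_top_dense)
  qed
  have close: "\<forall>\<^sub>F n in sequentially. \<forall>i\<in>{1..n}.
      p R1 n i = ex x2 y2 n i \<and>
      \<bar>p R2 n i - (ex x2 y2 n i + q (- x1) n)\<bar> \<le> \<delta> n \<and>
      \<bar>p R3 n i - (ex x2 y2 n i + q (- y1) n)\<bar> \<le> \<delta> n \<and>
      \<bar>p R4 n i - (ex x2 y2 n i + ex (- x1) (- y1) n i)\<bar> \<le> \<delta> n"
    using ln_c ln_1 pos[of x2] pos[of y2] pos[of "- x1"] pos[of "- y1"] eventually_ge_at_top[of n0]
  proof (eventually_elim, intro ballI)
    fix n i assume n: "c < ln (real n)" "1 < ln (real n)" "0 < b n + x2 / b n" "0 < b n + y2 / b n"
        "0 < b n + - x1 / b n" "0 < b n + - y1 / b n" "n0 \<le> n" and i: "i \<in> {1..n}"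
    interpret prob_space "M n" by (rule prob_space[OF n(7)])
    have t: "real i / real n \<in> {0..1}" using i by auto
    have "0 < m (real i / real n)" "m (real i / real n) \<le> c" using m_pos[OF t] c[OF t] by auto
    then have r: "0 \<le> \<rho> n i" "\<rho> n i < 1" using n by (auto simp: \<rho>_def)
    have st: "- b n + x1 / b n \<le> 0" "- b n + y1 / b n \<le> 0" using n by simp_all
    have neg: "- (- b n + x / b n) = b n + - x / b n" for x by simp
    have "p R1 n i = ex x2 y2 n i"
      unfolding p_def R1_def ex_def by (rule exceed_prob(1)[OF bn[OF n(7) i]]) (use r in simp)
    with exceed_or_below_prob[OF bn[OF n(7) i] r n(3,4) st]
    show "p R1 n i = ex x2 y2 n i \<and>
      \<bar>p R2 n i - (ex x2 y2 n i + q (- x1) n)\<bar> \<le> \<delta> n \<and>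
      \<bar>p R3 n i - (ex x2 y2 n i + q (- y1) n)\<bar> \<le> \<delta> n \<and>
      \<bar>p R4 n i - (ex x2 y2 n i + ex (- x1) (- y1) n i)\<bar> \<le> \<delta> n"
      unfolding lower neg p_def R1_def R2_def R3_def R4_def ex_def \<delta>_def q_def
      by blast
  qed
  have p01: "\<forall>\<^sub>F n in sequentially. \<forall>i\<in>{1..n}. 0 \<le> p R n i \<and> p R n i \<le> 1" for R
    using eventually_ge_at_top[of n0]
  proof eventually_elim
    case (elim n)
    interpret prob_space "M n" by (rule prob_space[OF elim])
    show ?case by (simp add: p_def)
  qed
  have \<delta>_nonneg: "0 \<le> \<delta> n" for n unfolding \<delta>_def using q_pos by (intro add_nonneg_nonneg mult_nonneg_nonneg less_imp_le)
  have asymp: "(\<lambda>n. s n * ((\<Prod>i=1..n. 1 - p R n i) - exp (- a))) \<longlonglongrightarrow> - exp (- a) * L"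
    if close_R: "\<forall>\<^sub>F n in sequentially. \<forall>i\<in>{1..n}. \<bar>p R n i - f n i\<bar> \<le> \<delta> n"
      and f: "\<And>n i. f n i \<le> \<tau> n" and sum: "(\<lambda>n. s n * ((\<Sum>i=1..n. f n i) - a)) \<longlonglongrightarrow> L" for R f a L
  proof (rule prod_one_minus_perturbed_expansion[OF _ s_top sn s\<delta> n\<tau> sum])
    show "\<forall>\<^sub>F n in sequentially. \<forall>i\<in>{1..n}. 0 \<le> p R n i \<and> p R n i \<le> 1 \<and> \<bar>p R n i - f n i\<bar> \<le> \<delta> n \<and> f n i \<le> \<tau> n"
      using p01[of R] close_R by eventually_elim (use f in blast)
  qed
  have lim1: "(\<lambda>n. s n * ((\<Prod>i=1..n. 1 - p R1 n i) - exp (- A x2 y2))) \<longlonglongrightarrow> - exp (- A x2 y2) * (- K x2 y2)"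
  proof (rule asymp[OF _ _ ex_sum])
    show "\<forall>\<^sub>F n in sequentially. \<forall>i\<in>{1..n}. \<bar>p R1 n i - ex x2 y2 n i\<bar> \<le> \<delta> n"
      using close by eventually_elim (use \<delta>_nonneg in simp)
    show "ex x2 y2 n i \<le> \<tau> n" for n i
      using ex_le[of x2 y2 n i] q_pos[of "- x1" n] q_pos[of "- y1" n] by (simp add: \<tau>_def)
  qed
  \<comment> \<open>One low level adds the tail \<open>q x n\<close> to each probability. It
    contributes \<open>exp (- x)\<close> to the exponent and nothing to the correction, which
    remains \<open>- K x2 y2\<close>.\<close>
  have lim_single: "(\<lambda>n. s n * ((\<Sum>i=1..n. ex x2 y2 n i + q x n) - (A x2 y2 + exp (- x)))) \<longlonglongrightarrow> - K x2 y2" for x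
  proof -
    have "(\<lambda>n. s n * ((\<Sum>i=1..n. ex x2 y2 n i) - A x2 y2) + s n * (real n * q x n - exp (- x))) \<longlonglongrightarrow> - K x2 y2 + 0"
      by (intro tendsto_add ex_sum q_exp)
    then show ?thesis by (simp add: sum.distrib algebra_simps)
  qed
  have lim2: "(\<lambda>n. s n * ((\<Prod>i=1..n. 1 - p R2 n i) - exp (- (A x2 y2 + exp (- (- x1)))))) \<longlonglongrightarrow> - exp (- (A x2 y2 + exp (- (- x1)))) * (- K x2 y2)"
  proof (rule asymp[OF _ _ lim_single])
    show "\<forall>\<^sub>F n in sequentially. \<forall>i\<in>{1..n}. \<bar>p R2 n i - (ex x2 y2 n i + q (- x1) n)\<bar> \<le> \<delta> n"
      using close by eventually_elim blast
    show "ex x2 y2 n i + q (- x1) n \<le> \<tau> n" for n i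
      using ex_le[of x2 y2 n i] q_pos[of "- y1" n] by (simp add: \<tau>_def)
  qed
  have lim3: "(\<lambda>n. s n * ((\<Prod>i=1..n. 1 - p R3 n i) - exp (- (A x2 y2 + exp (- (- y1)))))) \<longlonglongrightarrow> - exp (- (A x2 y2 + exp (- (- y1)))) * (- K x2 y2)"
  proof (rule asymp[OF _ _ lim_single])
    show "\<forall>\<^sub>F n in sequentially. \<forall>i\<in>{1..n}. \<bar>p R3 n i - (ex x2 y2 n i + q (- y1) n)\<bar> \<le> \<delta> n"
      using close by eventually_elim blast
    show "ex x2 y2 n i + q (- y1) n \<le> \<tau> n" for n i
      using ex_le[of x2 y2 n i] q_pos[of "- x1" n] by (simp add: \<tau>_def)
  qed
  have lim4: "(\<lambda>n. s n * ((\<Prod>i=1..n. 1 - p R4 n i) - exp (- (A x2 y2 + A (- x1) (- y1)))))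
      \<longlonglongrightarrow> - exp (- (A x2 y2 + A (- x1) (- y1))) * (- K x2 y2 + - K (- x1) (- y1))"
  proof (rule asymp)
    show "\<forall>\<^sub>F n in sequentially. \<forall>i\<in>{1..n}. \<bar>p R4 n i - (ex x2 y2 n i + ex (- x1) (- y1) n i)\<bar> \<le> \<delta> n"
      using close by eventually_elim blast
    show "ex x2 y2 n i + ex (- x1) (- y1) n i \<le> \<tau> n" for n i
      using ex_le[of x2 y2 n i] ex_le[of "- x1" "- y1" n i] by (simp add: \<tau>_def)
    have "(\<lambda>n. s n * ((\<Sum>i=1..n. ex x2 y2 n i) - A x2 y2) + s n * ((\<Sum>i=1..n. ex (- x1) (- y1) n i) - A (- x1) (- y1)))
        \<longlonglongrightarrow> - K x2 y2 + - K (- x1) (- y1)"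
      by (intro tendsto_add ex_sum)
    then show "(\<lambda>n. s n * ((\<Sum>i=1..n. ex x2 y2 n i + ex (- x1) (- y1) n i) - (A x2 y2 + A (- x1) (- y1))))
        \<longlonglongrightarrow> - K x2 y2 + - K (- x1) (- y1)"
      by (simp add: sum.distrib algebra_simps)
  qed
  have "{z. u < fst z} \<in> sets borel" "{z. v < snd z} \<in> sets borel"
    "{z. fst z \<le> u} \<in> sets borel" "{z. snd z \<le> v} \<in> sets borel" for u v :: real
    by ((rule borel_open, intro open_Collect_less continuous_intros)
      | (rule borel_closed, intro closed_Collect_le continuous_intros))+
  then have R_sets: "{z. R1 n (fst z) (snd z)} \<in> sets borel" "{z. R2 n (fst z) (snd z)} \<in> sets borel"
    "{z. R3 n (fst z) (snd z)} \<in> sets borel" "{z. R4 n (fst z) (snd z)} \<in> sets borel" for n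
    unfolding R2_def R3_def R4_def R1_def Collect_disj_eq by (intro sets.Un; blast)+
  have P_eq: "\<forall>\<^sub>F n in sequentially. P n = (\<Prod>i=1..n. 1 - p R1 n i) - (\<Prod>i=1..n. 1 - p R2 n i)
      - (\<Prod>i=1..n. 1 - p R3 n i) + (\<Prod>i=1..n. 1 - p R4 n i)"
    using eventually_ge_at_top[of n0]
  proof eventually_elim
    case (elim n)
    interpret prob_space "M n" by (rule prob_space[OF elim])
    have n: "0 < n" using elim n0 by simp
    note prod = prob_all_not[OF indep[OF elim] n, symmetric]
    have meas: "\<xi> n i \<in> borel_measurable (M n)" "\<eta> n i \<in> borel_measurable (M n)" if "i \<in> {1..n}" for i
      using gaussian[OF elim that] by (auto simp: bivariate_gaussian_def)
    show ?case
      unfolding P[OF elim] row_max_def row_min_def p_def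
      unfolding prod[of "R1 n", OF R_sets(1)] prod[of "R2 n", OF R_sets(2)] prod[of "R3 n", OF R_sets(3)] prod[of "R4 n", OF R_sets(4)]
      unfolding R2_def R3_def R4_def R1_def
      by (rule prob_max_min_inclusion_exclusion[OF meas n])
  qed
  have H: "H m x y = exp (- A x y)" for x y
    unfolding A_def by (rule H_eq_exp_integral[OF m_pos m_cont])
  have L: "Lambda (- x) = exp (- exp (- (- x)))" for x by (simp add: Lambda_def)
  have "(\<lambda>n. s n * ((\<Prod>i=1..n. 1 - p R1 n i) - exp (- A x2 y2))
      - s n * ((\<Prod>i=1..n. 1 - p R2 n i) - exp (- (A x2 y2 + exp (- (- x1)))))
      - s n * ((\<Prod>i=1..n. 1 - p R3 n i) - exp (- (A x2 y2 + exp (- (- y1)))))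
      + s n * ((\<Prod>i=1..n. 1 - p R4 n i) - exp (- (A x2 y2 + A (- x1) (- y1)))))
    \<longlonglongrightarrow> - exp (- A x2 y2) * (- K x2 y2) - (- exp (- (A x2 y2 + exp (- (- x1)))) * (- K x2 y2))
      - (- exp (- (A x2 y2 + exp (- (- y1)))) * (- K x2 y2))
      + (- exp (- (A x2 y2 + A (- x1) (- y1))) * (- K x2 y2 + - K (- x1) (- y1)))"
    by (intro tendsto_add tendsto_diff lim1 lim2 lim3 lim4)
  \<comment> \<open>\<open>K x2 y2\<close> occurs in all four terms, and their signed exponentials
    add up to \<open>H m x2 y2 * H_tilde m x1 y1\<close>. \<open>K (- x1) (- y1)\<close> occurs only
    in the fourth, whose exponential is \<open>H m x2 y2 * H m (- x1) (- y1)\<close>; this explains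
    the different prefactors of the two integrals.\<close>
  also have "- exp (- A x2 y2) * (- K x2 y2) - (- exp (- (A x2 y2 + exp (- (- x1)))) * (- K x2 y2))
      - (- exp (- (A x2 y2 + exp (- (- y1)))) * (- K x2 y2))
      + (- exp (- (A x2 y2 + A (- x1) (- y1))) * (- K x2 y2 + - K (- x1) (- y1)))
    = H m x2 y2 * H_tilde m x1 y1 * K x2 y2 + H m x2 y2 * H m (- x1) (- y1) * K (- x1) (- y1)"
    unfolding H_tilde_def H L minus_add_distrib exp_add by (simp add: algebra_simps)
  finally have "(\<lambda>n. s n * (P n - H m x2 y2 * H_tilde m x1 y1)) \<longlonglongrightarrow>
      H m x2 y2 * H_tilde m x1 y1 * K x2 y2 + H m x2 y2 * H m (- x1) (- y1) * K (- x1) (- y1)"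
  proof (rule Lim_transform_eventually)
    show "\<forall>\<^sub>F n in sequentially. s n * ((\<Prod>i=1..n. 1 - p R1 n i) - exp (- A x2 y2))
      - s n * ((\<Prod>i=1..n. 1 - p R2 n i) - exp (- (A x2 y2 + exp (- (- x1)))))
      - s n * ((\<Prod>i=1..n. 1 - p R3 n i) - exp (- (A x2 y2 + exp (- (- y1)))))
      + s n * ((\<Prod>i=1..n. 1 - p R4 n i) - exp (- (A x2 y2 + A (- x1) (- y1)))) = s n * (P n - H m x2 y2 * H_tilde m x1 y1)"
      using P_eq
    proof eventually_elim
      case (elim n)
      show ?case
        unfolding elim H_tilde_def H L minus_add_distrib exp_add by (simp add: algebra_simps)
    qed
  qed
  then show ?thesis by (simp add: s_def K_def mult.assoc)
qed

end
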